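(* Let $X$ be a separable Banach space and let $\alpha<\omega_1$ be a countable ordinal. Then $Sz(X)\le \omega^{\alpha+1}$ if and only if $X$ admits an equivalent norm whose dual norm is $\omega^\alpha$-UKK$^*$.
   Context: For a Banach space $X$ and a weak$^*$-compact $A\subset X^*$, the Kuratowski measure of non-compactness $\sigma(A)$ is the infimum of all $\varepsilon>0$ such that $A$ can be covered by finitely many closed balls of diameter $\varepsilon$. For $\varepsilon>0$ set $[\sigma]'_\varepsilon(A)=\{x^*\in A:\ \sigma(A\cap\overline{U}^* )\ge\varepsilon$ for every weak$^*$-neighborhood $U$ of $x^*\}$, where $\overline{U}^*$ is the weak$^*$-closure of $U$. Inductively $[\sigma]^0_\varepsilon(A)=A$, $[\sigma]^{\gamma+1}_\varepsilon(A)=[\sigma]'_\varepsilon([\sigma]^\gamma_\varepsilon(A))$, and $[\sigma]^\gamma_\varepsilon(A)=\bigcap_{\beta<\gamma}[\sigma]^\beta_\varepsilon(A)$ for $\gamma$ a limit ordinal. Let $Sz(A,\varepsilon)=\inf\{\gamma:\ [\sigma]^\gamma_\varepsilon(A)=\emptyset\}$ if such an ordinal exists and $Sz(A,\varepsilon)=\infty$ otherwise; $Sz(A)=\sup_{\varepsilon>0}Sz(A,\varepsilon)$ and the Szlenk index of $X$ is $Sz(X)=Sz(B_{X^*})$, where $B_{X^*}$ is the closed unit ball of $X^*$ ($\infty$ is larger than every ordinal). For $\alpha\in[0,\omega_1)$, the dual norm on $X^*$ is called $\omega^\alpha$-weak$^*$ uniformly Kadets-Klee ($\omega^\alpha$-UKK$^*$)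 if for every $\varepsilon>0$ there exists $\delta>0$ such that $[\sigma]^{\omega^\alpha}_\varepsilon(B_{X^*})\subset(1-\delta)B_{X^*}$ (here $B_{X^*}$ is the closed unit ball of the dual norm under consideration). *)

theory Defs
  imports "HOL-Analysis.Analysis" "HOL-Library.Lattice_Constructions"
begin

section \<open>Ordinals\<close>

text \<open>The ordinals of cardinality at most that of \<open>'a\<close>: order types of well-orders whose field
  is a set of elements of \<open>'a\<close>.\<close>

quotient_type 'a ordinal = "'a rel" / partial: "\<lambda>r s. (r, s) \<in> (ordIso :: ('a rel \<times> 'a rel) set)"
proof (rule part_equivpI)
  have "Well_order ({} :: 'a rel)" by simp
  then show "\<exists>r::'a rel. (r, r) \<in> ordIso" using ordIso_reflexive by blast
  show "symp (\<lambda>r s. (r, s) \<in> (ordIso :: ('a rel \<times> 'a rel) set))"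
    by (auto intro!: sympI ordIso_symmetric)
  show "transp (\<lambda>r s. (r, s) \<in> (ordIso :: ('a rel \<times> 'a rel) set))"
    by (auto intro!: transpI intro: ordIso_transitive)
qed

instantiation ordinal :: (type) wellorder
begin

lift_definition less_eq_ordinal :: "'a ordinal \<Rightarrow> 'a ordinal \<Rightarrow> bool" is "\<lambda>r s. (r, s) \<in> ordLeq"
proof
  fix r r' s s' :: "'a rel"
  assume r: "(r, r') \<in> ordIso" and s: "(s, s') \<in> ordIso"
  show "(r', s') \<in> ordLeq" if "(r, s) \<in> ordLeq"
    by (rule ordIso_ordLeq_trans[OF ordIso_symmetric[OF r] ordLeq_ordIso_trans[OF that s]])
  show "(r, s) \<in> ordLeq" if "(r', s') \<in> ordLeq"
    by (rule ordIso_ordLeq_trans[OF r ordLeq_ordIso_trans[OF that ordIso_symmetric[OF s]]])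
qed

lift_definition less_ordinal :: "'a ordinal \<Rightarrow> 'a ordinal \<Rightarrow> bool" is "\<lambda>r s. (r, s) \<in> ordLess"
proof
  fix r r' s s' :: "'a rel"
  assume r: "(r, r') \<in> ordIso" and s: "(s, s') \<in> ordIso"
  show "(r', s') \<in> ordLess" if "(r, s) \<in> ordLess"
    by (rule ordIso_ordLess_trans[OF ordIso_symmetric[OF r] ordLess_ordIso_trans[OF that s]])
  show "(r, s) \<in> ordLess" if "(r', s') \<in> ordLess"
    by (rule ordIso_ordLess_trans[OF r ordLess_ordIso_trans[OF that ordIso_symmetric[OF s]]])
qed

instance
proof
  fix x y z :: "'a ordinal"
  show "(x < y) = (x \<le> y \<and> \<not> y \<le> x)"
    by transfer (use not_ordLess_ordLeq ordLess_imp_ordLeq ordLess_or_ordLeq in \<open>unfold ordIso_def, blast\<close>)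
  show "x \<le> x"
    by transfer (simp add: ordIso_imp_ordLeq)
  show "x \<le> z" if "x \<le> y" "y \<le> z"
    using that by transfer (rule ordLeq_transitive)
  show "x = y" if "x \<le> y" "y \<le> x"
    using that by transfer (simp add: ordIso_iff_ordLeq)
  show "x \<le> y \<or> y \<le> x"
    by transfer (use ordLeq_total in \<open>unfold ordIso_def, blast\<close>)
next
  fix P :: "'a ordinal \<Rightarrow> bool" and a :: "'a ordinal"
  assume step: "\<And>x. (\<And>y. y < x \<Longrightarrow> P y) \<Longrightarrow> P x"
  have *: "\<forall>a. r = rep_ordinal a \<longrightarrow> P a" for r :: "'a rel"
  proof (induction r rule: wf_induct_rule[OF wf_ordLess])
    case (1 r)
    show ?case
    proof (intro allI impI)
      fix x :: "'a ordinal" assume x: "r = rep_ordinal x"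
      have "P y" if "y < x" for y
        using 1 that by (simp add: x less_ordinal.rep_eq)
      then show "P x" by (rule step)
    qed
  qed
  from *[of "rep_ordinal a"] show "P a" by simp
qed

end

lemma Well_order_rep_ordinal: "Well_order (rep_ordinal a)"
  using Quotient3_rep_reflp[OF Quotient3_ordinal, of a] by (simp add: ordIso_def)

lemma ex_ordinal_iso: "Well_order (r :: 'a rel) \<Longrightarrow> \<exists>a :: 'a ordinal. (rep_ordinal a, r) \<in> ordIso"
  using rep_abs_rsp_left[OF Quotient3_ordinal ordIso_reflexive] by blast

lemma ordinal_eqI: "(rep_ordinal a, rep_ordinal b) \<in> ordIso \<Longrightarrow> a = b"
  by (simp only: Quotient3_rel_rep[OF Quotient3_ordinal])

lemma ordinal_lessThan_iso:
  fixes a :: "'a ordinal"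
  obtains f where "bij_betw f (Field (rep_ordinal a)) {..<a}"
    and "\<And>x y. x \<in> Field (rep_ordinal a) \<Longrightarrow> y \<in> Field (rep_ordinal a) \<Longrightarrow>
      (x, y) \<in> rep_ordinal a \<longleftrightarrow> f x \<le> f y"
proof -
  define r where "r = rep_ordinal a"
  have W: "Well_order r" by (simp add: r_def Well_order_rep_ordinal)
  have "\<forall>x. \<exists>b :: 'a ordinal. (rep_ordinal b, Restr r (underS r x)) \<in> ordIso"
    by (intro allI ex_ordinal_iso Well_order_Restr W)
  then obtain f :: "'a \<Rightarrow> 'a ordinal" where
    f: "\<And>x. (rep_ordinal (f x), Restr r (underS r x)) \<in> ordIso" by metis
  have less: "f x < f y" if "x \<in> Field r" "y \<in> Field r" "(x, y) \<in> r" "x \<noteq> y" for x y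
  proof -
    have ofy: "wo_rel.ofilter r (underS r y)" and ofx: "wo_rel.ofilter r (underS r x)"
      using W by (simp_all add: wo_rel.underS_ofilter wo_rel_def)
    have "underS r x \<subset> underS r y"
      using that W
      by (metis psubsetI underS_I underS_E underS_incl_iff order_on_defs(5))
    then have "(Restr r (underS r x), Restr r (underS r y)) \<in> ordLess"
      using ofilter_subset_ordLess[OF W ofx ofy] by simp
    then show ?thesis
      using f[of x] f[of y]
      by (metis less_ordinal.rep_eq ordIso_ordLess_trans ordIso_symmetric ordLess_ordIso_trans)
  qed
  have tot: "(x, y) \<in> r \<or> (y, x) \<in> r" if "x \<in> Field r" "y \<in> Field r" for x y
    using W that by (metis wo_rel.TOTALS wo_rel_def)
  have iff: "(x, y) \<in> r \<longleftrightarrow> f x \<le> f y" if "x \<in> Field r" "y \<in> Field r" for x y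
    using less[OF that] less[OF that(2,1)] tot[OF that] by (cases "x = y") force+
  have "inj_on f (Field r)"
    by (rule inj_onI) (metis less less_irrefl tot)
  moreover have "f ` Field r = {..<a}"
  proof safe
    fix x assume "x \<in> Field r"
    then have "(Restr r (underS r x), r) \<in> ordLess"
      using W by (metis empty_iff underS_Restr_ordLess)
    then show "f x < a"
      unfolding less_ordinal.rep_eq using f[of x] r_def ordIso_ordLess_trans by blast
  next
    fix b assume "b < a"
    then have "(rep_ordinal b, r) \<in> ordLess" by (simp add: less_ordinal.rep_eq r_def)
    then obtain x where "x \<in> Field r" "(rep_ordinal b, Restr r (underS r x)) \<in> ordIso"
      using ordLess_iff_ordIso_Restr[OF W Well_order_rep_ordinal] by blast
    then have "b = f x"
      using f[of x] by (metis ordinal_eqI ordIso_symmetric ordIso_transitive)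
    then show "b \<in> f ` Field r" using \<open>x \<in> Field r\<close> by blast
  qed
  ultimately show ?thesis
    using that[of f] iff by (simp add: bij_betw_def r_def)
qed

lemma card_ordinal_lessThan: "(card_of {..<a::'a ordinal}, card_of (UNIV :: 'a set)) \<in> ordLeq"
proof -
  obtain f :: "'a \<Rightarrow> 'a ordinal" where f: "bij_betw f (Field (rep_ordinal a)) {..<a}"
    using ordinal_lessThan_iso[of a] by metis
  then have "{..<a} = f ` Field (rep_ordinal a)"
    by (simp add: bij_betw_def)
  then have "(card_of {..<a}, card_of (Field (rep_ordinal a))) \<in> ordLeq"
    by (simp add: card_of_image)
  also have "(card_of (Field (rep_ordinal a)), card_of (UNIV :: 'a set)) \<in> ordLeq"
    by (rule card_of_mono1) simp
  finally show ?thesis .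
qed

lemma card_ordinal_UNIV: "(card_of (UNIV :: 'a ordinal set), card_of (UNIV :: 'a set)) \<notin> ordLeq"
proof
  assume "(card_of (UNIV :: 'a ordinal set), card_of (UNIV :: 'a set)) \<in> ordLeq"
  then obtain h :: "'a ordinal \<Rightarrow> 'a" where h: "inj h"
    using card_of_ordLeq[of "UNIV :: 'a ordinal set" "UNIV :: 'a set"] by blast
  define R where "R = {(x, y :: 'a ordinal). x \<le> y}"
  have F: "Field R = UNIV" by (auto simp: R_def Field_def)
  have "wf (R - Id)"
    by (rule wf_subset[OF wf]) (auto simp: R_def)
  then have W: "Well_order R"
    unfolding well_order_on_def linear_order_on_def partial_order_on_def preorder_on_def F
    by (auto simp: R_def refl_on_def trans_def antisym_def total_on_def)
  have "(R, dir_image R h) \<in> ordIso"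
    by (rule dir_image_ordIso[OF W]) (simp add: F h)
  moreover obtain c :: "'a ordinal" where "(rep_ordinal c, dir_image R h) \<in> ordIso"
    using ex_ordinal_iso[OF Well_order_dir_image[OF W, of h]] h by (auto simp: F)
  ultimately have c: "(rep_ordinal c, R) \<in> ordIso"
    by (meson ordIso_symmetric ordIso_transitive)
  obtain f where f: "bij_betw f (Field (rep_ordinal c)) {..<c}"
    "\<And>x y. x \<in> Field (rep_ordinal c) \<Longrightarrow> y \<in> Field (rep_ordinal c) \<Longrightarrow>
      (x, y) \<in> rep_ordinal c \<longleftrightarrow> f x \<le> f y"
    using ordinal_lessThan_iso by blast
  have u: "underS R c = {..<c}" by (auto simp: underS_def R_def)
  have WR: "Well_order (Restr R {..<c})" by (rule Well_order_Restr[OF W])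
  have FR: "Field (Restr R {..<c}) = {..<c}" by (auto simp: R_def Field_def)
  have "iso (rep_ordinal c) (Restr R {..<c}) f"
    unfolding iso_iff2 FR using f bij_betwE[OF f(1)] by (auto simp: R_def)
  then have "(rep_ordinal c, Restr R (underS R c)) \<in> ordIso"
    unfolding ordIso_def u using WR Well_order_rep_ordinal by blast
  moreover have "(Restr R (underS R c), R) \<in> ordLess"
    by (rule underS_Restr_ordLess[OF W]) (simp add: F)
  ultimately show False
    using c by (meson not_ordLess_ordIso ordIso_ordLess_trans)
qed

text \<open>For infinite \<open>'a\<close> every family of at most \<open>|'a|\<close> ordinals is strictly bounded above, so
  the least elements taken below are successors and suprema in the usual sense.\<close>

lemma ordinal_bounded:
  fixes S :: "'a ordinal set"
  assumes inf: "infinite (UNIV :: 'a set)" and S: "(card_of S, card_of (UNIV :: 'a set)) \<in> ordLeq"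
  shows "\<exists>b. \<forall>a\<in>S. a < b"
proof (rule ccontr)
  assume *: "\<not> ?thesis"
  have "(card_of {..a::'a ordinal}, card_of (UNIV :: 'a set)) \<in> ordLeq" for a
  proof -
    have "{..a} = {..<a} \<union> {a}"
      by (metis ivl_disj_un_singleton(2))
    then show ?thesis
      using card_of_Un_ordLeq_infinite_Field[OF _ card_ordinal_lessThan[of a]
          card_of_singl_ordLeq card_of_Card_order, of a] inf
      by (simp add: Field_card_of)
  qed
  then have "(card_of (\<Union>a\<in>S. {..a}), card_of (UNIV :: 'a set)) \<in> ordLeq"
    using card_of_UNION_ordLeq_infinite[OF inf S] by blast
  moreover have "(\<Union>a\<in>S. {..a}) = UNIV"
  proof -
    have "\<exists>a\<in>S. b \<le> a" for b
      using * by (meson not_less)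
    then show ?thesis by blast
  qed
  ultimately have "(card_of (UNIV :: 'a ordinal set), card_of (UNIV :: 'a set)) \<in> ordLeq"
    by (simp only:)
  then show False
    using card_ordinal_UNIV[where 'a = 'a] by contradiction
qed

definition ozero :: "'o::wellorder" where
  "ozero = (LEAST a. True)"

definition osuc :: "'o::wellorder \<Rightarrow> 'o" where
  "osuc a = (LEAST b. a < b)"

definition osup :: "'o::wellorder set \<Rightarrow> 'o" where
  "osup S = (LEAST b. \<forall>a\<in>S. a \<le> b)"

text \<open>The least limit ordinal.\<close>

definition oomega :: "'o::wellorder" where
  "oomega = (LEAST a. a \<noteq> ozero \<and> (\<forall>b<a. osuc b < a))"

lemma Least_pred_less:
  fixes a :: "'o::wellorder"
  assumes "\<exists>b<a. a = osuc b"
  shows "(LEAST b. b < a \<and> a = osuc b) < a"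
  using LeastI_ex[OF assms] by simp

text \<open>Transfinite recursion: \<open>F 0 = z\<close>, \<open>F (\<gamma> + 1) = s (F \<gamma>)\<close>, and
  \<open>F \<gamma> = l {F \<beta> | \<beta> < \<gamma>}\<close> for limit \<open>\<gamma>\<close>.\<close>

function transrec :: "'b \<Rightarrow> ('b \<Rightarrow> 'b) \<Rightarrow> ('b set \<Rightarrow> 'b) \<Rightarrow> 'o::wellorder \<Rightarrow> 'b" where
  "transrec z s l a =
    (if a = ozero then z
     else if \<exists>b<a. a = osuc b then s (transrec z s l (LEAST b. b < a \<and> a = osuc b))
     else l (transrec z s l ` {..<a}))"
  by pat_completeness auto
termination
  apply (relation "inv_image {(x, y). x < y} (\<lambda>(z, s, l, a). a)")
    apply (rule wf_inv_image[OF wf])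
   apply (drule Least_pred_less, simp only: in_inv_image mem_Collect_eq case_prod_conv)
  apply (simp only: in_inv_image mem_Collect_eq case_prod_conv lessThan_iff)
  done
declare transrec.simps [simp del]

lemma transrec_ozero: "transrec z s l ozero = z"
  by (simp add: transrec.simps)

lemma transrec_osuc:
  assumes "a < b"
  shows "transrec z s l (osuc a) = s (transrec z s l a)"
proof -
  have less: "x < osuc x" and le: "\<And>y. x < y \<Longrightarrow> osuc x \<le> y" if "x < w" for x w :: 'a
    unfolding osuc_def using that by (auto intro: LeastI Least_le)
  have "ozero \<le> a"
    unfolding ozero_def by (simp add: Least_le)
  then have "osuc a \<noteq> ozero"
    using less[OF assms] by auto
  moreover have "(LEAST c. c < osuc a \<and> osuc a = osuc c) = a"
  proof (rule Least_equality)
    show "a \<le> c" if "c < osuc a \<and> osuc a = osuc c" for c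
      using that le[of c a] less[OF assms] by (metis leD not_le)
  qed (use less[OF assms] in auto)
  ultimately show ?thesis
    using less[OF assms] by (subst transrec.simps) auto
qed

lemma transrec_limit:
  assumes "a \<noteq> ozero" "\<And>b. b < a \<Longrightarrow> osuc b < a"
  shows "transrec z s l a = l (transrec z s l ` {..<a})"
  using assms by (subst transrec.simps) auto

definition oadd :: "'o::wellorder \<Rightarrow> 'o \<Rightarrow> 'o" where
  "oadd a b = transrec a osuc osup b"

definition omul :: "'o::wellorder \<Rightarrow> 'o \<Rightarrow> 'o" where
  "omul a b = transrec ozero (\<lambda>x. oadd x a) osup b"

definition opow :: "'o::wellorder \<Rightarrow> 'o \<Rightarrow> 'o" where
  "opow a b = transrec (osuc ozero) (\<lambda>x. omul x a) osup b"


section \<open>Szlenk derivations\<close>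

text \<open>The strong operator topology on the dual space \<open>X\<^sup>*\<close> is the topology of pointwise convergence
  on \<open>X\<close>.\<close>

abbreviation weak_star :: "('a::real_normed_vector \<Rightarrow>\<^sub>L real) topology" where
  "weak_star \<equiv> strong_operator_topology"

text \<open>In what follows \<open>M\<close> is the norm of \<open>X\<^sup>*\<close> under consideration: the dual of the given norm of
  \<open>X\<close> or of an equivalent one. A closed ball of diameter \<open>\<epsilon>\<close> is read as one of radius \<open>\<epsilon>/2\<close>, also in
  the zero space. The infimum is the intended one for \<open>M\<close>-bounded, in particular for weak*-compact,
  sets.\<close>

definition kuratowski ::
  "(('a::real_normed_vector \<Rightarrow>\<^sub>L real) \<Rightarrow> real) \<Rightarrow> ('a \<Rightarrow>\<^sub>L real) set \<Rightarrow> real" where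
  "kuratowski M A =
    Inf {\<epsilon>. 0 < \<epsilon> \<and> (\<exists>C. finite C \<and> A \<subseteq> (\<Union>c\<in>C. {f. M (f - c) \<le> \<epsilon> / 2}))}"

definition szlenk_deriv ::
  "(('a::real_normed_vector \<Rightarrow>\<^sub>L real) \<Rightarrow> real) \<Rightarrow> real \<Rightarrow> ('a \<Rightarrow>\<^sub>L real) set \<Rightarrow> ('a \<Rightarrow>\<^sub>L real) set" where
  "szlenk_deriv M \<epsilon> A =
    {f \<in> A. \<forall>U. (\<exists>V. openin weak_star V \<and> f \<in> V \<and> V \<subseteq> U) \<longrightarrow>
      kuratowski M (A \<inter> weak_star closure_of U) \<ge> \<epsilon>}"

definition szlenk_derived ::
  "(('a::real_normed_vector \<Rightarrow>\<^sub>L real) \<Rightarrow> real) \<Rightarrow> real \<Rightarrow> 'o::wellorder \<Rightarrow>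
    ('a \<Rightarrow>\<^sub>L real) set \<Rightarrow> ('a \<Rightarrow>\<^sub>L real) set" where
  "szlenk_derived M \<epsilon> \<gamma> A = transrec A (szlenk_deriv M \<epsilon>) Inter \<gamma>"

text \<open>Ordinals of cardinality at most that of \<open>\<real>\<^sup>X\<close>. The set \<open>\<real>\<^sup>X\<close> is infinite and contains
  \<open>X\<^sup>*\<close>, so a decreasing transfinite sequence of subsets of \<open>X\<^sup>*\<close> that becomes empty does so at
  such an ordinal. All countable ordinals are included, also for \<open>X = 0\<close>.\<close>

type_synonym 'a dual_ordinal = "('a \<Rightarrow> real) ordinal"

definition Sz_eps ::
  "(('a::real_normed_vector \<Rightarrow>\<^sub>L real) \<Rightarrow> real) \<Rightarrow> ('a \<Rightarrow>\<^sub>L real) set \<Rightarrow> real \<Rightarrow> 'a dual_ordinal top" where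
  "Sz_eps M A \<epsilon> =
    (if \<exists>\<gamma> :: 'a dual_ordinal. szlenk_derived M \<epsilon> \<gamma> A = {}
     then top.Value (LEAST \<gamma>. szlenk_derived M \<epsilon> \<gamma> A = {}) else top.Top)"

definition Sz_set ::
  "(('a::real_normed_vector \<Rightarrow>\<^sub>L real) \<Rightarrow> real) \<Rightarrow> ('a \<Rightarrow>\<^sub>L real) set \<Rightarrow> 'a dual_ordinal top" where
  "Sz_set M A = (LEAST s. \<forall>\<epsilon>>0. Sz_eps M A \<epsilon> \<le> s)"

definition Sz :: "'a::real_normed_vector itself \<Rightarrow> 'a dual_ordinal top" where
  "Sz _ = Sz_set norm (cball 0 1)"


section \<open>Equivalent norms and the uniform Kadets-Klee property\<close>

definition equivalent_norm :: "('a::real_normed_vector \<Rightarrow> real) \<Rightarrow> bool" where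
  "equivalent_norm N \<longleftrightarrow>
    (\<forall>x. N x = 0 \<longleftrightarrow> x = 0) \<and> (\<forall>x y. N (x + y) \<le> N x + N y) \<and> (\<forall>c x. N (c *\<^sub>R x) = \<bar>c\<bar> * N x) \<and>
    (\<exists>a>0. \<exists>b>0. \<forall>x. a * norm x \<le> N x \<and> N x \<le> b * norm x)"

definition dual_norm :: "('a::real_normed_vector \<Rightarrow> real) \<Rightarrow> ('a \<Rightarrow>\<^sub>L real) \<Rightarrow> real" where
  "dual_norm N f = (SUP x\<in>{x. N x \<le> 1}. \<bar>blinfun_apply f x\<bar>)"

lemma dual_norm_norm: "dual_norm norm = (norm :: ('a::real_normed_vector \<Rightarrow>\<^sub>L real) \<Rightarrow> real)"
proof
  fix f :: "'a \<Rightarrow>\<^sub>L real"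
  have le: "\<bar>blinfun_apply f x\<bar> \<le> norm f" if "norm x \<le> 1" for x
    using norm_blinfun[of f x] mult_left_mono[OF that norm_ge_zero[of f]] by simp
  have bdd: "bdd_above ((\<lambda>x. \<bar>blinfun_apply f x\<bar>) ` {x. norm x \<le> 1})"
    using le by (intro bdd_aboveI[of _ "norm f"]) auto
  have up: "\<bar>blinfun_apply f x\<bar> \<le> dual_norm norm f" if "norm x \<le> 1" for x
    unfolding dual_norm_def using that by (intro cSUP_upper bdd) simp
  have "norm (blinfun_apply f x) \<le> dual_norm norm f * norm x" for x
  proof (cases "x = 0")
    case False
    then show ?thesis
      using up[of "x /\<^sub>R norm x"] by (simp add: blinfun.scaleR_right field_simps abs_mult)
  qed (simp add: blinfun.zero_right)
  moreover have "0 \<le> dual_norm norm f"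
    using up[of 0] by (simp add: blinfun.zero_right)
  ultimately have "norm f \<le> dual_norm norm f"
    by (intro norm_blinfun_bound)
  moreover have "dual_norm norm f \<le> norm f"
    unfolding dual_norm_def using le by (intro cSUP_least) (auto intro: exI[of _ 0])
  ultimately show "dual_norm norm f = norm f" by simp
qed

text \<open>The bound \<open>\<delta> < 1\<close> is implicit in the shrinking of the ball: for \<open>\<delta> \<ge> 2\<close> the set
  \<open>(1 - \<delta>) B\<close> contains \<open>B\<close>.\<close>

definition UKK_star ::
  "'o::wellorder \<Rightarrow> (('a::real_normed_vector \<Rightarrow>\<^sub>L real) \<Rightarrow> real) \<Rightarrow> bool" where
  "UKK_star \<alpha> M \<longleftrightarrow>
    (\<forall>\<epsilon>>0. \<exists>\<delta>>0. \<delta> < 1 \<and>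
      szlenk_derived M \<epsilon> (opow oomega \<alpha>) {f. M f \<le> 1} \<subseteq> (\<lambda>f. (1 - \<delta>) *\<^sub>R f) ` {f. M f \<le> 1})"

end

theory Submission
  imports Defs
begin

text \<open>One implication iterates the derivation of order \<open>\<omega>\<^sup>\<alpha>\<close> on the ball, using
  homogeneity. For the other, let \<open>D\<close> be that derivation and suppose that \<open>n\<close> iterates of it
  empty \<open>E\<close>. Give a point of the \<open>j\<close>-th iterate rank \<open>\<ge> j\<close> and let
  \<open>L\<^sub>s\<close> be the set of averages of points of \<open>E\<close> of mean rank at least \<open>s\<close>.
  These sets are convex and, up to a small loss in \<open>\<epsilon>\<close>, \<open>D L\<^sub>s \<subseteq>
  L\<^sub>s\<^sub>+\<^sub>\<delta>\<close>: near a point outside \<open>L\<^sub>s\<^sub>+\<^sub>\<delta>\<close> the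
  averages are within \<open>O(\<delta>)\<close> of the closed convex hull of a compact set whose derivative is empty.
  That the derivative of such a hull is again empty follows by induction on \<open>\<alpha>\<close> from the same
  inclusion one level below. Applied to the dual ball, this yields finitely many decreasing convex sets with \<open>D
  C\<^sub>k \<subseteq> C\<^sub>k\<^sub>+\<^sub>1\<close> for each \<open>\<epsilon>\<close>, and the new dual norm is the
  gauge of the unit ball of a weighted sum of the distances to all of them.\<close>

section \<open>Ordinal iteration\<close>

text \<open>Derived sets of convex sets need not be convex, so they cannot serve directly in
  building a norm; this is why a chain of convex sets replaces them. Averaging ranks works because
  at order \<omega>^(\<alpha>+1) compactness leaves only finitely many iterates of \<open>D\<close>:
  ranks lie in a bounded interval of reals, which a uniform gain \<delta> exhausts in finitely many
  steps. No measures occur: the rank is stored as an additional real coordinate, and averages become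
  points of a closed convex hull in the product with the line.

  The loss in \<epsilon> can be made arbitrarily small, so it is carried through the induction as a
  statement about all pairs \<epsilon> < \<epsilon>'. Distances to the convex sets enter the new
  norm because they are convex, Lipschitz and weak-star lower semicontinuous: a point where their
  sum is nearly 1 is nearly maximal for each of them among nearby points of the ball, and this is
  what moves it down the chain. The ordinal \<omega>^\<alpha> is only accessed through its laws at
  zero, successors and limits.\<close>

lemma ozero_le: "ozero \<le> (a :: 'o::wellorder)"
  unfolding ozero_def by (simp add: Least_le)

lemma osuc_le: "a < b \<Longrightarrow> osuc a \<le> b"
  unfolding osuc_def by (rule Least_le)

definition olimit :: "'o::wellorder \<Rightarrow> bool" where
  "olimit a \<longleftrightarrow> a \<noteq> ozero \<and> (\<forall>b<a. osuc b < a)"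

lemma transrec_olimit: "olimit a \<Longrightarrow> transrec z s l a = l (transrec z s l ` {..<a})"
  by (rule transrec_limit) (auto simp: olimit_def)

lemma olimit_lessThan_nonempty: "olimit a \<Longrightarrow> {..<a} \<noteq> {}"
  using ozero_le[of a] by (metis olimit_def lessThan_iff empty_iff le_less)

context
  assumes inf: "infinite (UNIV :: 'a set)"
begin

lemma image_lessThan_bounded:
  fixes a :: "'a ordinal" and f :: "'a ordinal \<Rightarrow> 'a ordinal"
  shows "\<exists>b. \<forall>x\<in>f ` {..<a}. x \<le> b"
proof -
  have "(card_of (f ` {..<a}), card_of (UNIV :: 'a set)) \<in> ordLeq"
    using card_of_image card_ordinal_lessThan ordLeq_transitive by blast
  then show ?thesis
    using ordinal_bounded[OF inf] less_imp_le by meson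
qed

lemma range_nat_bounded:
  fixes f :: "nat \<Rightarrow> 'a ordinal"
  shows "\<exists>b. \<forall>x\<in>range f. x \<le> b"
proof -
  have "(card_of (range f), card_of (UNIV :: nat set)) \<in> ordLeq"
    by (rule card_of_image)
  also have "(card_of (UNIV :: nat set), card_of (UNIV :: 'a set)) \<in> ordLeq"
    using inf infinite_iff_card_of_nat by blast
  finally show ?thesis
    using ordinal_bounded[OF inf] less_imp_le by meson
qed

lemma less_osuc: "(a :: 'a ordinal) < osuc a"
proof -
  have "(card_of {a}, card_of (UNIV :: 'a set)) \<in> ordLeq"
    by (rule card_of_singl_ordLeq) simp
  then obtain b where "a < b"
    using ordinal_bounded[OF inf] by blast
  then show ?thesis unfolding osuc_def by (rule LeastI)
qed

lemma ordinal_cases [case_names zero suc limit]: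
  fixes a :: "'a ordinal"
  obtains "a = ozero" | b where "a = osuc b" "b < a"
    | "olimit a"
proof (cases "a = ozero \<or> (\<exists>b. a = osuc b)")
  case False
  then have "osuc b < a" if "b < a" for b
    using osuc_le[OF that] by (metis le_less)
  with False show ?thesis using that unfolding olimit_def by blast
qed (use that less_osuc in blast)

lemma ordinal_induct [case_names zero suc limit]:
  fixes a :: "'a ordinal"
  assumes "P ozero" "\<And>b. P b \<Longrightarrow> P (osuc b)"
    "\<And>a. olimit a \<Longrightarrow> (\<And>b. b < a \<Longrightarrow> P b) \<Longrightarrow> P a"
  shows "P a"
proof (induction a rule: less_induct)
  case (less a)
  show ?case
    by (cases a rule: ordinal_cases) (use assms less in auto)
qed

lemma osup_upper: "\<exists>b. \<forall>x\<in>S. x \<le> (b :: 'a ordinal) \<Longrightarrow> x \<in> S \<Longrightarrow> x \<le> osup S"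
  unfolding osup_def using LeastI_ex[of "\<lambda>b. \<forall>x\<in>S. x \<le> b"] by blast

lemma less_osup: "b < osup S \<Longrightarrow> \<exists>x\<in>S. (b :: 'a ordinal) < x"
  unfolding osup_def using not_less_Least by force

lemma transrec_suc: "transrec z s l (osuc a) = s (transrec z s l (a :: 'a ordinal))"
  by (rule transrec_osuc[OF less_osuc])

text \<open>Two operators are compared at once, so that one induction serves monotonicity in the
  set, a change of \<epsilon> and a change of the norm.\<close>

lemma transrec_Inter_mono:
  fixes a :: "'a ordinal"
  assumes "A \<subseteq> B" and d: "\<And>X Y. X \<subseteq> Y \<Longrightarrow> d X \<subseteq> d' Y"
  shows "transrec A d Inter a \<subseteq> transrec B d' Inter a"
proof (induction a rule: ordinal_induct)
  case (limit a)
  then have "\<Inter> (transrec A d Inter ` {..<a}) \<subseteq> transrec B d' Inter b" if "b < a" for b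
    using that by (meson INT_lower lessThan_iff order_trans)
  then show ?case
    unfolding transrec_olimit[OF limit.hyps] by (intro INT_greatest) simp
qed (simp_all add: transrec_ozero transrec_suc assms)

section \<open>Iterates of contracting operators along ordinal sums, products and powers\<close>

context
  fixes d :: "'v set \<Rightarrow> 'v set"
  assumes d: "\<And>A. d A \<subseteq> A"
begin

lemma transrec_antimono:
  fixes a b :: "'a ordinal"
  assumes "a \<le> b"
  shows "transrec A d Inter b \<subseteq> transrec A d Inter a"
  using assms
proof (induction b rule: ordinal_induct)
  case zero
  then show ?case using ozero_le[of a] by simp
next
  case (suc b)
  show ?case
  proof (cases "a = osuc b")
    case False
    with suc.prems osuc_le[of b a] have "a \<le> b" by fastforce
    then show ?thesis using suc.IH d by (simp add: transrec_suc) blast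
  qed simp
next
  case (limit b)
  show ?case
  proof (cases "a = b")
    case False
    with limit.prems show ?thesis
      unfolding transrec_olimit[OF limit.hyps] by (intro Inter_lower imageI) simp
  qed simp
qed

text \<open>The arithmetic operations take suprema of sets that need not be initial segments. A
  supremum that is not attained is a limit with \<open>S\<close> cofinal below it, so for a
  decreasing family both intersections agree.\<close>

lemma transrec_osup:
  fixes S :: "'a ordinal set"
  assumes "S \<noteq> {}" and bdd: "\<exists>b. \<forall>x\<in>S. x \<le> b"
  shows "transrec A d Inter (osup S) = (\<Inter>s\<in>S. transrec A d Inter s)"
proof (cases "osup S \<in> S")
  case True
  then show ?thesis
    using transrec_antimono[OF osup_upper[OF bdd]] by blast
next
  case False
  have less: "s < osup S" if "s \<in> S" for s
    using osup_upper[OF bdd that] that False by (metis le_less)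
  have "osup S \<noteq> ozero"
    using less assms(1) ozero_le by (metis ex_in_conv leD)
  moreover have "osuc b < osup S" if "b < osup S" for b
    using less_osup[OF that] osuc_le less by (metis le_less_trans)
  ultimately have "olimit (osup S)" by (simp add: olimit_def)
  then have "transrec A d Inter (osup S) = (\<Inter>b\<in>{..<osup S}. transrec A d Inter b)"
    by (rule transrec_olimit)
  also have "\<dots> = (\<Inter>s\<in>S. transrec A d Inter s)"
  proof (intro equalityI INT_greatest)
    show "(\<Inter>b\<in>{..<osup S}. transrec A d Inter b) \<subseteq> transrec A d Inter s" if "s \<in> S" for s
      using less[OF that] by blast
    show "(\<Inter>s\<in>S. transrec A d Inter s) \<subseteq> transrec A d Inter b" if b: "b \<in> {..<osup S}" for b
    proof -
      obtain s where "s \<in> S" "b < s" using less_osup[of b S] b by auto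
      then show ?thesis
        using transrec_antimono[of b s A] by (meson INT_lower less_imp_le order_trans)
    qed
  qed
  finally show ?thesis .
qed

lemma transrec_osup_image:
  fixes a :: "'a ordinal" and f :: "'a ordinal \<Rightarrow> 'a ordinal"
  assumes "olimit a"
  shows "transrec A d Inter (osup (f ` {..<a})) = (\<Inter>x\<in>{..<a}. transrec A d Inter (f x))"
proof -
  have "f ` {..<a} \<noteq> {}" using olimit_lessThan_nonempty[OF assms] by blast
  then show ?thesis
    unfolding transrec_osup[OF \<open>f ` {..<a} \<noteq> {}\<close> image_lessThan_bounded] by blast
qed

text \<open>Induction on \<open>b\<close>; the limit step turns the supremum in the definition of
  the sum into an intersection.\<close>

lemma transrec_oadd:
  fixes a b :: "'a ordinal"
  shows "transrec A d Inter (oadd a b) = transrec (transrec A d Inter a) d Inter b"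
proof (induction b rule: ordinal_induct)
  case (limit b)
  have "oadd a b = osup (oadd a ` {..<b})"
    unfolding oadd_def by (rule transrec_olimit[OF limit.hyps])
  then have "transrec A d Inter (oadd a b) = (\<Inter>x<b. transrec A d Inter (oadd a x))"
    by (simp only: transrec_osup_image[OF limit.hyps])
  also have "\<dots> = (\<Inter>x<b. transrec (transrec A d Inter a) d Inter x)"
    using limit.IH by auto
  finally show ?case
    unfolding transrec_olimit[OF limit.hyps] .
qed (simp_all add: oadd_def transrec_ozero transrec_suc)

end

lemma omul_finite:
  assumes d: "\<And>A :: 'v set. d A \<subseteq> A"
  shows "transrec A d Inter (omul a ((osuc ^^ n) (ozero :: 'a ordinal))) =
    ((\<lambda>A. transrec A d Inter a) ^^ n) A"
  by (induction n) (simp_all add: omul_def transrec_ozero transrec_suc transrec_oadd[OF d])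

text \<open>The supremum of the finite ordinals is a limit, so the \<open>LEAST\<close> in
  \<open>oomega\<close> is a genuine limit ordinal. Its minimality excludes limits below it, which
  leaves only finite successors of zero.\<close>

lemma lessThan_oomega: "{..<oomega :: 'a ordinal} = range (\<lambda>n. (osuc ^^ n) ozero)"
proof -
  let ?f = "\<lambda>n. (osuc ^^ n) (ozero :: 'a ordinal)"
  have bdd: "\<exists>b. \<forall>x\<in>range ?f. x \<le> b" by (rule range_nat_bounded)
  have up: "?f n < osup (range ?f)" for n
    using osup_upper[OF bdd rangeI[of ?f "Suc n"]] less_osuc[of "?f n"] by simp
  have "olimit (osup (range ?f))"
    unfolding olimit_def
  proof (intro conjI allI impI)
    show "osup (range ?f) \<noteq> ozero"
      using up[of 0] by auto
    show "osuc b < osup (range ?f)" if b: "b < osup (range ?f)" for b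
    proof -
      obtain n where "b < ?f n" using less_osup[OF b] by auto
      then show ?thesis using osuc_le[of b] up[of n] by fastforce
    qed
  qed
  then have omega: "olimit (oomega :: 'a ordinal)"
    unfolding oomega_def olimit_def by (rule LeastI)
  have "?f n < oomega" for n
  proof (induction n)
    case 0
    then show ?case using omega ozero_le[of oomega] by (auto simp: olimit_def le_less)
  qed (use omega in \<open>simp add: olimit_def\<close>)
  moreover have "b < oomega \<longrightarrow> b \<in> range ?f" for b
  proof (induction b rule: ordinal_induct)
    case zero
    show ?case by (metis funpow_0 rangeI)
  next
    case (suc b)
    show ?case
    proof
      assume "osuc b < oomega"
      then obtain n where "b = ?f n" using suc less_osuc[of b] by auto
      then have "osuc b = ?f (Suc n)" by simp
      then show "osuc b \<in> range ?f" by blast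
    qed
  next
    case (limit b)
    then show ?case unfolding oomega_def olimit_def using not_less_Least by blast
  qed
  ultimately show ?thesis by auto
qed

lemma transrec_omul_oomega:
  fixes a :: "'a ordinal"
  assumes d: "\<And>A :: 'v set. d A \<subseteq> A"
  shows "transrec A d Inter (omul a oomega) = (\<Inter>n. ((\<lambda>A. transrec A d Inter a) ^^ n) A)"
proof -
  have omega: "olimit (oomega :: 'a ordinal)"
    unfolding olimit_def
  proof (intro conjI allI impI)
    have "(osuc ^^ 0) ozero \<in> {..<oomega :: 'a ordinal}" unfolding lessThan_oomega by blast
    then show "(oomega :: 'a ordinal) \<noteq> ozero" by auto
    show "osuc b < (oomega :: 'a ordinal)" if "b < oomega" for b
    proof -
      have "b \<in> {..<oomega}" using that by simp
      then obtain n where "b = (osuc ^^ n) ozero" unfolding lessThan_oomega by blast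
      then have "osuc b = (osuc ^^ Suc n) ozero" by simp
      then have "osuc b \<in> {..<oomega}" unfolding lessThan_oomega by blast
      then show ?thesis by simp
    qed
  qed
  have "omul a oomega = osup (omul a ` {..<oomega})"
    unfolding omul_def by (rule transrec_olimit[OF omega])
  then have "transrec A d Inter (omul a oomega) = (\<Inter>x<oomega. transrec A d Inter (omul a x))"
    by (simp only: transrec_osup_image[OF d omega])
  then show ?thesis
    by (simp add: lessThan_oomega omul_finite[OF d])
qed

lemma transrec_opow_zero:
  "transrec A d Inter (opow oomega (ozero :: 'a ordinal)) = d A"
  by (simp add: opow_def transrec_ozero transrec_suc)

text \<open>Raising the exponent by one means taking all finite iterates of the previous operator.
  This is the form in which a successor exponent is used later.\<close>

lemma transrec_opow_suc:
  assumes d: "\<And>A :: 'v set. d A \<subseteq> A"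
  shows "transrec A d Inter (opow oomega (osuc (a :: 'a ordinal))) =
    (\<Inter>n. ((\<lambda>A. transrec A d Inter (opow oomega a)) ^^ n) A)"
  by (simp add: opow_def transrec_suc transrec_omul_oomega[OF d])

lemma transrec_opow_limit:
  fixes a :: "'a ordinal"
  assumes d: "\<And>A :: 'v set. d A \<subseteq> A" and a: "olimit a"
  shows "transrec A d Inter (opow oomega a) = (\<Inter>b<a. transrec A d Inter (opow oomega b))"
proof -
  have "opow oomega a = osup (opow oomega ` {..<a})"
    unfolding opow_def by (rule transrec_olimit[OF a])
  then show ?thesis
    by (simp only: transrec_osup_image[OF d a])
qed

lemma transrec_opow_antimono:
  fixes a b :: "'a ordinal"
  assumes d: "\<And>A :: 'v set. d A \<subseteq> A" and "a \<le> b"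
  shows "transrec A d Inter (opow oomega b) \<subseteq> transrec A d Inter (opow oomega a)"
  using assms(2)
proof (induction b rule: ordinal_induct)
  case zero
  then show ?case using ozero_le[of a] by simp
next
  case (suc b)
  have "transrec A d Inter (opow oomega (osuc b)) \<subseteq>
      ((\<lambda>A. transrec A d Inter (opow oomega b)) ^^ 1) A"
    unfolding transrec_opow_suc[OF d] by blast
  with suc osuc_le[of b a] show ?case
    by (cases "a = osuc b") fastforce+
next
  case (limit b)
  show ?case
  proof (cases "a = b")
    case False
    with limit.prems show ?thesis
      unfolding transrec_opow_limit[OF d limit.hyps] by (intro INT_lower) simp
  qed simp
qed

end

section \<open>Szlenk derivations in locally convex spaces\<close>

text \<open>The convex neighbourhoods are asked to be closed because they serve twice: to contain
  closures of smaller open sets, and to yield compact sets when cut with a ball.\<close>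

class locally_convex_space = real_vector + topological_ab_group_add + t2_space +
  assumes tendsto_scaleR_nhds:
      "filterlim (\<lambda>p. fst p *\<^sub>R snd p) (nhds (c *\<^sub>R x)) (nhds (c :: real) \<times>\<^sub>F nhds x)"
    and locally_convex': "open S \<Longrightarrow> 0 \<in> S \<Longrightarrow>
      \<exists>U V. closed U \<and> (\<forall>x\<in>U. \<forall>y\<in>U. \<forall>u\<ge>0. \<forall>v\<ge>0. u + v = (1 :: real) \<longrightarrow> u *\<^sub>R x + v *\<^sub>R y \<in> U) \<and>
        open V \<and> 0 \<in> V \<and> V \<subseteq> U \<and> U \<subseteq> S"

lemma locally_convex:
  fixes S :: "'v::locally_convex_space set"
  assumes "open S" "0 \<in> S"
  obtains U where "closed U" "convex U" "0 \<in> interior U" "U \<subseteq> S"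
  using locally_convex'[OF assms] unfolding convex_def interior_def by blast

lemma continuous_on_scaleR':
  fixes f :: "'b::topological_space \<Rightarrow> 'v::locally_convex_space"
  assumes "continuous_on S c" "continuous_on S f"
  shows "continuous_on S (\<lambda>x. c x *\<^sub>R f x)"
  unfolding continuous_on_def
proof
  fix x assume "x \<in> S"
  then have "filterlim (\<lambda>y. (c y, f y)) (nhds (c x) \<times>\<^sub>F nhds (f x)) (at x within S)"
    using assms by (intro filterlim_Pair) (auto simp: continuous_on_def)
  from filterlim_compose[OF tendsto_scaleR_nhds this]
  show "((\<lambda>x. c x *\<^sub>R f x) \<longlongrightarrow> c x *\<^sub>R f x) (at x within S)" by simp
qed

lemma open_translation': "open S \<Longrightarrow> open {y. y - x \<in> S}" for x :: "'v::topological_group_add"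
  using open_vimage[of S "\<lambda>y. y - x"] by (simp add: vimage_def continuous_intros)

lemma open_scaleR_image:
  fixes S :: "'v::locally_convex_space set"
  assumes "open S" "c \<noteq> 0"
  shows "open ((\<lambda>x. c *\<^sub>R x) ` S)"
proof -
  have "(\<lambda>x. c *\<^sub>R x) ` S = (\<lambda>x. inverse c *\<^sub>R x) -` S"
    using assms(2) by (auto simp: image_iff intro!: bexI[of _ "inverse c *\<^sub>R _"])
  moreover have "open ((\<lambda>x. inverse c *\<^sub>R x) -` S)"
    using assms(1) by (intro open_vimage continuous_on_scaleR' continuous_intros)
  ultimately show ?thesis by simp
qed

lemma compact_scaleR_image:
  fixes S :: "'v::locally_convex_space set"
  shows "compact S \<Longrightarrow> compact ((\<lambda>x. c *\<^sub>R x) ` S)"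
  by (intro compact_continuous_image continuous_on_scaleR' continuous_intros)

text \<open>In a decreasing family a finite subfamily is governed by its largest index. The index
  type is any linear order, since natural numbers and ordinals below a limit both occur.\<close>

lemma compact_antimono_Inter_nonempty:
  fixes F :: "'i::linorder \<Rightarrow> 'v::t2_space set"
  assumes "I \<noteq> {}" and F: "\<And>i. i \<in> I \<Longrightarrow> compact (F i)" "\<And>i. i \<in> I \<Longrightarrow> F i \<noteq> {}"
    and anti: "\<And>i j. i \<in> I \<Longrightarrow> j \<in> I \<Longrightarrow> i \<le> j \<Longrightarrow> F j \<subseteq> F i"
  shows "(\<Inter>i\<in>I. F i) \<noteq> {}"
proof -
  obtain k where k: "k \<in> I" using assms(1) by blast
  have "F k \<inter> (\<Inter>i\<in>I. F i) \<noteq> {}"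
  proof (rule compact_imp_fip_image[OF F(1)[OF k]])
    fix J assume J: "finite J" "J \<subseteq> I"
    define m where "m = Max (insert k J)"
    have "m \<in> insert k J" unfolding m_def using J(1) by (intro Max_in) auto
    then have m: "m \<in> I" using J k by blast
    have "F m \<subseteq> F i" if "i \<in> insert k J" for i
      using that J k m by (intro anti) (auto simp: m_def)
    then show "F k \<inter> (\<Inter>i\<in>J. F i) \<noteq> {}" using F(2)[OF m] by blast
  qed (use F(1) compact_imp_closed in blast)
  then show ?thesis by blast
qed

text \<open>This expresses that the measure of non-compactness is below \<epsilon>, without the
  default value of an infimum over no covers. The strict bound on \<open>e\<close> is a slack that
  later estimates spend.\<close>

definition small :: "('v::real_vector \<Rightarrow> real) \<Rightarrow> real \<Rightarrow> 'v set \<Rightarrow> bool" where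
  "small nm \<epsilon> S \<longleftrightarrow> (\<exists>e C. 0 < e \<and> e < \<epsilon> \<and> finite C \<and> S \<subseteq> (\<Union>c\<in>C. {x. nm (x - c) \<le> e / 2}))"

text \<open>Open neighbourhoods stand in for closures of neighbourhoods; by regularity of the
  topology both give the same points.\<close>

definition szd :: "('v::{real_vector,topological_space} \<Rightarrow> real) \<Rightarrow> real \<Rightarrow> 'v set \<Rightarrow> 'v set" where
  "szd nm \<epsilon> A = {x \<in> A. \<forall>V. open V \<longrightarrow> x \<in> V \<longrightarrow> \<not> small nm \<epsilon> (A \<inter> V)}"

definition sz :: "('v::{real_vector,topological_space} \<Rightarrow> real) \<Rightarrow> real \<Rightarrow> 'o::wellorder \<Rightarrow> 'v set \<Rightarrow> 'v set" where
  "sz nm \<epsilon> \<gamma> A = transrec A (szd nm \<epsilon>) Inter \<gamma>"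

lemma small_subset: "small nm \<epsilon> T \<Longrightarrow> S \<subseteq> T \<Longrightarrow> small nm \<epsilon> S"
  unfolding small_def by (meson order_trans)

lemma small_mono: "small nm \<epsilon> S \<Longrightarrow> \<epsilon> \<le> \<epsilon>' \<Longrightarrow> small nm \<epsilon>' S"
  unfolding small_def by (meson less_le_trans)

lemma small_empty: "0 < \<epsilon> \<Longrightarrow> small nm \<epsilon> {}"
  unfolding small_def by (intro exI[of _ "\<epsilon> / 2"] exI[of _ "{}"]) auto

lemma small_Un:
  assumes "small nm \<epsilon> S" "small nm \<epsilon> T"
  shows "small nm \<epsilon> (S \<union> T)"
proof -
  from assms obtain e C e' C' where
    *: "0 < e" "e < \<epsilon>" "finite C" "S \<subseteq> (\<Union>c\<in>C. {x. nm (x - c) \<le> e / 2})"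
    "0 < e'" "e' < \<epsilon>" "finite C'" "T \<subseteq> (\<Union>c\<in>C'. {x. nm (x - c) \<le> e' / 2})"
    unfolding small_def by metis
  have "S \<union> T \<subseteq> (\<Union>c\<in>C \<union> C'. {x. nm (x - c) \<le> max e e' / 2})"
    using *(4,8) by (fastforce simp: max_def)
  then show ?thesis
    unfolding small_def using * by (intro exI[of _ "max e e'"] exI[of _ "C \<union> C'"]) auto
qed

lemma small_UN:
  assumes "finite I" "0 < \<epsilon>" "\<And>i. i \<in> I \<Longrightarrow> small nm \<epsilon> (S i)"
  shows "small nm \<epsilon> (\<Union>i\<in>I. S i)"
  using assms by (induction I) (auto simp: small_empty small_Un)

lemma szd_subset: "szd nm \<epsilon> A \<subseteq> A"
  by (auto simp: szd_def)

lemma szd_mono: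
  assumes "A \<subseteq> B" "\<epsilon> \<le> \<epsilon>'"
  shows "szd nm \<epsilon>' A \<subseteq> szd nm \<epsilon> B"
proof
  fix x assume x: "x \<in> szd nm \<epsilon>' A"
  have "small nm \<epsilon>' (A \<inter> V)" if "small nm \<epsilon> (B \<inter> V)" for V
    using small_mono[OF small_subset[OF that] assms(2)] assms(1) by blast
  then show "x \<in> szd nm \<epsilon> B" using x assms(1) by (auto simp: szd_def)
qed

lemma szd_closed:
  assumes "closed A"
  shows "closed (szd nm \<epsilon> A)"
proof -
  have "szd nm \<epsilon> A = A - \<Union>{V. open V \<and> small nm \<epsilon> (A \<inter> V)}"
    by (auto simp: szd_def)
  then show ?thesis using assms by auto
qed

text \<open>Whether \<open>x\<close> survives depends only on the set near \<open>x\<close>. The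
  closure keeps the localised set compact when the derivation is iterated.\<close>

lemma szd_local:
  assumes "open V"
  shows "szd nm \<epsilon> A \<inter> V \<subseteq> szd nm \<epsilon> (closure (A \<inter> V))"
proof
  fix x assume x: "x \<in> szd nm \<epsilon> A \<inter> V"
  show "x \<in> szd nm \<epsilon> (closure (A \<inter> V))"
    unfolding szd_def
  proof (intro CollectI conjI allI impI notI)
    show "x \<in> closure (A \<inter> V)"
      using x closure_subset[of "A \<inter> V"] by (auto simp: szd_def)
    fix W assume W: "open W" "x \<in> W" "small nm \<epsilon> (closure (A \<inter> V) \<inter> W)"
    have "A \<inter> (V \<inter> W) \<subseteq> closure (A \<inter> V) \<inter> W"
      using closure_subset[of "A \<inter> V"] by blast
    with W(3) have "small nm \<epsilon> (A \<inter> (V \<inter> W))" by (rule small_subset)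
    then show False
      using x W(1,2) assms by (auto simp: szd_def dest: spec[of _ "V \<inter> W"])
  qed
qed

text \<open>A point outside a closed set has a neighbourhood missing it, so a point in neither
  derivative has one small neighbourhood for each set; their intersection has a small trace on the
  union.\<close>

lemma szd_Un:
  assumes "closed A" "closed B" "0 < \<epsilon>"
  shows "szd nm \<epsilon> (A \<union> B) \<subseteq> szd nm \<epsilon> A \<union> szd nm \<epsilon> B"
proof (rule subsetI, rule ccontr)
  fix x assume x: "x \<in> szd nm \<epsilon> (A \<union> B)" and not: "x \<notin> szd nm \<epsilon> A \<union> szd nm \<epsilon> B"
  have *: "\<exists>V. open V \<and> x \<in> V \<and> small nm \<epsilon> (C \<inter> V)" if "closed C" "x \<notin> szd nm \<epsilon> C" for C
  proof (cases "x \<in> C")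
    case False
    with that show ?thesis
      by (intro exI[of _ "- C"]) (simp add: small_empty assms open_Compl)
  qed (use that in \<open>auto simp: szd_def\<close>)
  obtain V W where "open V" "x \<in> V" "small nm \<epsilon> (A \<inter> V)" "open W" "x \<in> W" "small nm \<epsilon> (B \<inter> W)"
    using * assms not by (meson UnCI)
  moreover from this have "small nm \<epsilon> ((A \<inter> V) \<union> (B \<inter> W))"
    by (intro small_Un)
  then have "small nm \<epsilon> ((A \<union> B) \<inter> (V \<inter> W))"
    by (rule small_subset) blast
  ultimately have "open (V \<inter> W)" "x \<in> V \<inter> W" "small nm \<epsilon> ((A \<union> B) \<inter> (V \<inter> W))" by auto
  then show False using x unfolding szd_def by blast
qed

lemma sz_zero: "sz nm \<epsilon> ozero A = A"
  by (simp add: sz_def transrec_ozero)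

lemma sz_limit: "olimit \<gamma> \<Longrightarrow> sz nm \<epsilon> \<gamma> A = (\<Inter>\<beta>\<in>{..<\<gamma>}. sz nm \<epsilon> \<beta> A)"
  unfolding sz_def by (rule transrec_olimit)

text \<open>The locale isolates what Banach-Alaoglu provides for a dual norm, so that the results
  apply both to the original dual norm and to that of an equivalent norm.\<close>

locale dual_norm_space =
  fixes nm :: "'v::locally_convex_space \<Rightarrow> real"
  assumes nm_add: "nm (x + y) \<le> nm x + nm y"
    and nm_scaleR: "nm (c *\<^sub>R x) = \<bar>c\<bar> * nm x"
    and compact_unit_ball: "compact {x. nm x \<le> 1}"
begin

lemma nm_zero [simp]: "nm 0 = 0"
  using nm_scaleR[of 0 0] by simp

lemma nm_uminus [simp]: "nm (- x) = nm x"
  using nm_scaleR[of "-1" x] by simp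

lemma nm_nonneg [simp]: "0 \<le> nm x"
  using nm_add[of x "- x"] by simp

lemma nm_minus_commute: "nm (x - y) = nm (y - x)"
  using nm_uminus[of "x - y"] by simp

lemma nm_diff_triangle: "nm (x - z) \<le> nm (x - y) + nm (y - z)"
  using nm_add[of "x - y" "y - z"] by simp

lemma compact_nm_ball:
  assumes "0 < r"
  shows "compact {x. nm x \<le> r}"
proof -
  have "{x. nm x \<le> r} = (\<lambda>x. r *\<^sub>R x) ` {x. nm x \<le> 1}"
  proof (intro equalityI subsetI)
    fix x assume "x \<in> {x. nm x \<le> r}"
    then show "x \<in> (\<lambda>x. r *\<^sub>R x) ` {x. nm x \<le> 1}"
      using assms by (intro image_eqI[of _ _ "(1 / r) *\<^sub>R x"]) (auto simp: nm_scaleR field_simps)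
  qed (use assms in \<open>auto simp: nm_scaleR\<close>)
  then show ?thesis using compact_scaleR_image[OF compact_unit_ball] by simp
qed

lemma convex_nm_ball: "convex {x. nm x \<le> r}"
proof (rule convexI)
  fix x y and u v :: real
  assume *: "x \<in> {x. nm x \<le> r}" "y \<in> {x. nm x \<le> r}" "0 \<le> u" "0 \<le> v" "u + v = 1"
  have "nm (u *\<^sub>R x + v *\<^sub>R y) \<le> u * nm x + v * nm y"
    using nm_add[of "u *\<^sub>R x" "v *\<^sub>R y"] * by (simp add: nm_scaleR)
  also have "\<dots> \<le> u * r + v * r" using * by (intro add_mono mult_left_mono) auto
  also have "\<dots> = r" using * by (metis distrib_right mult_1)
  finally show "u *\<^sub>R x + v *\<^sub>R y \<in> {x. nm x \<le> r}" by simp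
qed

definition nb :: "real \<Rightarrow> 'v set \<Rightarrow> 'v set" where
  "nb r A = {x. \<exists>a\<in>A. nm (x - a) \<le> r}"

lemma nb_mono: "r \<le> s \<Longrightarrow> A \<subseteq> B \<Longrightarrow> nb r A \<subseteq> nb s B"
  unfolding nb_def by (auto intro: order_trans)

lemma compact_nb:
  assumes "compact A" "0 < r"
  shows "compact (nb r A)"
proof -
  have "nb r A = (\<lambda>(a, b). a + b) ` (A \<times> {x. nm x \<le> r})"
    unfolding nb_def by (force simp: image_iff intro: bexI[of _ "_ - _"])
  moreover have "compact \<dots>"
    using assms compact_nm_ball unfolding case_prod_unfold
    by (intro compact_continuous_image compact_Times continuous_intros) auto
  ultimately show ?thesis by simp
qed

lemma compact_ball_around:
  assumes "0 < r"
  shows "compact {a. nm (x - a) \<le> r}"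
proof -
  have "{a. nm (x - a) \<le> r} = nb r {x}"
    by (auto simp: nb_def nm_minus_commute)
  then show ?thesis using compact_nb[of "{x}"] assms by simp
qed

lemma small_nb:
  assumes "small nm \<epsilon> S" "0 \<le> r"
  shows "small nm (\<epsilon> + 2 * r) (nb r S)"
proof -
  obtain e C where *: "0 < e" "e < \<epsilon>" "finite C" "S \<subseteq> (\<Union>c\<in>C. {x. nm (x - c) \<le> e / 2})"
    using assms unfolding small_def by blast
  have "nb r S \<subseteq> (\<Union>c\<in>C. {x. nm (x - c) \<le> (e + 2 * r) / 2})"
  proof
    fix x assume "x \<in> nb r S"
    then obtain a where a: "a \<in> S" "nm (x - a) \<le> r" by (auto simp: nb_def)
    then obtain c where c: "c \<in> C" "nm (a - c) \<le> e / 2" using * by auto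
    then have "nm (x - c) \<le> (e + 2 * r) / 2" using a nm_diff_triangle[of x c a] by simp
    then show "x \<in> (\<Union>c\<in>C. {x. nm (x - c) \<le> (e + 2 * r) / 2})" using c by blast
  qed
  then show ?thesis
    unfolding small_def using * assms by (intro exI[of _ "e + 2 * r"] exI[of _ C]) auto
qed

text \<open>If \<open>x\<close> is outside the enlarged derivative, the points of \<open>A\<close>
  within \<open>r\<close> of \<open>x\<close> have neighbourhoods with small trace, and finitely
  many suffice by compactness. Near \<open>x\<close>, the enlargement of \<open>A\<close> comes from
  that small part only. Enlarging by \<open>r\<close> costs \<open>2 * r\<close> because \<epsilon>
  is a diameter.\<close>

lemma szd_nb:
  assumes A: "compact A" and pos: "0 < \<epsilon>" "0 < r"
  shows "szd nm (\<epsilon> + 2 * r) (nb r A) \<subseteq> nb r (szd nm \<epsilon> A)"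
proof (rule subsetI, rule ccontr)
  fix x assume x: "x \<in> szd nm (\<epsilon> + 2 * r) (nb r A)" and not: "x \<notin> nb r (szd nm \<epsilon> A)"
  define K where "K = A \<inter> {a. nm (x - a) \<le> r}"
  have "compact K"
    unfolding K_def using A compact_imp_closed[OF compact_ball_around[OF pos(2)]] by (rule compact_Int_closed)
  moreover have cover: "\<exists>V. open V \<and> a \<in> V \<and> small nm \<epsilon> (A \<inter> V)" if "a \<in> K" for a
    using that not by (auto simp: K_def nb_def szd_def)
  then have "K \<subseteq> \<Union>{V. open V \<and> small nm \<epsilon> (A \<inter> V)}" by blast
  ultimately obtain \<V> where \<V>: "\<V> \<subseteq> {V. open V \<and> small nm \<epsilon> (A \<inter> V)}" "finite \<V>" "K \<subseteq> \<Union>\<V>"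
    by (rule compactE) auto
  then have openV: "open (\<Union>\<V>)" by blast
  have "small nm \<epsilon> (\<Union>V\<in>\<V>. A \<inter> V)"
    using \<V> pos by (intro small_UN) auto
  moreover have "(\<Union>V\<in>\<V>. A \<inter> V) = A \<inter> \<Union>\<V>" by blast
  ultimately have smallV: "small nm \<epsilon> (A \<inter> \<Union>\<V>)" by (simp only:)
  \<comment> \<open>The rest of \<open>A\<close> has no point within \<open>r\<close> of
    \<open>x\<close>, and its enlargement is closed, so \<open>W\<close> is a neighbourhood of
    \<open>x\<close>.\<close>
  define W where "W = - nb r (A - \<Union>\<V>)"
  have "open W"
    unfolding W_def using openV A pos(2)
    by (intro open_Compl compact_imp_closed compact_nb compact_diff)
  moreover have "x \<in> W"
    using \<V>(3) by (auto simp: W_def nb_def K_def)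
  moreover have "nb r A \<inter> W \<subseteq> nb r (A \<inter> \<Union>\<V>)"
    by (auto simp: W_def nb_def)
  then have "small nm (\<epsilon> + 2 * r) (nb r A \<inter> W)"
    using small_nb[OF smallV, of r] pos(2) small_subset by simp
  ultimately show False using x by (auto simp: szd_def)
qed

lemma small_scaleR:
  assumes "small nm \<epsilon> S" "c \<noteq> 0"
  shows "small nm (\<bar>c\<bar> * \<epsilon>) ((\<lambda>x. c *\<^sub>R x) ` S)"
proof -
  obtain e C where *: "0 < e" "e < \<epsilon>" "finite C" "S \<subseteq> (\<Union>c\<in>C. {x. nm (x - c) \<le> e / 2})"
    using assms unfolding small_def by blast
  have "(\<lambda>x. c *\<^sub>R x) ` S \<subseteq> (\<Union>y\<in>(\<lambda>x. c *\<^sub>R x) ` C. {x. nm (x - y) \<le> (\<bar>c\<bar> * e) / 2})"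
  proof clarify
    fix x assume "x \<in> S"
    then obtain y where y: "y \<in> C" "nm (x - y) \<le> e / 2" using * by auto
    then have "nm (c *\<^sub>R x - c *\<^sub>R y) \<le> (\<bar>c\<bar> * e) / 2"
      using mult_left_mono[OF y(2), of "\<bar>c\<bar>"] by (simp add: nm_scaleR flip: scaleR_diff_right)
    then show "c *\<^sub>R x \<in> (\<Union>y\<in>(\<lambda>x. c *\<^sub>R x) ` C. {x. nm (x - y) \<le> (\<bar>c\<bar> * e) / 2})" using y by blast
  qed
  then show ?thesis
    unfolding small_def using * assms
    by (intro exI[of _ "\<bar>c\<bar> * e"] exI[of _ "(\<lambda>x. c *\<^sub>R x) ` C"]) auto
qed

lemma szd_scaleR:
  assumes "c \<noteq> 0"
  shows "szd nm (\<bar>c\<bar> * \<epsilon>) ((\<lambda>x. c *\<^sub>R x) ` A) \<subseteq> (\<lambda>x. c *\<^sub>R x) ` szd nm \<epsilon> A"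
proof
  fix y assume y: "y \<in> szd nm (\<bar>c\<bar> * \<epsilon>) ((\<lambda>x. c *\<^sub>R x) ` A)"
  then obtain x where x: "x \<in> A" "y = c *\<^sub>R x" by (auto simp: szd_def)
  have "\<not> small nm \<epsilon> (A \<inter> V)" if V: "open V" "x \<in> V" for V
  proof
    assume "small nm \<epsilon> (A \<inter> V)"
    from small_scaleR[OF this assms]
    have "small nm (\<bar>c\<bar> * \<epsilon>) ((\<lambda>x. c *\<^sub>R x) ` A \<inter> (\<lambda>x. c *\<^sub>R x) ` V)"
      by (rule small_subset) (use assms in auto)
    then show False
      using y V x open_scaleR_image[OF V(1) assms] by (auto simp: szd_def)
  qed
  then show "y \<in> (\<lambda>x. c *\<^sub>R x) ` szd nm \<epsilon> A" using x by (auto simp: szd_def)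
qed

end

section \<open>Transfinite iterates of the derivation\<close>

context
  assumes inf: "infinite (UNIV :: 'o set)"
begin

lemma sz_mono:
  fixes \<gamma> :: "'o ordinal"
  shows "A \<subseteq> B \<Longrightarrow> \<epsilon> \<le> \<epsilon>' \<Longrightarrow> sz nm \<epsilon>' \<gamma> A \<subseteq> sz nm \<epsilon> \<gamma> B"
  unfolding sz_def by (intro transrec_Inter_mono[OF inf] szd_mono)

lemma sz_suc: "sz nm \<epsilon> (osuc (\<gamma> :: 'o ordinal)) A = szd nm \<epsilon> (sz nm \<epsilon> \<gamma> A)"
  by (simp add: sz_def transrec_suc[OF inf])

lemma sz_antimono: "\<beta> \<le> \<gamma> \<Longrightarrow> sz nm \<epsilon> \<gamma> A \<subseteq> sz nm \<epsilon> (\<beta> :: 'o ordinal) A"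
  unfolding sz_def by (rule transrec_antimono[OF inf szd_subset])

lemma sz_subset: "sz nm \<epsilon> (\<gamma> :: 'o ordinal) A \<subseteq> A"
  using sz_antimono[OF ozero_le, of nm \<epsilon> \<gamma> A] by (simp add: sz_zero)

lemma sz_compact:
  fixes A :: "'v::{real_vector,t2_space} set" and \<gamma> :: "'o ordinal"
  assumes "compact A"
  shows "compact (sz nm \<epsilon> \<gamma> A)"
proof -
  have "closed (sz nm \<epsilon> \<gamma> A)"
  proof (induction \<gamma> rule: ordinal_induct[OF inf, case_names zero suc limit])
    case (limit \<gamma>)
    then show ?case unfolding sz_limit[OF limit.hyps] by (intro closed_INT) auto
  qed (simp_all add: sz_zero sz_suc szd_closed compact_imp_closed assms)
  then show ?thesis
    using compact_Int_closed[OF assms] sz_subset[of nm \<epsilon> \<gamma> A] by (metis inf.absorb_iff2)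
qed

text \<open>In the successor step the target stage \<open>?Y\<close> is closed, so it contains the
  closure of the localised stage and \<open>szd_local\<close> applies.\<close>

lemma sz_local:
  fixes A :: "'v::{real_vector,t2_space} set" and \<gamma> :: "'o ordinal"
  assumes A: "compact A" and V: "open V"
  shows "sz nm \<epsilon> \<gamma> A \<inter> V \<subseteq> sz nm \<epsilon> \<gamma> (closure (A \<inter> V))"
proof (induction \<gamma> rule: ordinal_induct[OF inf, case_names zero suc limit])
  case zero
  then show ?case using closure_subset[of "A \<inter> V"] by (simp add: sz_zero)
next
  case (suc \<gamma>)
  let ?X = "sz nm \<epsilon> \<gamma> A" and ?Y = "sz nm \<epsilon> \<gamma> (closure (A \<inter> V))"
  have "compact (closure (A \<inter> V))"
    using A by (metis closed_closure closure_minimal compact_Int_closed compact_imp_closed inf.absorb_iff2 inf_le1)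
  then have "closed ?Y" by (intro compact_imp_closed sz_compact)
  with suc have "closure (?X \<inter> V) \<subseteq> ?Y"
    by (intro closure_minimal) simp_all
  then have "szd nm \<epsilon> ?X \<inter> V \<subseteq> szd nm \<epsilon> ?Y"
    using szd_local[OF V, of nm \<epsilon> ?X] szd_mono[of "closure (?X \<inter> V)" ?Y \<epsilon> \<epsilon> nm] by simp
  then show ?case by (simp add: sz_suc)
next
  case (limit \<gamma>)
  have "sz nm \<epsilon> \<gamma> A \<inter> V \<subseteq> sz nm \<epsilon> \<beta> (closure (A \<inter> V))" if "\<beta> < \<gamma>" for \<beta>
    using limit.IH[OF that] sz_antimono[OF less_imp_le[OF that], of nm \<epsilon> A] by blast
  then show ?case unfolding sz_limit[OF limit.hyps, of _ _ "closure (A \<inter> V)"] by (intro INT_greatest) simp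
qed

lemma sz_Un:
  fixes A :: "'v::{real_vector,t2_space} set" and \<gamma> :: "'o ordinal"
  assumes A: "compact A" "compact B" and "0 < \<epsilon>"
  shows "sz nm \<epsilon> \<gamma> (A \<union> B) \<subseteq> sz nm \<epsilon> \<gamma> A \<union> sz nm \<epsilon> \<gamma> B"
proof (induction \<gamma> rule: ordinal_induct[OF inf, case_names zero suc limit])
  case (suc \<gamma>)
  have "szd nm \<epsilon> (sz nm \<epsilon> \<gamma> (A \<union> B)) \<subseteq> szd nm \<epsilon> (sz nm \<epsilon> \<gamma> A \<union> sz nm \<epsilon> \<gamma> B)"
    using suc by (intro szd_mono) simp_all
  also have "\<dots> \<subseteq> szd nm \<epsilon> (sz nm \<epsilon> \<gamma> A) \<union> szd nm \<epsilon> (sz nm \<epsilon> \<gamma> B)"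
    by (intro szd_Un compact_imp_closed sz_compact assms)
  finally show ?case by (simp add: sz_suc)
next
  case (limit \<gamma>)
  show ?case
  proof (rule subsetI, rule ccontr)
    fix x assume x: "x \<in> sz nm \<epsilon> \<gamma> (A \<union> B)" and "x \<notin> sz nm \<epsilon> \<gamma> A \<union> sz nm \<epsilon> \<gamma> B"
    then obtain \<beta> \<beta>' where *: "\<beta> < \<gamma>" "\<beta>' < \<gamma>" "x \<notin> sz nm \<epsilon> \<beta> A" "x \<notin> sz nm \<epsilon> \<beta>' B"
      by (auto simp: sz_limit[OF limit.hyps])
    \<comment> \<open>Stages decrease, so the two stages that exclude \<open>x\<close> merge into
      their maximum, still below the limit.\<close>
    define m where "m = max \<beta> \<beta>'"
    have m: "m < \<gamma>" "\<beta> \<le> m" "\<beta>' \<le> m" using * by (simp_all add: m_def)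
    have "x \<in> sz nm \<epsilon> m (A \<union> B)"
      using x m(1) by (simp add: sz_limit[OF limit.hyps])
    then have "x \<in> sz nm \<epsilon> m A \<union> sz nm \<epsilon> m B"
      using limit.IH[OF m(1)] by (rule rev_subsetD)
    then show False
      using * sz_antimono[OF m(2), of nm \<epsilon> A] sz_antimono[OF m(3), of nm \<epsilon> B] by auto
  qed
qed (simp add: sz_zero)

lemma sz_UN:
  fixes A :: "'i \<Rightarrow> 'v::{real_vector,t2_space} set" and \<gamma> :: "'o ordinal"
  assumes "finite I" "\<And>i. i \<in> I \<Longrightarrow> compact (A i)" "0 < \<epsilon>"
  shows "sz nm \<epsilon> \<gamma> (\<Union>i\<in>I. A i) \<subseteq> (\<Union>i\<in>I. sz nm \<epsilon> \<gamma> (A i))"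
  using assms
proof (induction I)
  case empty
  then show ?case using sz_subset[of nm \<epsilon> \<gamma> "{}"] by simp
next
  case (insert i I)
  have "sz nm \<epsilon> \<gamma> (A i \<union> (\<Union>i\<in>I. A i)) \<subseteq> sz nm \<epsilon> \<gamma> (A i) \<union> sz nm \<epsilon> \<gamma> (\<Union>i\<in>I. A i)"
    using insert by (intro sz_Un compact_UN) auto
  then show ?case using insert by auto
qed

end

context dual_norm_space
begin

context
  assumes inf: "infinite (UNIV :: 'o set)"
begin

lemma sz_nb:
  fixes \<gamma> :: "'o ordinal"
  assumes A: "compact A" and pos: "0 < \<epsilon>" "0 < r"
  shows "sz nm (\<epsilon> + 2 * r) \<gamma> (nb r A) \<subseteq> nb r (sz nm \<epsilon> \<gamma> A)"
proof (induction \<gamma> rule: ordinal_induct[OF inf, case_names zero suc limit])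
  case (suc \<gamma>)
  have "szd nm (\<epsilon> + 2 * r) (sz nm (\<epsilon> + 2 * r) \<gamma> (nb r A)) \<subseteq> szd nm (\<epsilon> + 2 * r) (nb r (sz nm \<epsilon> \<gamma> A))"
    using suc by (intro szd_mono) simp_all
  also have "\<dots> \<subseteq> nb r (szd nm \<epsilon> (sz nm \<epsilon> \<gamma> A))"
    by (intro szd_nb sz_compact[OF inf] assms)
  finally show ?case by (simp add: sz_suc[OF inf])
next
  case (limit \<gamma>)
  show ?case
  proof
    fix x assume x: "x \<in> sz nm (\<epsilon> + 2 * r) \<gamma> (nb r A)"
    \<comment> \<open>Each stage offers a point within \<open>r\<close> of \<open>x\<close>, but
      possibly a different one; compactness gives one point that serves all stages below the
      limit.\<close>
    define F where "F \<beta> = sz nm \<epsilon> \<beta> A \<inter> {a. nm (x - a) \<le> r}" for \<beta> :: "'o ordinal"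
    have "(\<Inter>\<beta>\<in>{..<\<gamma>}. F \<beta>) \<noteq> {}"
    proof (rule compact_antimono_Inter_nonempty[OF olimit_lessThan_nonempty[OF limit.hyps]])
      fix \<beta> assume \<beta>: "\<beta> \<in> {..<\<gamma>}"
      show "compact (F \<beta>)"
        unfolding F_def using compact_imp_closed[OF compact_ball_around[OF pos(2)]]
        by (intro compact_Int_closed sz_compact[OF inf] A)
      have "x \<in> sz nm (\<epsilon> + 2 * r) \<beta> (nb r A)"
        using x \<beta> by (simp add: sz_limit[OF limit.hyps])
      then have "x \<in> nb r (sz nm \<epsilon> \<beta> A)"
        using limit.IH[of \<beta>] \<beta> by auto
      then show "F \<beta> \<noteq> {}" by (auto simp: F_def nb_def)
      fix \<beta>' assume "\<beta> \<le> \<beta>'"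
      then show "F \<beta>' \<subseteq> F \<beta>"
        using sz_antimono[OF inf, of \<beta> \<beta>' nm \<epsilon> A] by (auto simp: F_def)
    qed
    then obtain a where "\<And>\<beta>. \<beta> < \<gamma> \<Longrightarrow> a \<in> sz nm \<epsilon> \<beta> A \<and> nm (x - a) \<le> r"
      unfolding F_def by blast
    then show "x \<in> nb r (sz nm \<epsilon> \<gamma> A)"
      unfolding nb_def sz_limit[OF limit.hyps] using olimit_lessThan_nonempty[OF limit.hyps]
      by (intro CollectI bexI[of _ a]) auto
  qed
qed (simp add: sz_zero)

text \<open>Covering radii scale by the absolute value of \<open>c\<close>. The case
  \<open>c = - 1\<close> yields the symmetry of derived sets of symmetric sets.\<close>

lemma sz_scaleR:
  fixes \<gamma> :: "'o ordinal"
  assumes c: "c \<noteq> 0"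
  shows "sz nm (\<bar>c\<bar> * \<epsilon>) \<gamma> ((\<lambda>x. c *\<^sub>R x) ` A) \<subseteq> (\<lambda>x. c *\<^sub>R x) ` sz nm \<epsilon> \<gamma> A"
proof (induction \<gamma> rule: ordinal_induct[OF inf, case_names zero suc limit])
  case (suc \<gamma>)
  have "szd nm (\<bar>c\<bar> * \<epsilon>) (sz nm (\<bar>c\<bar> * \<epsilon>) \<gamma> ((\<lambda>x. c *\<^sub>R x) ` A)) \<subseteq>
      szd nm (\<bar>c\<bar> * \<epsilon>) ((\<lambda>x. c *\<^sub>R x) ` sz nm \<epsilon> \<gamma> A)"
    using suc by (intro szd_mono) simp_all
  also have "\<dots> \<subseteq> (\<lambda>x. c *\<^sub>R x) ` szd nm \<epsilon> (sz nm \<epsilon> \<gamma> A)"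
    by (rule szd_scaleR[OF c])
  finally show ?case by (simp add: sz_suc[OF inf])
next
  case (limit \<gamma>)
  show ?case
  proof
    fix y assume y: "y \<in> sz nm (\<bar>c\<bar> * \<epsilon>) \<gamma> ((\<lambda>x. c *\<^sub>R x) ` A)"
    have "inverse c *\<^sub>R y \<in> sz nm \<epsilon> \<beta> A" if "\<beta> < \<gamma>" for \<beta>
    proof -
      have "y \<in> sz nm (\<bar>c\<bar> * \<epsilon>) \<beta> ((\<lambda>x. c *\<^sub>R x) ` A)"
        using y that by (simp add: sz_limit[OF limit.hyps])
      then have "y \<in> (\<lambda>x. c *\<^sub>R x) ` sz nm \<epsilon> \<beta> A"
        using limit.IH[OF that] by (rule rev_subsetD)
      then show ?thesis using c by auto
    qed
    then have "inverse c *\<^sub>R y \<in> sz nm \<epsilon> \<gamma> A"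
      by (simp add: sz_limit[OF limit.hyps])
    then show "y \<in> (\<lambda>x. c *\<^sub>R x) ` sz nm \<epsilon> \<gamma> A"
      using c by (intro image_eqI[of _ _ "inverse c *\<^sub>R y"]) auto
  qed
qed (simp add: sz_zero)

end

end

section \<open>Closed convex hulls\<close>

definition cch :: "'v::{real_vector,topological_space} set \<Rightarrow> 'v set" where
  "cch S = \<Inter>{K. closed K \<and> convex K \<and> S \<subseteq> K}"

lemma subset_cch: "S \<subseteq> cch S"
  by (auto simp: cch_def)

lemma closed_cch: "closed (cch S)"
  by (auto simp: cch_def)

lemma convex_cch: "convex (cch S)"
  unfolding cch_def by (rule convex_Inter) auto

lemma cch_minimal: "closed K \<Longrightarrow> convex K \<Longrightarrow> S \<subseteq> K \<Longrightarrow> cch S \<subseteq> K"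
  by (auto simp: cch_def)

lemma cch_mono: "S \<subseteq> T \<Longrightarrow> cch S \<subseteq> cch T"
  using subset_cch[of T] by (intro cch_minimal closed_cch convex_cch) auto

lemma cch_subset_compact:
  fixes K :: "'v::{real_vector,t2_space} set"
  assumes "compact K" "convex K" "S \<subseteq> K"
  shows "cch S \<subseteq> K" and "compact (cch S)"
proof -
  show sub: "cch S \<subseteq> K" using assms by (intro cch_minimal compact_imp_closed)
  then show "compact (cch S)"
    using compact_Int_closed[OF assms(1) closed_cch, of S] by (simp add: Int_absorb1)
qed

section \<open>Joins of convex sets\<close>

definition segment_join :: "'v::real_vector set \<Rightarrow> 'v set \<Rightarrow> 'v set" where
  "segment_join P Q = (\<lambda>(t, p, q). (1 - t) *\<^sub>R p + t *\<^sub>R q) ` ({0..1} \<times> P \<times> Q)"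

lemma segment_joinI:
  "0 \<le> t \<Longrightarrow> t \<le> 1 \<Longrightarrow> p \<in> P \<Longrightarrow> q \<in> Q \<Longrightarrow> (1 - t) *\<^sub>R p + t *\<^sub>R q \<in> segment_join P Q"
  unfolding segment_join_def by (rule image_eqI[of _ _ "(t, p, q)"]) auto

lemma segment_joinE:
  assumes "z \<in> segment_join P Q"
  obtains t p q where "0 \<le> t" "t \<le> 1" "p \<in> P" "q \<in> Q" "z = (1 - t) *\<^sub>R p + t *\<^sub>R q"
  using assms unfolding segment_join_def by auto

lemma subset_segment_join: "P \<noteq> {} \<Longrightarrow> Q \<noteq> {} \<Longrightarrow> P \<union> Q \<subseteq> segment_join P Q"
  using segment_joinI[of 0 _ P _ Q] segment_joinI[of 1 _ P _ Q] by auto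

text \<open>Two weights on points of \<open>P\<close> merge into one point carrying the total
  weight. A total of zero is allowed, so that the ends of a join need no separate treatment.\<close>

lemma convex_combination_scaled:
  assumes "convex P" "p \<in> P" "p' \<in> P" "0 \<le> a" "0 \<le> b"
  obtains p'' where "p'' \<in> P" "a *\<^sub>R p + b *\<^sub>R p' = (a + b) *\<^sub>R p''"
proof (cases "a + b = 0")
  case True
  then have "a = 0" "b = 0" using assms by auto
  then show ?thesis using that[of p] assms by simp
next
  case False
  have "(a / (a + b)) *\<^sub>R p + (b / (a + b)) *\<^sub>R p' \<in> P"
    using assms False by (intro convexD) (auto simp: add_divide_distrib[symmetric])
  then show ?thesis using that False by (auto simp: scaleR_add_right)
qed

lemma convex_segment_join:
  assumes P: "convex P" and Q: "convex Q"
  shows "convex (segment_join P Q)"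
proof (rule convexI)
  fix x y and u v :: real
  assume xy: "x \<in> segment_join P Q" "y \<in> segment_join P Q" and uv: "0 \<le> u" "0 \<le> v" "u + v = 1"
  obtain t p q where x: "0 \<le> t" "t \<le> 1" "p \<in> P" "q \<in> Q" "x = (1 - t) *\<^sub>R p + t *\<^sub>R q"
    using xy(1) by (rule segment_joinE)
  obtain t' p' q' where y: "0 \<le> t'" "t' \<le> 1" "p' \<in> P" "q' \<in> Q" "y = (1 - t') *\<^sub>R p' + t' *\<^sub>R q'"
    using xy(2) by (rule segment_joinE)
  obtain p'' where p'': "p'' \<in> P" "(u * (1 - t)) *\<^sub>R p + (v * (1 - t')) *\<^sub>R p' = (u * (1 - t) + v * (1 - t')) *\<^sub>R p''"
    using convex_combination_scaled[OF P x(3) y(3), of "u * (1 - t)" "v * (1 - t')"] uv x y by auto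
  obtain q'' where q'': "q'' \<in> Q" "(u * t) *\<^sub>R q + (v * t') *\<^sub>R q' = (u * t + v * t') *\<^sub>R q''"
    using convex_combination_scaled[OF Q x(4) y(4), of "u * t" "v * t'"] uv x y by auto
  have "u *\<^sub>R x + v *\<^sub>R y = ((u * (1 - t)) *\<^sub>R p + (v * (1 - t')) *\<^sub>R p') + ((u * t) *\<^sub>R q + (v * t') *\<^sub>R q')"
    by (simp add: x(5) y(5) scaleR_add_right)
  also have "\<dots> = (u * (1 - t) + v * (1 - t')) *\<^sub>R p'' + (u * t + v * t') *\<^sub>R q''"
    by (simp only: p'' q'')
  also have "u * (1 - t) + v * (1 - t') = 1 - (u * t + v * t')"
    using uv by (simp add: algebra_simps)
  finally have eq: "u *\<^sub>R x + v *\<^sub>R y = (1 - (u * t + v * t')) *\<^sub>R p'' + (u * t + v * t') *\<^sub>R q''" .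
  have "u * t + v * t' \<le> u * 1 + v * 1"
    using x y uv by (intro add_mono mult_left_mono) auto
  then show "u *\<^sub>R x + v *\<^sub>R y \<in> segment_join P Q"
    unfolding eq using p'' q'' x y uv by (intro segment_joinI) auto
qed

lemma compact_segment_join:
  fixes P Q :: "'v::locally_convex_space set"
  assumes "compact P" "compact Q"
  shows "compact (segment_join P Q)"
  unfolding segment_join_def case_prod_unfold
  using assms by (intro compact_continuous_image compact_Times continuous_on_scaleR' continuous_intros) auto

text \<open>The product with the reals is not declared an instance of the class, so continuity of
  the join map is checked in each coordinate.\<close>

lemma compact_segment_join_prod:
  fixes P Q :: "('v::locally_convex_space \<times> real) set"
  assumes "compact P" "compact Q"
  shows "compact (segment_join P Q)"
proof -
  have "segment_join P Q = (\<lambda>z. ((1 - fst z) *\<^sub>R fst (fst (snd z)) + fst z *\<^sub>R fst (snd (snd z)),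
      (1 - fst z) * snd (fst (snd z)) + fst z * snd (snd (snd z)))) ` ({0..1} \<times> P \<times> Q)"
    unfolding segment_join_def by (intro image_cong) (auto simp: prod_eq_iff)
  moreover have "compact \<dots>"
    using assms by (intro compact_continuous_image compact_Times continuous_on_Pair continuous_on_scaleR' continuous_intros) auto
  ultimately show ?thesis by simp
qed

text \<open>The join of the two hulls is compact and convex, hence contains the hull of the union. A
  join with an empty set is empty, which is why the two pure cases are listed.\<close>

lemma cch_Un_cases:
  fixes K :: "('v::locally_convex_space \<times> real) set"
  assumes K: "compact K" "convex K" "S \<union> T \<subseteq> K" and z: "z \<in> cch (S \<union> T)"
  obtains "z \<in> cch S" | "z \<in> cch T" | "z \<in> segment_join (cch S) (cch T)"
proof (cases "S = {} \<or> T = {}")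
  case True
  then show ?thesis using that z by auto
next
  case False
  have ne: "cch S \<noteq> {}" "cch T \<noteq> {}" using False subset_cch by blast+
  have "compact (cch S)" "compact (cch T)"
    using cch_subset_compact(2)[OF K(1,2)] K(3) by auto
  then have "closed (segment_join (cch S) (cch T))"
    by (intro compact_imp_closed compact_segment_join_prod)
  moreover have "S \<union> T \<subseteq> segment_join (cch S) (cch T)"
    using subset_segment_join[OF ne] subset_cch[of S] subset_cch[of T] by blast
  ultimately have "cch (S \<union> T) \<subseteq> segment_join (cch S) (cch T)"
    by (intro cch_minimal convex_segment_join convex_cch)
  with z that show ?thesis by blast
qed

lemma convex_hull_insert_segment_join:
  "S \<noteq> {} \<Longrightarrow> convex hull (insert a S) = segment_join {a} (convex hull S)"
  unfolding convex_hull_insert segment_join_def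
  by (force simp: image_iff intro: exI[of _ "1 - _"])

lemma compact_convex_hull_finite:
  fixes C :: "'v::locally_convex_space set"
  assumes "finite C"
  shows "compact (convex hull C)"
  using assms
proof (induction C)
  case (insert a C)
  then show ?case
    by (cases "C = {}") (auto simp: convex_hull_insert_segment_join compact_segment_join)
qed simp

section \<open>Closed convex hulls of small sets\<close>

context dual_norm_space
begin

lemma nm_sum_le: "nm (x - y) \<le> a \<Longrightarrow> nm (y - z) \<le> b \<Longrightarrow> nm (x - z) \<le> a + b"
  using nm_diff_triangle[of x z y] by simp

text \<open>Adding a vertex combines a net of the old hull with a net of the parameter interval;
  each accounts for half of the error.\<close>

lemma totally_bounded_convex_hull_finite:
  assumes "finite C" "0 < \<eta>"
  shows "\<exists>F. finite F \<and> convex hull C \<subseteq> nb \<eta> F"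
  using assms
proof (induction C arbitrary: \<eta>)
  case empty
  then show ?case by (intro exI[of _ "{}"]) simp
next
  case (insert a C)
  show ?case
  proof (cases "C = {}")
    case True
    then show ?thesis using insert by (intro exI[of _ "{a}"]) (auto simp: nb_def)
  next
    case False
    obtain F where F: "finite F" "convex hull C \<subseteq> nb (\<eta> / 2) F"
      using insert.IH[of "\<eta> / 2"] insert.prems by auto
    \<comment> \<open>\<open>M\<close> bounds the distances from \<open>a\<close> to the net; the
      summand 1 keeps it positive for the division below.\<close>
    define M where "M = 1 + (\<Sum>f\<in>F. nm (f - a))"
    have sum: "0 \<le> (\<Sum>f\<in>F. nm (f - a))" by (intro sum_nonneg) simp
    have M: "nm (f - a) \<le> M" if "f \<in> F" for f
      using member_le_sum[OF that, of "\<lambda>f. nm (f - a)"] F(1) by (simp add: M_def)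
    have M0: "0 < M" using sum by (simp add: M_def)
    then have "0 < \<eta> / (2 * M)" using insert.prems by simp
    then obtain T where T: "finite T" "{0..1::real} \<subseteq> (\<Union>t\<in>T. ball t (\<eta> / (2 * M)))"
      using compact_eq_totally_bounded[of "{0..1::real}"] by auto
    let ?F = "(\<lambda>(t, f). (1 - t) *\<^sub>R a + t *\<^sub>R f) ` (T \<times> F)"
    have "segment_join {a} (convex hull C) \<subseteq> nb \<eta> ?F"
    proof
      fix z assume "z \<in> segment_join {a} (convex hull C)"
      then obtain t q where t: "0 \<le> t" "t \<le> 1" "q \<in> convex hull C" "z = (1 - t) *\<^sub>R a + t *\<^sub>R q"
        by (auto elim: segment_joinE)
      obtain f where f: "f \<in> F" "nm (q - f) \<le> \<eta> / 2" using t F by (auto simp: nb_def)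
      obtain t' where t': "t' \<in> T" "\<bar>t - t'\<bar> < \<eta> / (2 * M)"
        using t T(2) by (auto simp: dist_real_def abs_minus_commute)
      have "z - ((1 - t) *\<^sub>R a + t *\<^sub>R f) = t *\<^sub>R (q - f)"
        by (simp add: t(4) scaleR_diff_right)
      then have 1: "nm (z - ((1 - t) *\<^sub>R a + t *\<^sub>R f)) \<le> \<eta> / 2"
        using mult_mono[of t 1 "nm (q - f)" "\<eta> / 2"] t f by (simp add: nm_scaleR)
      have "((1 - t) *\<^sub>R a + t *\<^sub>R f) - ((1 - t') *\<^sub>R a + t' *\<^sub>R f) = (t - t') *\<^sub>R (f - a)"
        by (simp add: algebra_simps)
      then have "nm (((1 - t) *\<^sub>R a + t *\<^sub>R f) - ((1 - t') *\<^sub>R a + t' *\<^sub>R f)) = \<bar>t - t'\<bar> * nm (f - a)"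
        by (simp add: nm_scaleR)
      also have "\<dots> \<le> \<eta> / (2 * M) * M"
        using t' M[OF f(1)] M0 by (intro mult_mono) auto
      finally have "nm (z - ((1 - t') *\<^sub>R a + t' *\<^sub>R f)) \<le> \<eta>"
        using nm_sum_le[OF 1] M0 by fastforce
      then show "z \<in> nb \<eta> ?F"
        unfolding nb_def using t'(1) f(1) by (intro CollectI bexI[of _ "(1 - t') *\<^sub>R a + t' *\<^sub>R f"]) auto
    qed
    then show ?thesis
      using T(1) F(1) convex_hull_insert_segment_join[OF False] by (intro exI[of _ ?F]) auto
  qed
qed

lemma convex_nb:
  assumes "convex A"
  shows "convex (nb r A)"
proof (rule convexI)
  fix x y and u v :: real
  assume xy: "x \<in> nb r A" "y \<in> nb r A" and uv: "0 \<le> u" "0 \<le> v" "u + v = 1"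
  then obtain a b where ab: "a \<in> A" "b \<in> A" "nm (x - a) \<le> r" "nm (y - b) \<le> r" by (auto simp: nb_def)
  have "u *\<^sub>R (x - a) + v *\<^sub>R (y - b) \<in> {x. nm x \<le> r}"
    using convexD[OF convex_nm_ball] ab uv by blast
  then have "nm ((u *\<^sub>R x + v *\<^sub>R y) - (u *\<^sub>R a + v *\<^sub>R b)) \<le> r"
    by (simp add: algebra_simps)
  moreover have "u *\<^sub>R a + v *\<^sub>R b \<in> A" using convexD[OF assms ab(1,2) uv] .
  ultimately show "u *\<^sub>R x + v *\<^sub>R y \<in> nb r A" by (auto simp: nb_def)
qed

lemma nb_nb: "nb r (nb s A) \<subseteq> nb (r + s) A"
  unfolding nb_def using nm_sum_le by blast

text \<open>Finitely many balls put \<open>S\<close> within \<open>e / 2\<close> of a compact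
  polytope, and so also its closed convex hull. The polytope has finite norm nets, whose mesh is
  paid for by the slack between \<open>e\<close> and \<epsilon>.\<close>

lemma small_cch:
  assumes "small nm \<epsilon> S"
  shows "small nm \<epsilon> (cch S)"
proof -
  obtain e C where *: "0 < e" "e < \<epsilon>" "finite C" "S \<subseteq> (\<Union>c\<in>C. {x. nm (x - c) \<le> e / 2})"
    using assms unfolding small_def by blast
  have "S \<subseteq> nb (e / 2) (convex hull C)"
    using *(4) hull_subset[of C convex] by (fastforce simp: nb_def)
  then have sub: "cch S \<subseteq> nb (e / 2) (convex hull C)"
    using * by (intro cch_minimal convex_nb compact_imp_closed compact_nb compact_convex_hull_finite) auto
  \<comment> \<open>With this mesh \<open>e + 2 * \<eta>\<close> is the midpoint of \<open>e\<close>
    and \<epsilon>.\<close>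
  define \<eta> where "\<eta> = (\<epsilon> - e) / 4"
  have \<eta>: "0 < \<eta>" using * by (simp add: \<eta>_def)
  obtain F where F: "finite F" "convex hull C \<subseteq> nb \<eta> F"
    using totally_bounded_convex_hull_finite[OF *(3) \<eta>] by blast
  have "cch S \<subseteq> nb (e / 2) (nb \<eta> F)"
    using sub nb_mono[OF order_refl F(2)] by blast
  then have "cch S \<subseteq> nb (e / 2 + \<eta>) F"
    using nb_nb by blast
  also have "\<dots> = (\<Union>c\<in>F. {x. nm (x - c) \<le> (e + 2 * \<eta>) / 2})"
    by (auto simp: nb_def add_divide_distrib)
  finally show ?thesis
    unfolding small_def using * \<eta> F(1)
    by (intro exI[of _ "e + 2 * \<eta>"] exI[of _ F]) (auto simp: \<eta>_def field_simps)
qed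

lemma szd_empty_iff_small:
  assumes "compact E" "0 < \<epsilon>"
  shows "szd nm \<epsilon> E = {} \<longleftrightarrow> small nm \<epsilon> E"
proof
  assume empty: "szd nm \<epsilon> E = {}"
  then have "E \<subseteq> \<Union>{V. open V \<and> small nm \<epsilon> (E \<inter> V)}" by (auto simp: szd_def)
  with assms(1) obtain \<V> where \<V>: "\<V> \<subseteq> {V. open V \<and> small nm \<epsilon> (E \<inter> V)}" "finite \<V>" "E \<subseteq> \<Union>\<V>"
    by (rule compactE) auto
  then have "small nm \<epsilon> (\<Union>V\<in>\<V>. E \<inter> V)"
    using assms(2) by (intro small_UN) auto
  then show "small nm \<epsilon> E" by (rule small_subset) (use \<V> in blast)
next
  assume "small nm \<epsilon> E"
  then show "szd nm \<epsilon> E = {}" by (auto simp: szd_def dest: spec[of _ UNIV])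
qed

end

section \<open>Derivations of convex hulls\<close>

lemma convex_fst_image: "convex H \<Longrightarrow> convex {x. \<exists>t\<ge>s. (x, t) \<in> H}"
  for H :: "('v::real_vector \<times> real) set"
proof (rule convexI)
  fix x y and u v :: real
  assume H: "convex H" and xy: "x \<in> {x. \<exists>t\<ge>s. (x, t) \<in> H}" "y \<in> {x. \<exists>t\<ge>s. (x, t) \<in> H}"
    and uv: "0 \<le> u" "0 \<le> v" "u + v = 1"
  obtain a b where ab: "s \<le> a" "(x, a) \<in> H" "s \<le> b" "(y, b) \<in> H" using xy by auto
  have "(u *\<^sub>R x + v *\<^sub>R y, u * a + v * b) \<in> H"
    using convexD[OF H ab(2,4) uv] by simp
  moreover have "u * s + v * s \<le> u * a + v * b" using ab uv by (intro add_mono mult_left_mono)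
  then have "s \<le> u * a + v * b" using uv by (metis distrib_right mult_1)
  ultimately show "u *\<^sub>R x + v *\<^sub>R y \<in> {x. \<exists>t\<ge>s. (x, t) \<in> H}" by auto
qed

text \<open>Two independent moves by \<open>U\<close> are controlled: one takes \<open>x\<close> to
  a nearby average, the other undoes the replacement of points by nearby points of higher
  rank.\<close>

lemma locally_convex_difference_nhd:
  fixes L :: "'v::locally_convex_space set"
  assumes "closed L" "x \<notin> L"
  obtains U where "closed U" "convex U" "0 \<in> interior U" "\<And>u u'. u \<in> U \<Longrightarrow> u' \<in> U \<Longrightarrow> x + u - u' \<notin> L"
proof -
  define T where "T = (\<lambda>(u, u'). x + u - u') -` (- L)"
  have "open T"
    unfolding T_def case_prod_unfold using assms(1)
    by (intro open_vimage continuous_intros open_Compl)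
  moreover have "(0, 0) \<in> T" using assms(2) by (simp add: T_def)
  ultimately obtain A B where AB: "open A" "open B" "(0, 0) \<in> A \<times> B" "A \<times> B \<subseteq> T"
    by (rule open_prod_elim)
  then obtain U where U: "closed U" "convex U" "0 \<in> interior U" "U \<subseteq> A \<inter> B"
    using locally_convex[of "A \<inter> B"] by auto
  moreover have "x + u - u' \<notin> L" if "u \<in> U" "u' \<in> U" for u u'
  proof -
    have "(u, u') \<in> T" using that U(4) AB(4) by blast
    then show ?thesis by (simp add: T_def)
  qed
  ultimately show ?thesis using that by blast
qed

context dual_norm_space
begin

context
  assumes inf: "infinite (UNIV :: 'o set)"
begin

lemma compact_sz_funpow:
  fixes \<gamma> :: "'o ordinal"
  assumes "compact E"
  shows "compact ((sz nm \<epsilon> \<gamma> ^^ j) E)"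
  by (induction j) (simp_all add: assms sz_compact[OF inf])

lemma sz_funpow_antimono:
  fixes \<gamma> :: "'o ordinal"
  assumes "i \<le> j"
  shows "(sz nm \<epsilon> \<gamma> ^^ j) E \<subseteq> (sz nm \<epsilon> \<gamma> ^^ i) E"
  by (rule lift_Suc_antimono_le[of "\<lambda>j. (sz nm \<epsilon> \<gamma> ^^ j) E", OF _ assms]) (simp add: sz_subset[OF inf])

text \<open>The sets \<open>A j\<close> are the iterated derivatives of \<open>E\<close>, and \<open>L s\<close> consists of the barycentres
  of the measures on \<open>E\<close> whose average rank is at least \<open>s\<close>, a point of \<open>A j\<close> having rank \<open>\<ge> j\<close>.
  Near a point of \<open>L s\<close> outside \<open>L (s + \<delta>)\<close> such a measure has mass at least \<open>1 - \<delta>\<close> away from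
  neighbourhoods of the next derivatives, hence on the compact sets \<open>E' j\<close> whose derivative is
  empty.\<close>

lemma convex_chain:
  fixes \<gamma> :: "'o ordinal"
  assumes hull: "\<And>\<epsilon> \<epsilon>' E R. 0 < \<epsilon> \<Longrightarrow> \<epsilon> < \<epsilon>' \<Longrightarrow> compact E \<Longrightarrow> E \<subseteq> {x. nm x \<le> R} \<Longrightarrow>
      sz nm \<epsilon> \<gamma> E = {} \<Longrightarrow> sz nm \<epsilon>' \<gamma> (cch E) = {}"
    and \<epsilon>: "0 < \<epsilon>" "\<epsilon> < \<epsilon>'" and E: "compact E" "E \<subseteq> {x. nm x \<le> R}"
    and n: "(sz nm \<epsilon> \<gamma> ^^ n) E = {}"
  obtains C :: "nat \<Rightarrow> 'v set" and m where "E \<subseteq> C 0" "C m = {}"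
    "\<And>k. compact (C k)" "\<And>k. convex (C k)" "\<And>k. sz nm \<epsilon>' \<gamma> (C k) \<subseteq> C (Suc k)"
    "\<And>k x. (\<And>x. x \<in> E \<Longrightarrow> - x \<in> E) \<Longrightarrow> x \<in> C k \<Longrightarrow> - x \<in> C k"
proof -
  define R' where "R' = max R 1"
  have R': "0 < R'" "E \<subseteq> {x. nm x \<le> R'}" using E(2) by (auto simp: R'_def)
  define A where "A j = (sz nm \<epsilon> \<gamma> ^^ j) E" for j
  have A_Suc: "A (Suc j) = sz nm \<epsilon> \<gamma> (A j)" for j by (simp add: A_def)
  have A_compact: "compact (A j)" for j unfolding A_def by (rule compact_sz_funpow[OF E(1)])
  have A_sub: "A j \<subseteq> {x. nm x \<le> R'}" for j
    using sz_funpow_antimono[of 0 j \<epsilon> \<gamma> E] R'(2) by (simp add: A_def)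
  have A_n: "A n = {}" using n by (simp add: A_def)
  \<comment> \<open>The rank becomes the second coordinate. Over a point of the hull
    \<open>H\<close>, the height is the mean rank of an average that represents it; ranks stop below
    \<open>n\<close> because \<open>A n\<close> is empty.\<close>
  define G where "G = (\<Union>j\<in>{..<n}. A j \<times> {real j})"
  define K where "K = {x. nm x \<le> R'} \<times> {0..real n}"
  have K: "compact K" "convex K"
    unfolding K_def by (auto intro!: compact_Times compact_nm_ball convex_Times convex_nm_ball R')
  have GK: "G \<subseteq> K" using A_sub by (fastforce simp: G_def K_def)
  define H where "H = cch G"
  have H: "compact H" "convex H" "H \<subseteq> K"
    using cch_subset_compact[OF K GK] convex_cch by (auto simp: H_def)
  define L where "L s = {x. \<exists>t\<ge>s. (x, t) \<in> H}" for s
  have L_compact: "compact (L s)" for s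
  proof -
    have "L s = fst ` (H \<inter> UNIV \<times> {s..})" by (force simp: L_def)
    then show ?thesis
      using H(1) by (auto intro!: compact_continuous_image continuous_intros compact_Int_closed closed_Times)
  qed
  have L_convex: "convex (L s)" for s unfolding L_def by (rule convex_fst_image[OF H(2)])
  \<comment> \<open>Half of the gap between \<epsilon> and \<epsilon>' is spent on passing to a
    hull, the other half on an enlargement by \<open>r\<close>. The latter bounds the displacement
    when mass \<delta> is moved inside the ball of radius \<open>R'\<close>. Also \<delta> is at
    most 1, so that one full rank is at least the gain asked for.\<close>
  define \<epsilon>1 where "\<epsilon>1 = (\<epsilon> + \<epsilon>') / 2"
  define \<delta> where "\<delta> = min 1 ((\<epsilon>' - \<epsilon>) / (8 * R'))"
  define r where "r = 2 * R' * \<delta>"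
  have \<delta>: "0 < \<delta>" "\<delta> \<le> 1" using \<epsilon> R'(1) by (auto simp: \<delta>_def)
  then have r: "0 < r" using R' by (simp add: r_def)
  have "R' * \<delta> \<le> R' * ((\<epsilon>' - \<epsilon>) / (8 * R'))" unfolding \<delta>_def using R'(1) by (intro mult_left_mono) auto
  also have "\<dots> = (\<epsilon>' - \<epsilon>) / 8" using R'(1) by simp
  finally have "2 * r \<le> (\<epsilon>' - \<epsilon>) / 2" by (simp add: r_def)
  then have \<epsilon>1: "\<epsilon> < \<epsilon>1" "\<epsilon>1 + 2 * r \<le> \<epsilon>'"
    using \<epsilon> by (auto simp: \<epsilon>1_def field_simps)
  have step: "sz nm \<epsilon>' \<gamma> (L s) \<subseteq> L (s + \<delta>)" for s
  proof (rule subsetI, rule ccontr)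
    fix x assume x: "x \<in> sz nm \<epsilon>' \<gamma> (L s)" and not: "x \<notin> L (s + \<delta>)"
    obtain U where U: "closed U" "convex U" "0 \<in> interior U"
      and disj: "\<And>u u'. u \<in> U \<Longrightarrow> u' \<in> U \<Longrightarrow> x + u - u' \<notin> L (s + \<delta>)"
      using locally_convex_difference_nhd[OF compact_imp_closed[OF L_compact] not] by metis
    have U0: "0 \<in> U" using U(3) interior_subset by blast
    \<comment> \<open>Points of rank at least \<open>j\<close> are split: away from the next
      derivative they form \<open>E' j\<close>, on which the derivation dies, and close to it they
      form \<open>G' j\<close>. The two parts may overlap.\<close>
    define W where "W j = (\<Union>a\<in>A (Suc j). {y. y - a \<in> interior U})" for j
    define E' where "E' j = A j - W j" for j
    define G' where "G' j = A j \<inter> (\<Union>a\<in>A (Suc j). {y. y - a \<in> U})" for j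
    have W_open: "open (W j)" for j unfolding W_def by (intro open_UN ballI open_translation') simp
    have E'_compact: "compact (E' j)" for j unfolding E'_def by (intro compact_diff A_compact W_open)
    have E'_sz: "sz nm \<epsilon> \<gamma> (E' j) = {}" for j
    proof -
      have "sz nm \<epsilon> \<gamma> (E' j) \<subseteq> A (Suc j)"
        unfolding A_Suc by (rule sz_mono[OF inf]) (auto simp: E'_def)
      moreover have "A (Suc j) \<subseteq> W j" using U(3) by (force simp: W_def)
      moreover have "sz nm \<epsilon> \<gamma> (E' j) \<subseteq> E' j" by (rule sz_subset[OF inf])
      ultimately show ?thesis unfolding E'_def by blast
    qed
    define F where "F = (\<Union>j\<in>{..<n}. E' j)"
    have F: "compact F" "F \<subseteq> {x. nm x \<le> R'}"
      using A_sub by (auto simp: F_def E'_def intro!: compact_UN E'_compact[unfolded E'_def])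
    have "sz nm \<epsilon> \<gamma> F \<subseteq> (\<Union>j\<in>{..<n}. sz nm \<epsilon> \<gamma> (E' j))"
      unfolding F_def by (rule sz_UN[OF inf]) (use E'_compact \<epsilon> in auto)
    then have "sz nm \<epsilon> \<gamma> F = {}" using E'_sz by simp
    then have F_empty: "sz nm \<epsilon>1 \<gamma> (cch F) = {}"
      using hull[OF \<epsilon>(1) \<epsilon>1(1) F] by blast
    define P where "P = (\<Union>j\<in>{..<n}. E' j \<times> {real j})"
    define Q where "Q = (\<Union>j\<in>{..<n}. G' j \<times> {real j})"
    have PQ_G: "P \<subseteq> G" "Q \<subseteq> G" by (auto simp: P_def Q_def G_def E'_def G'_def)
    have G_PQ: "G \<subseteq> P \<union> Q"
      using interior_subset[of U] by (fastforce simp: P_def Q_def G_def E'_def G'_def W_def)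
    have PQ_K: "P \<union> Q \<subseteq> K" using PQ_G GK by blast
    have P_H: "cch P \<subseteq> H" and Q_H: "cch Q \<subseteq> H" unfolding H_def by (rule cch_mono[OF PQ_G(1)], rule cch_mono[OF PQ_G(2)])
    have H_PQ: "H \<subseteq> cch (P \<union> Q)" unfolding H_def by (rule cch_mono[OF G_PQ])
    \<comment> \<open>\<open>K'\<close> is \<open>H\<close> with first coordinates moved by
      \<open>U\<close>. Cutting \<open>U\<close> with a ball gives compactness, and the radius
      \<open>2 * R'\<close> admits all differences of points of \<open>E\<close>.\<close>
    define K' where "K' = (\<lambda>(h, u). (fst h + u, snd h)) ` (H \<times> (U \<inter> {u. nm u \<le> 2 * R'}))"
    have "compact (U \<inter> {u. nm u \<le> 2 * R'})"
      using closed_Int_compact[OF U(1) compact_nm_ball[of "2 * R'"]] R'(1) by simp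
    then have "compact K'"
      unfolding K'_def case_prod_unfold using H(1)
      by (intro compact_continuous_image compact_Times continuous_intros)
    have "convex K'"
    proof (rule convexI)
      fix z w and a b :: real
      assume zw: "z \<in> K'" "w \<in> K'" and ab: "0 \<le> a" "0 \<le> b" "a + b = 1"
      obtain h u where z: "h \<in> H" "u \<in> U \<inter> {u. nm u \<le> 2 * R'}" "z = (fst h + u, snd h)"
        using zw(1) unfolding K'_def by auto
      obtain k v where w: "k \<in> H" "v \<in> U \<inter> {u. nm u \<le> 2 * R'}" "w = (fst k + v, snd k)"
        using zw(2) unfolding K'_def by auto
      have "a *\<^sub>R h + b *\<^sub>R k \<in> H" using convexD[OF H(2) z(1) w(1) ab] .
      moreover have "a *\<^sub>R u + b *\<^sub>R v \<in> U \<inter> {u. nm u \<le> 2 * R'}"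
        using convexD[OF convex_Int[OF U(2) convex_nm_ball] z(2) w(2) ab] .
      ultimately show "a *\<^sub>R z + b *\<^sub>R w \<in> K'"
        unfolding K'_def
        by (intro image_eqI[of _ _ "(a *\<^sub>R h + b *\<^sub>R k, a *\<^sub>R u + b *\<^sub>R v)"])
          (auto simp: z(3) w(3) algebra_simps)
    qed
    have H_K': "H \<subseteq> K'"
    proof
      fix h assume "h \<in> H"
      then show "h \<in> K'"
        unfolding K'_def using U0 R'(1) by (intro image_eqI[of _ _ "(h, 0)"]) auto
    qed
    \<comment> \<open>Over points near \<open>x\<close> the heights in \<open>K'\<close> stay below
      \<open>s + \<delta>\<close>: undoing the move by \<open>U\<close> leads to a point of
      \<open>H\<close> whose first coordinate avoids \<open>L (s + \<delta>)\<close>.\<close>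
    have K'_L: "t < s + \<delta>" if yt: "(y, t) \<in> K'" "y - x \<in> U" for y t
    proof (rule ccontr)
      assume "\<not> t < s + \<delta>"
      obtain h u where hu: "h \<in> H" "u \<in> U" "(y, t) = (fst h + u, snd h)"
        using yt(1) unfolding K'_def by auto
      then have "(y - u, t) \<in> H" by (metis Pair_inject add_diff_cancel_right' prod.collapse)
      then have "y - u \<in> L (s + \<delta>)" unfolding L_def using \<open>\<not> t < s + \<delta>\<close> by (auto intro!: exI[of _ t])
      with disj[OF yt(2) hu(2)] show False by (simp add: algebra_simps)
    qed
    \<comment> \<open>A point near the next derivative can be traded, within \<open>U\<close>, for a
      point of rank one higher. So raising heights in \<open>Q\<close> by 1 stays in
      \<open>K'\<close>, and this passes to the hull since \<open>K'\<close> is closed and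
      convex.\<close>
    have "Q \<subseteq> {z. (fst z, snd z + 1) \<in> K'}"
    proof
      fix z assume "z \<in> Q"
      then obtain j g where z: "z = (g, real j)" "j < n" "g \<in> G' j" by (auto simp: Q_def)
      then obtain a where a: "g \<in> A j" "a \<in> A (Suc j)" "g - a \<in> U" by (auto simp: G'_def)
      have "Suc j \<noteq> n" using a(2) A_n by auto
      then have "(a, real (Suc j)) \<in> G" using a(2) z(2) by (force simp: G_def)
      then have h: "(a, real (Suc j)) \<in> H" unfolding H_def using subset_cch by blast
      have "nm (g - a) \<le> nm g + nm a" using nm_add[of g "- a"] by simp
      also have "\<dots> \<le> 2 * R'" using A_sub[of j] A_sub[of "Suc j"] a(1,2) by fastforce
      finally show "z \<in> {z. (fst z, snd z + 1) \<in> K'}"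
        unfolding K'_def using h a z
        by (intro CollectI image_eqI[of _ _ "((a, real (Suc j)), g - a)"]) auto
    qed
    moreover have "closed {z. (fst z, snd z + 1) \<in> K'}"
    proof -
      have "closed ((\<lambda>z. (fst z, snd z + 1)) -` K')"
        using compact_imp_closed[OF \<open>compact K'\<close>]
        by (intro closed_vimage continuous_intros)
      then show ?thesis by (simp add: vimage_def)
    qed
    moreover have "convex {z. (fst z, snd z + 1) \<in> K'}"
    proof (rule convexI)
      fix z w and a b :: real
      assume zw: "z \<in> {z. (fst z, snd z + 1) \<in> K'}" "w \<in> {z. (fst z, snd z + 1) \<in> K'}"
        and ab: "0 \<le> a" "0 \<le> b" "a + b = 1"
      have "a *\<^sub>R (fst z, snd z + 1) + b *\<^sub>R (fst w, snd w + 1) \<in> K'"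
        using convexD[OF \<open>convex K'\<close> _ _ ab] zw by blast
      moreover have "a * (snd z + 1) + b * (snd w + 1) = a * snd z + b * snd w + 1"
        using ab by (simp add: algebra_simps)
      ultimately show "a *\<^sub>R z + b *\<^sub>R w \<in> {z. (fst z, snd z + 1) \<in> K'}" by simp
    qed
    ultimately have Q_shift: "cch Q \<subseteq> {z. (fst z, snd z + 1) \<in> K'}" by (intro cch_minimal)
    have P_F: "cch P \<subseteq> {z. fst z \<in> cch F}"
    proof (rule cch_minimal)
      have "closed (fst -` cch F)" by (intro closed_vimage closed_cch continuous_intros)
      then show "closed {z. fst z \<in> cch F}" by (simp add: vimage_def)
      show "convex {z. fst z \<in> cch F}"
        using convexD[OF convex_cch[of F]] by (intro convexI) auto
      show "P \<subseteq> {z. fst z \<in> cch F}"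
        using subset_cch[of F] by (auto simp: P_def F_def)
    qed
    have main: "y \<in> nb r (cch F)" if y: "y \<in> L s" "y - x \<in> U" for y
    proof -
      obtain t where t: "s \<le> t" "(y, t) \<in> H" using y(1) by (auto simp: L_def)
      have "(y, t) \<in> cch (P \<union> Q)" using t H_PQ by blast
      from cch_Un_cases[OF K PQ_K this] show ?thesis
      proof cases
        case 1
        then have "y \<in> cch F" using P_F by auto
        then show ?thesis unfolding nb_def using r by force
      next
        case 2
        then have "(y, t + 1) \<in> K'" using Q_shift by auto
        then show ?thesis using K'_L[OF _ y(2)] t \<delta> by force
      next
        case 3
        then obtain \<tau> p q where *: "0 \<le> \<tau>" "\<tau> \<le> 1" "p \<in> cch P" "q \<in> cch Q"
          "(y, t) = (1 - \<tau>) *\<^sub>R p + \<tau> *\<^sub>R q" by (rule segment_joinE)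
        have eq: "y = (1 - \<tau>) *\<^sub>R fst p + \<tau> *\<^sub>R fst q" "t = (1 - \<tau>) * snd p + \<tau> * snd q"
          using *(5) by (auto simp: prod_eq_iff)
        \<comment> \<open>Raising only the part \<open>q\<close>, of weight \<tau>, lifts the
          average by \<tau>. The height bound over points near \<open>x\<close> then makes \<tau>
          less than \<delta>.\<close>
        have "p \<in> K'" "(fst q, snd q + 1) \<in> K'" using * P_H H_K' Q_shift by auto
        then have "(1 - \<tau>) *\<^sub>R p + \<tau> *\<^sub>R (fst q, snd q + 1) \<in> K'"
          using convexD[OF \<open>convex K'\<close>, of p "(fst q, snd q + 1)" "1 - \<tau>" \<tau>] * by simp
        moreover have "(1 - \<tau>) *\<^sub>R p + \<tau> *\<^sub>R (fst q, snd q + 1) = (y, t + \<tau>)"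
          by (simp add: prod_eq_iff eq algebra_simps)
        ultimately have "t + \<tau> < s + \<delta>" using K'_L[OF _ y(2)] by simp
        then have \<tau>: "\<tau> < \<delta>" using t by simp
        have "nm (fst p) \<le> R'" "nm (fst q) \<le> R'"
          using * P_H Q_H H(3) by (auto simp: K_def)
        then have "nm (fst q - fst p) \<le> 2 * R'"
          using nm_add[of "fst q" "- fst p"] by simp
        moreover have "y - fst p = \<tau> *\<^sub>R (fst q - fst p)" by (simp add: eq(1) algebra_simps)
        ultimately have "nm (y - fst p) \<le> \<delta> * (2 * R')"
          using \<tau> *(1) by (auto simp: nm_scaleR intro!: mult_mono)
        then have "nm (y - fst p) \<le> r" by (simp add: r_def mult_ac)
        then show ?thesis unfolding nb_def using * P_F by auto
      qed
    qed
    \<comment> \<open>Near \<open>x\<close> the set \<open>L s\<close> lies in an enlargement of a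
      hull whose derivative is empty, so by locality \<open>x\<close> cannot survive.\<close>
    define V where "V = {y. y - x \<in> interior U}"
    have V: "open V" "x \<in> V" unfolding V_def using U(3) by (auto intro: open_translation')
    have cF: "compact (cch F)" by (rule cch_subset_compact(2)[OF compact_nm_ball[OF R'(1)] convex_nm_ball F(2)])
    have "L s \<inter> V \<subseteq> nb r (cch F)"
      using main interior_subset[of U] by (auto simp: V_def)
    then have cl: "closure (L s \<inter> V) \<subseteq> nb r (cch F)"
      using cF r by (intro closure_minimal compact_imp_closed compact_nb)
    have "x \<in> sz nm \<epsilon>' \<gamma> (closure (L s \<inter> V))"
      using sz_local[OF inf L_compact V(1)] x V(2) by blast
    also have "\<dots> \<subseteq> sz nm (\<epsilon>1 + 2 * r) \<gamma> (nb r (cch F))"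
      using cl \<epsilon>1(2) by (rule sz_mono[OF inf])
    also have "\<dots> \<subseteq> nb r (sz nm \<epsilon>1 \<gamma> (cch F))"
      using \<epsilon>1 \<epsilon> r by (intro sz_nb[OF inf] cF) auto
    finally show False using F_empty by (simp add: nb_def)
  qed
  define C where "C k = L (real k * \<delta>)" for k
  \<comment> \<open>Heights in \<open>H\<close> are at most \<open>n\<close>, so the level
    \<open>m * \<delta>\<close> lies above all of them.\<close>
  obtain m where "real n / \<delta> < real m" using reals_Archimedean2 by blast
  then have m: "real n < real m * \<delta>" using \<delta> by (simp add: field_simps)
  show ?thesis
  proof (rule that[of C m])
    show "E \<subseteq> C 0"
    proof
      fix x assume x: "x \<in> E"
      then have "n \<noteq> 0" using n by (cases n) auto
      then have "(x, 0) \<in> G" using x by (force simp: G_def A_def)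
      then show "x \<in> C 0" using subset_cch[of G] by (auto simp: C_def L_def H_def)
    qed
    have False if "x \<in> C m" for x
      using that m H(3) by (auto simp: C_def L_def K_def)
    then show "C m = {}" by blast
    show "compact (C k)" "convex (C k)" for k by (simp_all add: C_def L_compact L_convex)
    show "sz nm \<epsilon>' \<gamma> (C k) \<subseteq> C (Suc k)" for k
      using step[of "real k * \<delta>"] by (simp add: C_def algebra_simps)
    fix k x assume sym: "\<And>x. x \<in> E \<Longrightarrow> - x \<in> E" and x: "x \<in> C k"
    have A_sym: "- x \<in> A j" if "x \<in> A j" for x j
      using that
    proof (induction j arbitrary: x)
      case (Suc j)
      have "A j \<subseteq> (\<lambda>x. (- 1) *\<^sub>R x) ` A j"
        using Suc.IH by (auto simp: image_iff intro!: bexI[of _ "- _"])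
      then have "sz nm \<epsilon> \<gamma> (A j) \<subseteq> sz nm (\<bar>- 1\<bar> * \<epsilon>) \<gamma> ((\<lambda>x. (- 1) *\<^sub>R x) ` A j)"
        by (intro sz_mono[OF inf]) auto
      also have "\<dots> \<subseteq> (\<lambda>x. (- 1) *\<^sub>R x) ` sz nm \<epsilon> \<gamma> (A j)" by (rule sz_scaleR[OF inf]) simp
      finally show ?case using Suc.prems unfolding A_Suc by auto
    qed (simp add: A_def sym)
    have "H \<subseteq> {z. (- fst z, snd z) \<in> H}"
      unfolding H_def
    proof (rule cch_minimal)
      have "closed ((\<lambda>z. (- fst z, snd z)) -` cch G)"
        by (intro closed_vimage closed_cch continuous_intros)
      then show "closed {z. (- fst z, snd z) \<in> cch G}" by (simp add: vimage_def)
      show "convex {z. (- fst z, snd z) \<in> cch G}"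
      proof (rule convexI)
        fix z w and a b :: real
        assume zw: "z \<in> {z. (- fst z, snd z) \<in> cch G}" "w \<in> {z. (- fst z, snd z) \<in> cch G}"
          and ab: "0 \<le> a" "0 \<le> b" "a + b = 1"
        have "a *\<^sub>R (- fst z, snd z) + b *\<^sub>R (- fst w, snd w) \<in> cch G"
          using convexD[OF convex_cch[of G] _ _ ab] zw by blast
        then show "a *\<^sub>R z + b *\<^sub>R w \<in> {z. (- fst z, snd z) \<in> cch G}" by simp
      qed
      show "G \<subseteq> {z. (- fst z, snd z) \<in> cch G}"
      proof
        fix z assume "z \<in> G"
        then have "(- fst z, snd z) \<in> G" using A_sym by (auto simp: G_def)
        then show "z \<in> {z. (- fst z, snd z) \<in> cch G}" using subset_cch by blast
      qed
    qed
    then show "- x \<in> C k" using x by (force simp: C_def L_def)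
  qed
qed

text \<open>Decreasing compact sets have empty intersection only if one of them is empty; here an
  infinite order turns into a finite number of iterates.\<close>

lemma sz_opow_suc_empty:
  fixes \<alpha> :: "'o ordinal"
  assumes "compact E" "sz nm \<epsilon> (opow oomega (osuc \<alpha>)) E = {}"
  obtains n where "(sz nm \<epsilon> (opow oomega \<alpha>) ^^ n) E = {}"
proof -
  have "(\<Inter>n\<in>UNIV. (sz nm \<epsilon> (opow oomega \<alpha>) ^^ n) E) = {}"
    using assms(2) transrec_opow_suc[where d = "szd nm \<epsilon>" and A = E and a = \<alpha>, OF inf szd_subset]
    by (simp add: sz_def[abs_def])
  moreover have "(\<Inter>n\<in>UNIV. (sz nm \<epsilon> (opow oomega \<alpha>) ^^ n) E) \<noteq> {}"
    if "\<And>n. (sz nm \<epsilon> (opow oomega \<alpha>) ^^ n) E \<noteq> {}"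
    by (rule compact_antimono_Inter_nonempty)
      (use that compact_sz_funpow[OF assms(1)] sz_funpow_antimono in auto)
  ultimately show ?thesis using that by blast
qed

lemma sz_opow_suc_subset:
  fixes \<alpha> :: "'o ordinal"
  shows "sz nm \<epsilon> (opow oomega (osuc \<alpha>)) E \<subseteq> (sz nm \<epsilon> (opow oomega \<alpha>) ^^ n) E"
  using transrec_opow_suc[where d = "szd nm \<epsilon>" and A = E and a = \<alpha>, OF inf szd_subset] by (auto simp: sz_def[abs_def])

text \<open>Since the gap between \<epsilon> and \<epsilon>' is arbitrary, every successor level can
  hand a part of its own gap to the level below. Limits cost nothing, because compactness places the
  emptiness at some smaller exponent.\<close>

theorem sz_cch:
  fixes \<alpha> :: "'o ordinal"
  assumes "0 < \<epsilon>" "\<epsilon> < \<epsilon>'" "compact E" "E \<subseteq> {x. nm x \<le> R}" "sz nm \<epsilon> (opow oomega \<alpha>) E = {}"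
  shows "sz nm \<epsilon>' (opow oomega \<alpha>) (cch E) = {}"
  using assms
proof (induction \<alpha> arbitrary: \<epsilon> \<epsilon>' E R rule: ordinal_induct[OF inf, case_names zero suc limit])
  case zero
  have "small nm \<epsilon> E"
    using zero szd_empty_iff_small[of E \<epsilon>] by (simp add: sz_def transrec_opow_zero[OF inf])
  then have "small nm \<epsilon>' (cch E)" using small_cch small_mono zero.prems(2) by (metis less_imp_le)
  then show ?case
    by (auto simp: sz_def transrec_opow_zero[OF inf] szd_def dest: spec[of _ UNIV])
next
  case (suc \<alpha>)
  obtain n where n: "(sz nm \<epsilon> (opow oomega \<alpha>) ^^ n) E = {}"
    using sz_opow_suc_empty[OF suc.prems(3,5)] by blast
  show ?case
  proof (rule convex_chain[OF _ suc.prems(1-4) n])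
    show "sz nm \<epsilon>' (opow oomega \<alpha>) (cch E) = {}"
      if "0 < \<epsilon>" "\<epsilon> < \<epsilon>'" "compact E" "E \<subseteq> {x. nm x \<le> R}" "sz nm \<epsilon> (opow oomega \<alpha>) E = {}" for \<epsilon> \<epsilon>' E R
      using suc.IH that by blast
  next
    fix C :: "nat \<Rightarrow> 'v set" and m
    assume C: "E \<subseteq> C 0" "C m = {}" "\<And>k. compact (C k)" "\<And>k. convex (C k)"
      "\<And>k. sz nm \<epsilon>' (opow oomega \<alpha>) (C k) \<subseteq> C (Suc k)"
    \<comment> \<open>The chain starts above the hull of \<open>E\<close>, and each derivation of
      order \<omega>^\<alpha> descends one link, so \<open>m\<close> of them end in the empty
      set.\<close>
    have "(sz nm \<epsilon>' (opow oomega \<alpha>) ^^ k) (cch E) \<subseteq> C k" for k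
    proof (induction k)
      case 0
      have "cch E \<subseteq> C 0" using C by (intro cch_minimal compact_imp_closed)
      then show ?case by simp
    next
      case (Suc k)
      have "sz nm \<epsilon>' (opow oomega \<alpha>) ((sz nm \<epsilon>' (opow oomega \<alpha>) ^^ k) (cch E)) \<subseteq>
          sz nm \<epsilon>' (opow oomega \<alpha>) (C k)"
        by (rule sz_mono[OF inf Suc.IH order_refl])
      then show ?case using C(5)[of k] by simp
    qed
    then show "sz nm \<epsilon>' (opow oomega (osuc \<alpha>)) (cch E) = {}"
      using sz_opow_suc_subset[of \<epsilon>' \<alpha> "cch E" m] C(2) by blast
  qed
next
  case (limit \<alpha>)
  have eq: "sz nm \<epsilon> (opow oomega \<alpha>) E = (\<Inter>\<beta>\<in>{..<\<alpha>}. sz nm \<epsilon> (opow oomega \<beta>) E)" for \<epsilon> E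
    unfolding sz_def by (rule transrec_opow_limit[OF inf szd_subset limit.hyps])
  have "\<exists>\<beta>\<in>{..<\<alpha>}. sz nm \<epsilon> (opow oomega \<beta>) E = {}"
  proof (rule ccontr)
    assume *: "\<not> ?thesis"
    have "(\<Inter>\<beta>\<in>{..<\<alpha>}. sz nm \<epsilon> (opow oomega \<beta>) E) \<noteq> {}"
    proof (rule compact_antimono_Inter_nonempty[OF olimit_lessThan_nonempty[OF limit.hyps]])
      show "sz nm \<epsilon> (opow oomega \<beta>') E \<subseteq> sz nm \<epsilon> (opow oomega \<beta>) E" if "\<beta> \<le> \<beta>'" for \<beta> \<beta>' :: "'o ordinal"
        unfolding sz_def by (rule transrec_opow_antimono[OF inf szd_subset that])
    qed (use * limit.prems sz_compact[OF inf] in auto)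
    then show False using limit.prems eq by simp
  qed
  then obtain \<beta> where \<beta>: "\<beta> < \<alpha>" "sz nm \<epsilon> (opow oomega \<beta>) E = {}" by auto
  then have "sz nm \<epsilon>' (opow oomega \<beta>) (cch E) = {}"
    using limit.IH limit.prems by blast
  then show ?case using \<beta>(1) unfolding eq by blast
qed

end

end

section \<open>The Hahn-Banach theorem\<close>

definition sublinear :: "('a::real_vector \<Rightarrow> real) \<Rightarrow> bool" where
  "sublinear p \<longleftrightarrow> (\<forall>x y. p (x + y) \<le> p x + p y) \<and> (\<forall>c>0. \<forall>x. p (c *\<^sub>R x) = c * p x)"

lemma sublinear_add: "sublinear p \<Longrightarrow> p (x + y) \<le> p x + p y"
  by (simp add: sublinear_def)

lemma sublinear_scaleR: "sublinear p \<Longrightarrow> 0 < c \<Longrightarrow> p (c *\<^sub>R x) = c * p x"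
  by (simp add: sublinear_def)

lemma sublinear_zero: "sublinear p \<Longrightarrow> p 0 = 0"
  using sublinear_scaleR[of p 2 0] by simp

lemma sublinear_minus: "sublinear p \<Longrightarrow> - p (- x) \<le> p x"
  using sublinear_add[of p x "- x"] by (simp add: sublinear_zero)

lemma sublinear_norm: "sublinear norm"
  by (simp add: sublinear_def norm_triangle_ineq)

lemma sublinearI:
  assumes add: "\<And>x y. p (x + y) \<le> p x + p y"
    and scale: "\<And>c x. 0 < c \<Longrightarrow> p (c *\<^sub>R x) \<le> c * p x"
  shows "sublinear p"
proof -
  have "c * p x \<le> p (c *\<^sub>R x)" if "0 < c" for c x
    using scale[of "inverse c" "c *\<^sub>R x"] that by (simp add: field_simps)
  then show ?thesis unfolding sublinear_def using add scale by (auto intro: antisym)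
qed

text \<open>At \<open>- y\<close> the last property reads \<open>q (- y) \<le> - p y\<close>, so
  every linear functional below \<open>q\<close> agrees with \<open>p\<close> at
  \<open>y\<close>.\<close>

lemma sublinear_reduce:
  assumes p: "sublinear p"
  obtains q where "sublinear q" "q \<le> p" "\<And>x. q x \<le> p (x + y) - p y"
proof -
  define q where "q x = (INF t\<in>{0..}. p (x + t *\<^sub>R y) - t * p y)" for x
  have scale: "p (t *\<^sub>R y) = t * p y" if "0 \<le> t" for t
    using that sublinear_scaleR[OF p] sublinear_zero[OF p] by (cases "t = 0") auto
  have bdd: "bdd_below ((\<lambda>t. p (x + t *\<^sub>R y) - t * p y) ` {0..})" for x
  proof (rule bdd_belowI2)
    fix t :: real assume "t \<in> {0..}"
    then show "- p (- x) \<le> p (x + t *\<^sub>R y) - t * p y"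
      using sublinear_add[OF p, of "x + t *\<^sub>R y" "- x"] scale[of t] by simp
  qed
  have le: "q x \<le> p (x + t *\<^sub>R y) - t * p y" if "0 \<le> t" for x t
    unfolding q_def by (rule cINF_lower[OF bdd]) (use that in simp)
  have greatest: "a \<le> q x" if "\<And>t. 0 \<le> t \<Longrightarrow> a \<le> p (x + t *\<^sub>R y) - t * p y" for a x
    unfolding q_def by (rule cINF_greatest) (use that in auto)
  have "sublinear q"
  proof (rule sublinearI)
    fix x x'
    have *: "q (x + x') \<le> (p (x + t *\<^sub>R y) - t * p y) + (p (x' + s *\<^sub>R y) - s * p y)"
      if "0 \<le> t" "0 \<le> s" for t s
      using le[of "t + s" "x + x'"] sublinear_add[OF p, of "x + t *\<^sub>R y" "x' + s *\<^sub>R y"] that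
      by (simp add: algebra_simps)
    have "q (x + x') - (p (x' + s *\<^sub>R y) - s * p y) \<le> q x" if "0 \<le> s" for s
      by (rule greatest) (use *[OF _ that] in \<open>simp add: algebra_simps\<close>)
    then have "q (x + x') - q x \<le> q x'"
      by (intro greatest) (simp add: algebra_simps)
    then show "q (x + x') \<le> q x + q x'" by simp
  next
    fix c :: real and x assume c: "0 < c"
    have "q (c *\<^sub>R x) / c \<le> p (x + t *\<^sub>R y) - t * p y" if "0 \<le> t" for t
    proof -
      have "q (c *\<^sub>R x) \<le> p (c *\<^sub>R (x + t *\<^sub>R y)) - (c * t) * p y"
        using le[of "c * t" "c *\<^sub>R x"] c that by (simp add: scaleR_add_right)
      then show ?thesis using c unfolding sublinear_scaleR[OF p c] by (simp add: field_simps)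
    qed
    then have "q (c *\<^sub>R x) / c \<le> q x" by (rule greatest)
    then show "q (c *\<^sub>R x) \<le> c * q x" using c by (simp add: field_simps)
  qed
  moreover have "q \<le> p" using le[of 0] by (auto simp: le_fun_def)
  moreover have "q x \<le> p (x + y) - p y" for x using le[of 1 x] by simp
  ultimately show ?thesis using that by blast
qed

text \<open>The pointwise infimum is finite because each member dominates \<open>- p (- x)\<close>.
  It is subadditive because two members of a chain can both be replaced by the smaller one.\<close>

lemma sublinear_Inf_chain:
  assumes C: "C \<noteq> {}" "\<And>q. q \<in> C \<Longrightarrow> sublinear q" "\<And>q. q \<in> C \<Longrightarrow> q \<le> p"
    and chain: "\<And>q r. q \<in> C \<Longrightarrow> r \<in> C \<Longrightarrow> q \<le> r \<or> r \<le> q"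
  obtains u where "sublinear u" "\<And>q. q \<in> C \<Longrightarrow> u \<le> q"
proof -
  define u where "u x = (INF q\<in>C. q x)" for x
  have bdd: "bdd_below ((\<lambda>q. q x) ` C)" for x
  proof (rule bdd_belowI2)
    show "- p (- x) \<le> q x" if "q \<in> C" for q
      using sublinear_minus[OF C(2)[OF that], of x] C(3)[OF that] by (auto simp: le_fun_def intro: order_trans[rotated])
  qed
  have le: "u x \<le> q x" if "q \<in> C" for q x
    unfolding u_def by (rule cINF_lower[OF bdd that])
  have greatest: "a \<le> u x" if "\<And>q. q \<in> C \<Longrightarrow> a \<le> q x" for a x
    unfolding u_def by (rule cINF_greatest[OF C(1)]) (use that in auto)
  have "sublinear u"
  proof (rule sublinearI)
    fix x y
    have *: "u (x + y) \<le> q x + r y" if qr: "q \<in> C" "r \<in> C" for q r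
    proof -
      obtain m where m: "m \<in> C" "m \<le> q" "m \<le> r" using chain[OF qr] qr by auto
      have "u (x + y) \<le> m x + m y"
        using le[OF m(1)] sublinear_add[OF C(2)[OF m(1)]] by (rule order_trans)
      also have "\<dots> \<le> q x + r y" using m by (intro add_mono) (auto simp: le_fun_def)
      finally show ?thesis .
    qed
    have "u (x + y) - r y \<le> u x" if "r \<in> C" for r
      by (rule greatest) (use *[OF _ that] in \<open>simp add: algebra_simps\<close>)
    then have "u (x + y) - u x \<le> u y"
      by (intro greatest) (simp add: algebra_simps)
    then show "u (x + y) \<le> u x + u y" by simp
  next
    fix c :: real and x assume c: "0 < c"
    have "u (c *\<^sub>R x) / c \<le> q x" if "q \<in> C" for q
      using le[OF that, of "c *\<^sub>R x"] c by (simp add: sublinear_scaleR[OF C(2)[OF that]] field_simps)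
    then have "u (c *\<^sub>R x) / c \<le> u x" by (rule greatest)
    then show "u (c *\<^sub>R x) \<le> c * u x" using c by (simp add: field_simps)
  qed
  moreover have "u \<le> q" if "q \<in> C" for q using le[OF that] by (simp add: le_fun_def)
  ultimately show ?thesis using that by blast
qed

text \<open>A minimal sublinear functional is linear.\<close>

lemma sublinear_dominates_linear:
  fixes p :: "'a::real_vector \<Rightarrow> real"
  assumes p: "sublinear p"
  obtains f where "linear f" "f \<le> p"
proof -
  define S where "S = {q. sublinear q \<and> q \<le> p}"
  have "\<exists>m\<in>S. \<forall>q\<in>S. m \<ge> q \<longrightarrow> q = m"
  proof (rule predicate_Zorn)
    show "partial_order_on S (relation_of (\<ge>) S)"
      by (rule partial_order_on_relation_ofI) auto
    fix C assume C: "C \<in> Chains (relation_of (\<ge>) S)"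
    show "\<exists>u\<in>S. \<forall>q\<in>C. q \<ge> u"
    proof (cases "C = {}")
      case True
      then show ?thesis using p by (auto simp: S_def)
    next
      case False
      have sub: "C \<subseteq> S" and chain: "q \<le> r \<or> r \<le> q" if "q \<in> C" "r \<in> C" for q r
        using C that unfolding Chains_def relation_of_def by blast+
      have "sublinear q" "q \<le> p" if "q \<in> C" for q
        using sub[OF that that] that by (auto simp: S_def)
      then obtain u where u: "sublinear u" "\<And>q. q \<in> C \<Longrightarrow> u \<le> q"
        using sublinear_Inf_chain[OF False, of p] chain by metis
      have "u \<le> p" using False u(2) \<open>\<And>q. q \<in> C \<Longrightarrow> q \<le> p\<close> by (meson all_not_in_conv order_trans)
      then show ?thesis using u by (auto simp: S_def)
    qed
  qed
  then obtain m where m: "sublinear m" "m \<le> p" and min: "\<And>q. sublinear q \<Longrightarrow> q \<le> m \<Longrightarrow> q = m"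
    unfolding S_def by (auto intro: order_trans)
  have add: "m (x + y) = m x + m y" for x y
  proof -
    \<comment> \<open>By minimality the reduction in direction \<open>y\<close> is \<open>m\<close>
      itself, which gives the reverse of subadditivity.\<close>
    obtain q where q: "sublinear q" "q \<le> m" "\<And>x. q x \<le> m (x + y) - m y"
      using sublinear_reduce[OF m(1), of y] by blast
    have "m x \<le> m (x + y) - m y" using q(3)[of x] min[OF q(1,2)] by simp
    then show ?thesis using sublinear_add[OF m(1), of x y] by simp
  qed
  have minus: "m (- x) = - m x" for x
    using add[of x "- x"] sublinear_zero[OF m(1)] by simp
  have "m (c *\<^sub>R x) = c * m x" for c x
  proof (cases c "0 :: real" rule: linorder_cases)
    case less
    then show ?thesis using sublinear_scaleR[OF m(1), of "- c" x] minus[of "c *\<^sub>R x"] by simp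
  qed (auto simp: sublinear_zero[OF m(1)] sublinear_scaleR[OF m(1)])
  then have "linear m" using add by (intro linearI) auto
  then show ?thesis using that m(2) by blast
qed

text \<open>Reducing the norm in the direction of \<open>x\<close> before choosing a linear minorant
  forces equality at \<open>x\<close>.\<close>

lemma norming_functional:
  fixes x :: "'a::real_normed_vector"
  obtains f :: "'a \<Rightarrow>\<^sub>L real" where "norm f \<le> 1" "blinfun_apply f x = norm x"
proof -
  obtain q where q: "sublinear q" "q \<le> norm" "\<And>z. q z \<le> norm (z + x) - norm x"
    using sublinear_reduce[OF sublinear_norm, of x] by blast
  obtain f where f: "linear f" "f \<le> q" using sublinear_dominates_linear[OF q(1)] by blast
  have le: "f z \<le> norm z" for z using f(2) q(2) by (metis le_funD order_trans)
  have bound: "norm (f z) \<le> 1 * norm z" for z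
    using le[of z] le[of "- z"] linear_neg[OF f(1), of z] by simp
  have bl: "bounded_linear f"
    using f(1) bound by (intro bounded_linear_intro[of f 1]) (simp_all add: linear_add linear_cmul)
  have "f (- x) \<le> - norm x" using f(2) q(3)[of "- x"] by (auto simp: le_fun_def intro: order_trans)
  then have "f x = norm x" using le[of x] linear_neg[OF f(1), of x] by simp
  moreover have "norm (Blinfun f) \<le> 1"
    using bound by (intro norm_blinfun_bound) (simp_all add: bounded_linear_Blinfun_apply[OF bl])
  ultimately show ?thesis using that[of "Blinfun f"] by (simp add: bounded_linear_Blinfun_apply[OF bl])
qed

section \<open>The weak* topology\<close>

text \<open>A copy of the dual space whose type class topology is the weak-star one, since the type
  of bounded linear maps already carries its norm topology.\<close>

typedef (overloaded) 'a weak_dual = "UNIV :: ('a::real_normed_vector \<Rightarrow>\<^sub>L real) set"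
  morphisms functional weak_dual by blast

lemma functional_inverse' [simp]: "functional (weak_dual f) = f"
  by (simp add: weak_dual_inverse)

declare functional_inverse [simp]

definition eval :: "'a::real_normed_vector weak_dual \<Rightarrow> 'a \<Rightarrow> real" where
  "eval \<phi> = blinfun_apply (functional \<phi>)"

lemma weak_dual_eqI: "(\<And>x. eval \<phi> x = eval \<psi> x) \<Longrightarrow> \<phi> = \<psi>"
  unfolding eval_def by (simp add: blinfun_eqI flip: functional_inject)

instantiation weak_dual :: (real_normed_vector) real_vector
begin

definition "0 = weak_dual 0"
definition "\<phi> + \<psi> = weak_dual (functional \<phi> + functional \<psi>)"
definition "\<phi> - \<psi> = weak_dual (functional \<phi> - functional \<psi>)"
definition "- \<phi> = weak_dual (- functional \<phi>)"
definition "c *\<^sub>R \<phi> = weak_dual (c *\<^sub>R functional \<phi>)"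

instance
  by standard
    (simp_all add: zero_weak_dual_def plus_weak_dual_def minus_weak_dual_def uminus_weak_dual_def
      scaleR_weak_dual_def algebra_simps)

end

lemma functional_simps [simp]:
  "functional 0 = 0" "functional (\<phi> + \<psi>) = functional \<phi> + functional \<psi>"
  "functional (\<phi> - \<psi>) = functional \<phi> - functional \<psi>" "functional (- \<phi>) = - functional \<phi>"
  "functional (c *\<^sub>R \<phi>) = c *\<^sub>R functional \<phi>"
  by (simp_all add: zero_weak_dual_def plus_weak_dual_def minus_weak_dual_def uminus_weak_dual_def
      scaleR_weak_dual_def)

lemma eval_simps [simp]:
  "eval 0 x = 0" "eval (\<phi> + \<psi>) x = eval \<phi> x + eval \<psi> x"
  "eval (\<phi> - \<psi>) x = eval \<phi> x - eval \<psi> x" "eval (- \<phi>) x = - eval \<phi> x"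
  "eval (c *\<^sub>R \<phi>) x = c * eval \<phi> x"
  by (simp_all add: eval_def blinfun.bilinear_simps)

lemma eval_linear [simp]:
  "eval \<phi> 0 = 0" "eval \<phi> (x + y) = eval \<phi> x + eval \<phi> y" "eval \<phi> (- x) = - eval \<phi> x"
  "eval \<phi> (c *\<^sub>R x) = c * eval \<phi> x" "eval \<phi> (\<Sum>i\<in>I. g i) = (\<Sum>i\<in>I. eval \<phi> (g i))"
  by (simp_all add: eval_def blinfun.bilinear_simps blinfun.sum_right)

instantiation weak_dual :: (real_normed_vector) topological_space
begin

definition "open U \<longleftrightarrow> openin weak_star (weak_dual -` U)" for U :: "'a weak_dual set"

instance
proof
  show "open (UNIV :: 'a weak_dual set)"
    using openin_topspace[of "weak_star :: ('a \<Rightarrow>\<^sub>L real) topology"]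
    by (simp add: open_weak_dual_def strong_operator_topology_topspace)
next
  fix K :: "'a weak_dual set set" assume "\<forall>S\<in>K. open S"
  then show "open (\<Union>K)"
    unfolding open_weak_dual_def vimage_Union by (intro openin_Union) auto
qed (simp add: open_weak_dual_def openin_Int)

end

lemma open_weak_dual_iff: "open U \<longleftrightarrow> (\<exists>T. open T \<and> U = eval -` T)"
proof -
  have 1: "open U \<longleftrightarrow> (\<exists>T. open T \<and> weak_dual -` U = blinfun_apply -` T)"
    unfolding open_weak_dual_def strong_operator_topology_def openin_pullback_topology by simp
  have 2: "weak_dual -` U = blinfun_apply -` T \<longleftrightarrow> U = eval -` T" for T
  proof
    assume *: "weak_dual -` U = blinfun_apply -` T"
    show "U = eval -` T"
    proof (rule set_eqI)
      fix \<phi>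
      have "functional \<phi> \<in> weak_dual -` U \<longleftrightarrow> functional \<phi> \<in> blinfun_apply -` T" by (simp only: *)
      then show "\<phi> \<in> U \<longleftrightarrow> \<phi> \<in> eval -` T" by (simp add: eval_def)
    qed
  qed (auto simp: eval_def)
  show ?thesis unfolding 1 2 ..
qed

lemma continuous_on_eval: "continuous_on S (\<lambda>\<phi>. eval \<phi> x)"
proof -
  have "continuous_on UNIV (\<lambda>\<phi>. eval \<phi> x)"
    unfolding continuous_on_open_vimage[OF open_UNIV]
  proof (intro allI impI)
    fix B :: "real set" assume "open B"
    then have "open ((\<lambda>g. g x) -` B)"
      by (intro open_vimage continuous_on_product_coordinates)
    then show "open ((\<lambda>\<phi>. eval \<phi> x) -` B \<inter> UNIV)"
      unfolding open_weak_dual_iff by (intro exI[of _ "(\<lambda>g. g x) -` B"]) auto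
  qed
  then show ?thesis by (rule continuous_on_subset) simp
qed

lemma tendsto_weak_dualI:
  assumes "\<And>x. ((\<lambda>y. eval (f y) x) \<longlongrightarrow> eval l x) F"
  shows "(f \<longlongrightarrow> l) F"
proof (rule topological_tendstoI)
  fix U assume U: "open U" "l \<in> U"
  obtain T where T: "open T" "U = eval -` T" using U(1) open_weak_dual_iff by blast
  have "limitin (product_topology (\<lambda>i. euclidean) UNIV) (\<lambda>y. eval (f y)) (eval l) F"
    unfolding limitin_componentwise using assms by simp
  then have "((\<lambda>y. eval (f y)) \<longlongrightarrow> eval l) F"
    by (simp add: euclidean_product_topology)
  then have "eventually (\<lambda>y. eval (f y) \<in> T) F"
    using T U by (auto dest: topological_tendstoD)
  then show "eventually (\<lambda>y. f y \<in> U) F" using T(2) by simp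
qed

lemma tendsto_eval: "(f \<longlongrightarrow> l) F \<Longrightarrow> ((\<lambda>y. eval (f y) x) \<longlongrightarrow> eval l x) F"
  using continuous_on_tendsto_compose[OF continuous_on_eval[of UNIV x]] by simp

lemma continuous_on_weak_dualI:
  "(\<And>x. continuous_on S (\<lambda>y. eval (f y) x)) \<Longrightarrow> continuous_on S f"
  unfolding continuous_on_def by (blast intro: tendsto_weak_dualI)

lemma weak_dual_open_nhd:
  fixes S :: "'a::real_normed_vector weak_dual set"
  assumes "open S" "\<phi> \<in> S"
  obtains F e where "finite F" "0 < e" "\<And>\<psi>. (\<And>x. x \<in> F \<Longrightarrow> \<bar>eval \<psi> x - eval \<phi> x\<bar> \<le> e) \<Longrightarrow> \<psi> \<in> S"
proof -
  obtain T where T: "open T" "S = eval -` T" using assms(1) open_weak_dual_iff by blast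
  have "openin (product_topology (\<lambda>i. euclidean) UNIV) T"
    using T(1) by (simp add: euclidean_product_topology)
  moreover have "eval \<phi> \<in> T" using assms T by simp
  ultimately obtain X where X: "eval \<phi> \<in> Pi\<^sub>E UNIV X" "\<And>i. openin euclidean (X i)"
    "finite {i. X i \<noteq> topspace euclidean}" "Pi\<^sub>E UNIV X \<subseteq> T"
    using product_topology_open_contains_basis[of "\<lambda>i. euclidean" UNIV T "eval \<phi>"] by blast
  define F where "F = {i. X i \<noteq> UNIV}"
  have F: "finite F" using X(3) by (simp add: F_def)
  have "\<exists>e>0. \<forall>t. \<bar>t - eval \<phi> i\<bar> \<le> e \<longrightarrow> t \<in> X i" for i
  proof -
    have "open (X i)" "eval \<phi> i \<in> X i" using X(1,2) by auto
    then obtain e where "0 < e" "cball (eval \<phi> i) e \<subseteq> X i" using open_contains_cball by blast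
    then show ?thesis by (intro exI[of _ e]) (auto simp: dist_real_def abs_minus_commute subset_eq)
  qed
  then obtain d where d: "\<And>i. 0 < d i" "\<And>i t. \<bar>t - eval \<phi> i\<bar> \<le> d i \<Longrightarrow> t \<in> X i" by metis
  define e where "e = Min (insert 1 (d ` F))"
  have e: "0 < e" using F d(1) by (auto simp: e_def)
  have ed: "e \<le> d i" if "i \<in> F" for i unfolding e_def using F that by (intro Min_le) auto
  have "\<psi> \<in> S" if \<psi>: "\<And>x. x \<in> F \<Longrightarrow> \<bar>eval \<psi> x - eval \<phi> x\<bar> \<le> e" for \<psi>
  proof -
    have "eval \<psi> i \<in> X i" for i
    proof (cases "i \<in> F")
      case True
      then show ?thesis using d(2) \<psi> ed by (meson order_trans)
    qed (simp add: F_def)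
    then have "eval \<psi> \<in> Pi\<^sub>E UNIV X" by auto
    then show ?thesis using X(4) T(2) by auto
  qed
  then show ?thesis using that F e by blast
qed

instance weak_dual :: (real_normed_vector) locally_convex_space
proof
  fix \<phi> \<psi> :: "'a weak_dual" and c :: real
  show "filterlim (\<lambda>p. fst p + snd p) (nhds (\<phi> + \<psi>)) (nhds \<phi> \<times>\<^sub>F nhds \<psi>)"
    by (rule tendsto_weak_dualI)
      (auto intro!: tendsto_add tendsto_eval filterlim_fst filterlim_snd)
  show "filterlim uminus (nhds (- \<phi>)) (nhds \<phi>)"
    by (rule tendsto_weak_dualI) (auto intro!: tendsto_minus tendsto_eval filterlim_ident)
  show "filterlim (\<lambda>p. fst p *\<^sub>R snd p) (nhds (c *\<^sub>R \<phi>)) (nhds c \<times>\<^sub>F nhds \<phi>)"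
    by (rule tendsto_weak_dualI)
      (auto intro!: tendsto_mult tendsto_eval filterlim_fst filterlim_snd)
next
  fix \<phi> \<psi> :: "'a weak_dual" assume "\<phi> \<noteq> \<psi>"
  then obtain x where "eval \<phi> x \<noteq> eval \<psi> x" using weak_dual_eqI by blast
  from hausdorff[OF this]
  obtain U V where UV: "open U" "open V" "eval \<phi> x \<in> U" "eval \<psi> x \<in> V" "U \<inter> V = {}"
    by auto
  have "open ((\<lambda>\<phi>. eval \<phi> x) -` U)" "open ((\<lambda>\<phi>. eval \<phi> x) -` V)"
    using UV by (auto intro!: open_vimage continuous_on_eval)
  then show "\<exists>U V. open U \<and> open V \<and> \<phi> \<in> U \<and> \<psi> \<in> V \<and> U \<inter> V = {}"
    using UV by (intro exI[of _ "(\<lambda>\<phi>. eval \<phi> x) -` U"] exI[of _ "(\<lambda>\<phi>. eval \<phi> x) -` V"]) auto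
next
  fix S :: "'a weak_dual set" assume "open S" "0 \<in> S"
  then obtain F e where F: "finite F" "0 < e" "\<And>\<psi>. (\<And>x. x \<in> F \<Longrightarrow> \<bar>eval \<psi> x - eval 0 x\<bar> \<le> e) \<Longrightarrow> \<psi> \<in> S"
    by (rule weak_dual_open_nhd) blast
  define U where "U = (\<Inter>x\<in>F. (\<lambda>\<psi>. eval \<psi> x) -` {- e..e})"
  define V where "V = (\<Inter>x\<in>F. (\<lambda>\<psi>. eval \<psi> x) -` {- e<..<e})"
  have "closed U" unfolding U_def by (intro closed_INT ballI closed_vimage continuous_on_eval closed_atLeastAtMost)
  moreover have "open V"
    unfolding V_def by (intro open_INT F(1) ballI open_vimage continuous_on_eval open_greaterThanLessThan)
  moreover have "u *\<^sub>R \<phi> + v *\<^sub>R \<psi> \<in> U"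
    if "\<phi> \<in> U" "\<psi> \<in> U" "0 \<le> u" "0 \<le> v" "u + v = 1" for \<phi> \<psi> and u v :: real
    unfolding U_def
  proof (intro INT_I vimageI2)
    fix x assume "x \<in> F"
    then have "eval \<phi> x \<in> {- e..e}" "eval \<psi> x \<in> {- e..e}" using that by (auto simp: U_def)
    then show "eval (u *\<^sub>R \<phi> + v *\<^sub>R \<psi>) x \<in> {- e..e}"
      using convexD[OF convex_real_interval(5), of "eval \<phi> x" "- e" e "eval \<psi> x" u v] that by simp
  qed
  moreover have "0 \<in> V" "V \<subseteq> U" using F(2) by (fastforce simp: U_def V_def)+
  moreover have "U \<subseteq> S" using F(3) by (force simp: U_def)
  ultimately show "\<exists>U V. closed U \<and>
      (\<forall>x\<in>U. \<forall>y\<in>U. \<forall>u\<ge>0. \<forall>v\<ge>0. u + v = (1 :: real) \<longrightarrow> u *\<^sub>R x + v *\<^sub>R y \<in> U) \<and>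
      open V \<and> 0 \<in> V \<and> V \<subseteq> U \<and> U \<subseteq> S"
    by (intro exI[of _ U] exI[of _ V]) auto
qed

text \<open>The ball is a continuous image of the linear members of a product of compact intervals;
  linearity is closed, being a family of equations between coordinates.\<close>

theorem Banach_Alaoglu: "compact {\<phi> :: 'a::real_normed_vector weak_dual. norm (functional \<phi>) \<le> 1}"
proof -
  define P where "P = Pi\<^sub>E UNIV (\<lambda>x :: 'a. {- norm x..norm x})"
  define L where "L = (\<Inter>x. \<Inter>y. {g :: 'a \<Rightarrow> real. g (x + y) = g x + g y}) \<inter>
    (\<Inter>c. \<Inter>x. {g. g (c *\<^sub>R x) = c * g x})"
  have "compactin (product_topology (\<lambda>i. euclidean) UNIV) P"
    unfolding P_def by (simp add: compactin_PiE)
  then have "compact P" by (simp add: euclidean_product_topology)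
  moreover have "closed L"
    unfolding L_def
    by (intro closed_Int closed_INT ballI closed_Collect_eq continuous_intros continuous_on_product_coordinates)
  ultimately have K: "compact (P \<inter> L)" by (rule compact_Int_closed)
  define h where "h g = weak_dual (Blinfun g)" for g :: "'a \<Rightarrow> real"
  have bound: "norm (g x) \<le> norm x * 1" if "g \<in> P" for g x
    using that by (auto simp: P_def PiE_iff abs_le_iff minus_le_iff)
  have eval_h: "eval (h g) x = g x" if "g \<in> P \<inter> L" for g x
  proof -
    have "bounded_linear g"
      by (rule bounded_linear_intro[of g 1]) (use that bound[of g] in \<open>auto simp: L_def\<close>)
    then show ?thesis by (simp add: eval_def h_def bounded_linear_Blinfun_apply)
  qed
  have "continuous_on (P \<inter> L) h"
  proof (rule continuous_on_weak_dualI)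
    fix x
    have "continuous_on (P \<inter> L) (\<lambda>g. g x)"
      by (rule continuous_on_subset[OF continuous_on_product_coordinates]) simp
    then show "continuous_on (P \<inter> L) (\<lambda>g. eval (h g) x)"
      by (rule continuous_on_eq) (simp add: eval_h)
  qed
  then have "compact (h ` (P \<inter> L))" using K by (rule compact_continuous_image)
  also have "h ` (P \<inter> L) = {\<phi>. norm (functional \<phi>) \<le> 1}"
  proof (intro equalityI subsetI)
    fix \<phi> assume "\<phi> \<in> h ` (P \<inter> L)"
    then obtain g where g: "g \<in> P \<inter> L" "\<phi> = h g" by blast
    have "norm (functional \<phi>) \<le> 1"
    proof (rule norm_blinfun_bound)
      show "norm (blinfun_apply (functional \<phi>) x) \<le> 1 * norm x" for x
        using eval_h[OF g(1), of x] bound[of g x] g by (simp add: eval_def)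
    qed simp
    then show "\<phi> \<in> {\<phi>. norm (functional \<phi>) \<le> 1}" by simp
  next
    fix \<phi> :: "'a weak_dual" assume "\<phi> \<in> {\<phi>. norm (functional \<phi>) \<le> 1}"
    then have "\<bar>eval \<phi> x\<bar> \<le> norm x" for x
      using norm_blinfun[of "functional \<phi>" x] mult_right_mono[of "norm (functional \<phi>)" 1 "norm x"]
      by (simp add: eval_def)
    then have "eval \<phi> \<in> P \<inter> L" by (auto simp: P_def L_def abs_le_iff minus_le_iff)
    moreover have "\<phi> = h (eval \<phi>)"
      by (rule weak_dual_eqI) (simp add: eval_h[OF \<open>eval \<phi> \<in> P \<inter> L\<close>])
    ultimately show "\<phi> \<in> h ` (P \<inter> L)" by blast
  qed
  finally show ?thesis .
qed

text \<open>The separating vector is read off the minimiser over \<open>K\<close> of the squared distance in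
  finitely many coordinates.\<close>

lemma weak_dual_separation:
  fixes K :: "'a::real_normed_vector weak_dual set"
  assumes K: "compact K" "convex K" "K \<noteq> {}" and \<phi>: "\<phi> \<notin> K"
  obtains x c where "\<And>\<psi>. \<psi> \<in> K \<Longrightarrow> eval \<psi> x \<le> c" "c < eval \<phi> x"
proof -
  have "open (- K)" "\<phi> \<in> - K" using compact_imp_closed[OF K(1)] \<phi> by auto
  then obtain F e where F: "finite F" "0 < e" "\<And>\<psi>. (\<And>x. x \<in> F \<Longrightarrow> \<bar>eval \<psi> x - eval \<phi> x\<bar> \<le> e) \<Longrightarrow> \<psi> \<in> - K"
    by (rule weak_dual_open_nhd) blast
  define Q where "Q \<psi> = (\<Sum>x\<in>F. (eval \<psi> x - eval \<phi> x)\<^sup>2)" for \<psi>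
  have "continuous_on K Q"
    unfolding Q_def by (intro continuous_intros continuous_on_eval)
  then obtain \<psi> where \<psi>: "\<psi> \<in> K" "\<And>\<theta>. \<theta> \<in> K \<Longrightarrow> Q \<psi> \<le> Q \<theta>"
    using continuous_attains_inf[OF K(1,3)] by blast
  have "Q \<psi> \<noteq> 0"
  proof
    assume "Q \<psi> = 0"
    then have "\<And>x. x \<in> F \<Longrightarrow> \<bar>eval \<psi> x - eval \<phi> x\<bar> \<le> e"
      using F(1,2) by (simp add: Q_def sum_nonneg_eq_0_iff)
    then show False using F(3) \<psi>(1) by blast
  qed
  moreover have "0 \<le> Q \<psi>" unfolding Q_def by (intro sum_nonneg) simp
  ultimately have Q: "0 < Q \<psi>" by simp
  \<comment> \<open>Evaluation at \<open>z\<close> is half the derivative of \<open>Q\<close> at the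
    minimiser \<psi>.\<close>
  define z where "z = (\<Sum>x\<in>F. (eval \<psi> x - eval \<phi> x) *\<^sub>R x)"
  have z: "eval \<psi> z - eval \<phi> z = Q \<psi>"
    by (simp add: z_def Q_def power2_eq_square right_diff_distrib left_diff_distrib
        flip: sum_subtractf)
  have "eval \<psi> z \<le> eval \<theta> z" if \<theta>: "\<theta> \<in> K" for \<theta>
  proof (rule ccontr)
    assume "\<not> ?thesis"
    define B where "B = eval \<psi> z - eval \<theta> z"
    then have neg: "0 < B" using \<open>\<not> eval \<psi> z \<le> eval \<theta> z\<close> by simp
    define D where "D = (\<Sum>x\<in>F. (eval \<theta> x - eval \<psi> x)\<^sup>2)"
    have D: "0 \<le> D" unfolding D_def by (intro sum_nonneg) simp
    have B_sum: "eval \<theta> z - eval \<psi> z = (\<Sum>x\<in>F. (eval \<psi> x - eval \<phi> x) * (eval \<theta> x - eval \<psi> x))"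
      by (simp add: z_def right_diff_distrib flip: sum_subtractf)
    \<comment> \<open>This is minimality of \<psi> along the segment towards \<theta>, divided by
      \<open>t\<close>.\<close>
    have "2 * B \<le> t * D" if t: "0 < t" "t \<le> 1" for t
    proof -
      have "(1 - t) *\<^sub>R \<psi> + t *\<^sub>R \<theta> \<in> K"
        using t by (intro convexD[OF K(2) \<psi>(1) \<theta>]) auto
      then have "Q \<psi> \<le> Q ((1 - t) *\<^sub>R \<psi> + t *\<^sub>R \<theta>)" by (rule \<psi>(2))
      also have "\<dots> = (\<Sum>x\<in>F. (eval \<psi> x - eval \<phi> x)\<^sup>2
          + 2 * t * ((eval \<psi> x - eval \<phi> x) * (eval \<theta> x - eval \<psi> x)) + t\<^sup>2 * (eval \<theta> x - eval \<psi> x)\<^sup>2)"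
        unfolding Q_def by (intro sum.cong refl) (simp add: power2_eq_square algebra_simps)
      also have "\<dots> = Q \<psi> + 2 * t * (eval \<theta> z - eval \<psi> z) + t\<^sup>2 * D"
        unfolding B_sum Q_def D_def by (simp add: sum.distrib sum_distrib_left)
      finally have "t * (2 * B) \<le> t * (t * D)" by (simp add: B_def power2_eq_square algebra_simps)
      then show ?thesis using t by simp
    qed
    note * = this
    \<comment> \<open>This choice makes \<open>t * D\<close> at most \<open>B\<close>, against
      \<open>2 * B \<le> t * D\<close>; the 1 in the denominator covers
      \<open>D = 0\<close>.\<close>
    define t where "t = min 1 (B / (D + 1))"
    have t: "0 < t" "t \<le> 1" using neg D by (auto simp: t_def)
    have "t * D \<le> B / (D + 1) * D" using D by (intro mult_right_mono) (auto simp: t_def)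
    also have "\<dots> \<le> B" using neg D by (simp add: field_simps)
    finally show False using *[OF t] neg by simp
  qed
  then show ?thesis using Q z by (intro that[of "- z" "- eval \<psi> z"]) auto
qed

section \<open>Renorming\<close>

definition lsc :: "('v::topological_space \<Rightarrow> real) \<Rightarrow> bool" where
  "lsc f \<longleftrightarrow> (\<forall>a. open {x. a < f x})"

lemma lsc_add:
  assumes "lsc f" "lsc g"
  shows "lsc (\<lambda>x. f x + g x)"
  unfolding lsc_def
proof
  fix a
  have "{x. a < f x + g x} = (\<Union>b. {x. b < f x} \<inter> {x. a - b < g x})"
  proof (intro equalityI subsetI)
    fix x assume "x \<in> {x. a < f x + g x}"
    \<comment> \<open>The threshold is the midpoint between \<open>a - g x\<close> and
      \<open>f x\<close>.\<close>
    then show "x \<in> (\<Union>b. {x. b < f x} \<inter> {x. a - b < g x})"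
      by (intro UN_I[of "(f x + (a - g x)) / 2"]) (auto simp: field_simps)
  qed auto
  then show "open {x. a < f x + g x}"
    using assms unfolding lsc_def by (simp only: open_UN open_Int simp_thms ball_simps)
qed

lemma lsc_sum: "finite I \<Longrightarrow> (\<And>i. i \<in> I \<Longrightarrow> lsc (f i)) \<Longrightarrow> lsc (\<lambda>x. \<Sum>i\<in>I. f i x)"
  by (induction I rule: finite_induct) (auto simp: lsc_add, simp add: lsc_def)

lemma lsc_suminf:
  assumes lsc: "\<And>i. lsc (f i)" and nonneg: "\<And>i x. 0 \<le> f i x" and summable: "\<And>x. summable (\<lambda>i. f i x)"
  shows "lsc (\<lambda>x. \<Sum>i. f i x)"
  unfolding lsc_def
proof
  fix a
  have "{x. a < (\<Sum>i. f i x)} = (\<Union>n. {x. a < (\<Sum>i<n. f i x)})"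
  proof (intro equalityI subsetI)
    fix x assume "x \<in> {x. a < (\<Sum>i. f i x)}"
    then have "eventually (\<lambda>n. a < (\<Sum>i<n. f i x)) sequentially"
      using order_tendstoD(1)[OF summable_LIMSEQ[OF summable]] by blast
    then show "x \<in> (\<Union>n. {x. a < (\<Sum>i<n. f i x)})"
      using eventually_happens'[OF sequentially_bot] by blast
  next
    fix x assume "x \<in> (\<Union>n. {x. a < (\<Sum>i<n. f i x)})"
    then obtain n where "a < (\<Sum>i<n. f i x)" by blast
    also have "\<dots> \<le> (\<Sum>i. f i x)" by (intro sum_le_suminf summable) (auto simp: nonneg)
    finally show "x \<in> {x. a < (\<Sum>i. f i x)}" by simp
  qed
  then show "open {x. a < (\<Sum>i. f i x)}"
    using lsc_sum[of "{..<_}" f] lsc by (auto simp: lsc_def)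
qed

lemma lsc_scale:
  assumes "lsc f" "0 < c"
  shows "lsc (\<lambda>x. c * f x)"
proof -
  have "{x. a < c * f x} = {x. a / c < f x}" for a
    using assms(2) by (simp add: pos_divide_less_eq mult.commute)
  then show ?thesis using assms(1) by (simp add: lsc_def)
qed

section \<open>Distances to compact convex sets\<close>

context dual_norm_space
begin

definition dst :: "'v set \<Rightarrow> 'v \<Rightarrow> real" where
  "dst S x = (INF c\<in>S. nm (x - c))"

lemma dst_le: "c \<in> S \<Longrightarrow> dst S x \<le> nm (x - c)"
  unfolding dst_def by (rule cINF_lower) (auto intro: bdd_belowI[of _ 0])

lemma dst_greatest: "S \<noteq> {} \<Longrightarrow> (\<And>c. c \<in> S \<Longrightarrow> a \<le> nm (x - c)) \<Longrightarrow> a \<le> dst S x"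
  unfolding dst_def by (rule cINF_greatest)

lemma dst_nonneg: "S \<noteq> {} \<Longrightarrow> 0 \<le> dst S x"
  by (rule dst_greatest) auto

lemma dst_less: "S \<noteq> {} \<Longrightarrow> dst S x < r \<Longrightarrow> \<exists>c\<in>S. nm (x - c) < r"
  by (meson dst_greatest not_less)

lemma dst_less_nb: "S \<noteq> {} \<Longrightarrow> dst S x < r \<Longrightarrow> x \<in> nb r S"
  using dst_less[of S x r] by (auto simp: nb_def intro: less_imp_le)

lemma nb_dst: "x \<in> nb r S \<Longrightarrow> dst S x \<le> r"
  unfolding nb_def using dst_le order_trans by blast

lemma dst_lipschitz:
  assumes "S \<noteq> {}"
  shows "dst S x \<le> dst S y + nm (x - y)"
proof -
  have "dst S x - nm (x - y) \<le> dst S y"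
  proof (rule dst_greatest[OF assms])
    fix c assume "c \<in> S"
    then show "dst S x - nm (x - y) \<le> nm (y - c)"
      using dst_le[of c S x] nm_diff_triangle[of x c y] by simp
  qed
  then show ?thesis by simp
qed

lemma dst_convex:
  assumes S: "convex S" "S \<noteq> {}" and uv: "0 \<le> u" "0 \<le> v" "u + v = 1"
  shows "dst S (u *\<^sub>R x + v *\<^sub>R y) \<le> u * dst S x + v * dst S y"
proof (rule field_le_epsilon)
  fix e :: real assume e: "0 < e"
  obtain c where c: "c \<in> S" "nm (x - c) < dst S x + e" using dst_less[OF S(2), of x "dst S x + e"] e by auto
  obtain d where d: "d \<in> S" "nm (y - d) < dst S y + e" using dst_less[OF S(2), of y "dst S y + e"] e by auto
  have "dst S (u *\<^sub>R x + v *\<^sub>R y) \<le> nm ((u *\<^sub>R x + v *\<^sub>R y) - (u *\<^sub>R c + v *\<^sub>R d))"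
    by (rule dst_le[OF convexD[OF S(1) c(1) d(1) uv]])
  also have "(u *\<^sub>R x + v *\<^sub>R y) - (u *\<^sub>R c + v *\<^sub>R d) = u *\<^sub>R (x - c) + v *\<^sub>R (y - d)"
    by (simp add: algebra_simps)
  also have "nm \<dots> \<le> u * nm (x - c) + v * nm (y - d)"
    using nm_add[of "u *\<^sub>R (x - c)" "v *\<^sub>R (y - d)"] uv by (simp add: nm_scaleR)
  also have "\<dots> \<le> u * (dst S x + e) + v * (dst S y + e)"
    using c d uv by (intro add_mono mult_left_mono) auto
  also have "\<dots> = u * dst S x + v * dst S y + (u + v) * e" by (simp add: algebra_simps)
  finally show "dst S (u *\<^sub>R x + v *\<^sub>R y) \<le> u * dst S x + v * dst S y + e" using uv by simp
qed

lemma dst_uminus: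
  assumes "S \<noteq> {}" "\<And>x. x \<in> S \<Longrightarrow> - x \<in> S"
  shows "dst S (- x) = dst S x"
proof -
  have "dst S (- x) \<le> dst S x" for x
  proof (rule dst_greatest[OF assms(1)])
    fix c assume "c \<in> S"
    then have "dst S (- x) \<le> nm (- x - - c)" using assms(2) by (intro dst_le)
    also have "- x - - c = - (x - c)" by simp
    finally show "dst S (- x) \<le> nm (x - c)" by (simp only: nm_uminus)
  qed
  from this[of x] this[of "- x"] show ?thesis by simp
qed

text \<open>Sublevel sets are intersections of compact enlargements of \<open>S\<close>. Using all
  radii above \<open>a\<close> replaces attainment of the infimum and keeps the radii positive when
  \<open>a = 0\<close>.\<close>

lemma lsc_dst:
  assumes S: "compact S" "S \<noteq> {}"
  shows "lsc (dst S)"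
  unfolding lsc_def
proof
  fix a
  show "open {x. a < dst S x}"
  proof (cases "a < 0")
    case True
    then have "{x. a < dst S x} = UNIV" using dst_nonneg[OF S(2)] by (auto intro: less_le_trans)
    then show ?thesis by simp
  next
    case False
    have "- {x. a < dst S x} = (\<Inter>e\<in>{a<..}. nb e S)"
    proof (intro equalityI subsetI)
      fix x assume "x \<in> - {x. a < dst S x}"
      then show "x \<in> (\<Inter>e\<in>{a<..}. nb e S)" using dst_less_nb[OF S(2)] by auto
    next
      fix x assume "x \<in> (\<Inter>e\<in>{a<..}. nb e S)"
      then have "dst S x \<le> e" if "a < e" for e using nb_dst that by blast
      then have "dst S x \<le> a" by (rule dense_ge)
      then show "x \<in> - {x. a < dst S x}" by simp
    qed
    moreover have "closed (\<Inter>e\<in>{a<..}. nb e S)"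
      using False by (intro closed_INT ballI compact_imp_closed compact_nb S) auto
    ultimately show ?thesis by (simp add: open_closed)
  qed
qed

end

section \<open>The weighted sum of distances and its unit ball\<close>

locale symmetric_convex_sequence = dual_norm_space nm for nm :: "'v::locally_convex_space \<Rightarrow> real" +
  fixes S :: "nat \<Rightarrow> 'v set"
  assumes S_ne: "S i \<noteq> {}" and S_compact: "compact (S i)" and S_convex: "convex (S i)"
    and S_sym: "x \<in> S i \<Longrightarrow> - x \<in> S i" and S_0: "S 0 = {0}"
begin

definition summand :: "nat \<Rightarrow> 'v \<Rightarrow> real" where
  "summand i x = (1 / 2) ^ i * dst (S i) x"

definition F :: "'v \<Rightarrow> real" where
  "F x = (\<Sum>i. summand i x)"

lemma zero_mem: "0 \<in> S i"
proof -
  obtain x where "x \<in> S i" using S_ne by blast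
  then have "(1 / 2) *\<^sub>R x + (1 / 2) *\<^sub>R (- x) \<in> S i"
    by (intro convexD[OF S_convex] S_sym) auto
  then show ?thesis by simp
qed

lemma summand_nonneg: "0 \<le> summand i x"
  unfolding summand_def by (intro mult_nonneg_nonneg dst_nonneg S_ne) simp

lemma summand_le: "summand i x \<le> (1 / 2) ^ i * nm x"
  unfolding summand_def using dst_le[OF zero_mem, of i x] by (intro mult_left_mono) auto

lemma sums_nm: "(\<lambda>i. (1 / 2) ^ i * nm x) sums (2 * nm x)"
  using sums_mult2[OF geometric_sums[of "1 / 2 :: real"], of "nm x"] by simp

lemma summable_summand: "summable (\<lambda>i. summand i x)"
  by (rule summable_comparison_test'[OF sums_summable[OF sums_nm[of x]], of 0])
    (use summand_nonneg summand_le in auto)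

lemma F_le: "F x \<le> 2 * nm x"
  unfolding F_def sums_unique[OF sums_nm]
  by (intro suminf_le summand_le summable_summand sums_summable[OF sums_nm])

text \<open>The term for \<open>S 0 = {0}\<close> is the norm itself; it is in the sequence for this
  bound.\<close>

lemma F_ge: "nm x \<le> F x"
proof -
  have "summand 0 x \<le> F x"
    unfolding F_def using sum_le_suminf[OF summable_summand, of "{0}" x] summand_nonneg by simp
  moreover have "nm x \<le> dst (S 0) x" by (rule dst_greatest) (auto simp: S_0)
  ultimately show ?thesis by (simp add: summand_def)
qed

lemma F_convex:
  assumes "0 \<le> u" "0 \<le> v" "u + v = 1"
  shows "F (u *\<^sub>R x + v *\<^sub>R y) \<le> u * F x + v * F y"
proof -
  have "F (u *\<^sub>R x + v *\<^sub>R y) \<le> (\<Sum>i. u * summand i x + v * summand i y)"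
    unfolding F_def
  proof (intro suminf_le summable_summand summable_add summable_mult)
    fix i
    show "summand i (u *\<^sub>R x + v *\<^sub>R y) \<le> u * summand i x + v * summand i y"
      using mult_left_mono[OF dst_convex[OF S_convex S_ne assms, of i x y], of "(1 / 2) ^ i"]
      by (simp add: summand_def algebra_simps)
  qed
  also have "\<dots> = u * F x + v * F y"
    unfolding F_def by (simp add: suminf_add[symmetric] suminf_mult summable_mult summable_summand)
  finally show ?thesis .
qed

lemma F_uminus: "F (- x) = F x"
  unfolding F_def summand_def using dst_uminus[OF S_ne S_sym] by simp

lemma F_lipschitz: "F x \<le> F y + 2 * nm (x - y)"
proof -
  have "F x \<le> (\<Sum>i. summand i y + (1 / 2) ^ i * nm (x - y))"
    unfolding F_def
  proof (intro suminf_le summable_summand summable_add sums_summable[OF sums_nm])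
    fix i
    show "summand i x \<le> summand i y + (1 / 2) ^ i * nm (x - y)"
      using mult_left_mono[OF dst_lipschitz[OF S_ne, of i x y], of "(1 / 2) ^ i"]
      by (simp add: summand_def algebra_simps)
  qed
  also have "\<dots> = F y + 2 * nm (x - y)"
    unfolding F_def
    by (simp add: suminf_add[symmetric] summable_summand sums_summable[OF sums_nm] sums_unique[OF sums_nm, symmetric])
  finally show ?thesis .
qed

lemma lsc_summand: "lsc (summand i)"
  unfolding summand_def[abs_def] by (intro lsc_scale lsc_dst S_compact S_ne) simp

lemma lsc_F: "lsc F"
  unfolding F_def[abs_def] by (intro lsc_suminf lsc_summand summand_nonneg summable_summand)

text \<open>The series without its term \<open>k\<close> is again lower semicontinuous; a lower
  bound for it bounds the term \<open>k\<close> from above on the ball near a given point.\<close>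

definition rest :: "nat \<Rightarrow> 'v \<Rightarrow> real" where
  "rest k x = (\<Sum>i. if i = k then 0 else summand i x)"

lemma lsc_rest: "lsc (rest k)"
  unfolding rest_def[abs_def]
proof (rule lsc_suminf)
  show "lsc (\<lambda>x. if i = k then 0 else summand i x)" for i
    using lsc_summand by (cases "i = k") (simp_all add: lsc_def)
  show "summable (\<lambda>i. if i = k then 0 else summand i x)" for x
    by (rule summable_comparison_test'[OF summable_summand[of x], of 0]) (simp add: summand_nonneg)
qed (simp add: summand_nonneg)

lemma F_split: "F x = summand k x + rest k x"
proof -
  have s: "summable (\<lambda>i. if i = k then 0 else summand i x)"
    by (rule summable_comparison_test'[OF summable_summand[of x], of 0]) (simp add: summand_nonneg)
  have "(\<lambda>i. if i = k then summand i x else 0) sums summand k x"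
    by (rule sums_single)
  from sums_add[OF this summable_sums[OF s]]
  have "(\<lambda>i. (if i = k then summand i x else 0) + (if i = k then 0 else summand i x)) sums
      (summand k x + rest k x)"
    by (simp only: rest_def)
  moreover have "(\<lambda>i. (if i = k then summand i x else 0) + (if i = k then 0 else summand i x)) =
      (\<lambda>i. summand i x)" by auto
  ultimately show ?thesis unfolding F_def using sums_unique by fastforce
qed

lemma compact_F_ball: "compact {x. F x \<le> 1}"
proof -
  have "- {x. F x \<le> 1} = {x. 1 < F x}" by auto
  then have "closed {x. F x \<le> 1}" using lsc_F by (simp add: closed_def lsc_def)
  from closed_Int_compact[OF this compact_unit_ball]
  have "compact ({x. F x \<le> 1} \<inter> {x. nm x \<le> 1})" .
  moreover have "{x. F x \<le> 1} \<inter> {x. nm x \<le> 1} = {x. F x \<le> 1}" using order_trans[OF F_ge] by auto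
  ultimately show ?thesis by simp
qed

lemma convex_F_ball: "convex {x. F x \<le> 1}"
proof (rule convexI)
  fix x y and u v :: real
  assume *: "x \<in> {x. F x \<le> 1}" "y \<in> {x. F x \<le> 1}" "0 \<le> u" "0 \<le> v" "u + v = 1"
  have "F (u *\<^sub>R x + v *\<^sub>R y) \<le> u * F x + v * F y" using F_convex * by blast
  also have "\<dots> \<le> u * 1 + v * 1" using * by (intro add_mono mult_left_mono) auto
  finally show "u *\<^sub>R x + v *\<^sub>R y \<in> {x. F x \<le> 1}" using * by simp
qed

text \<open>\<open>F\<close> is in general not homogeneous, so a bound on it is turned into a
  dilation by the Lipschitz estimate: multiplying \<open>x\<close> by
  \<open>1 / (1 - \<delta> / 4)\<close> moves it by at most \<open>\<delta> / 2\<close>, which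
  raises \<open>F\<close> by at most \<delta>.\<close>

lemma F_ball_shrink:
  assumes "F x \<le> 1 - \<delta>" "0 < \<delta>" "\<delta> < 1"
  shows "x \<in> (\<lambda>x. (1 - \<delta> / 4) *\<^sub>R x) ` {x. F x \<le> 1}"
proof -
  define t where "t = 1 / (1 - \<delta> / 4)"
  have t: "1 \<le> t" "t - 1 \<le> \<delta> / 2" "(1 - \<delta> / 4) * t = 1"
  proof -
    have "\<delta> * \<delta> \<le> 1 * \<delta>" using assms(2,3) by (intro mult_right_mono) auto
    then show "1 \<le> t" "t - 1 \<le> \<delta> / 2" "(1 - \<delta> / 4) * t = 1"
      using assms(2,3) by (auto simp: t_def field_simps)
  qed
  have nm1: "nm x \<le> 1" using F_ge[of x] assms by simp
  have "t *\<^sub>R x - x = (t - 1) *\<^sub>R x" by (simp add: algebra_simps)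
  then have "nm (t *\<^sub>R x - x) = (t - 1) * nm x" using t by (simp add: nm_scaleR)
  also have "\<dots> \<le> \<delta> / 2 * 1" using t nm1 by (intro mult_mono) auto
  finally have "F (t *\<^sub>R x) \<le> 1" using F_lipschitz[of "t *\<^sub>R x" x] assms(1) by simp
  then show ?thesis using t(3) by (intro image_eqI[of _ _ "t *\<^sub>R x"]) auto
qed

text \<open>If \<open>F x\<close> is nearly \<open>1\<close>, lower semicontinuity forces each summand to be nearly maximal at
  \<open>x\<close> among the points of the ball near \<open>x\<close>. So if \<open>x\<close> is close to \<open>C j\<close>, then all these points
  are, and \<open>x\<close> is close to \<open>C (Suc j)\<close>.\<close>

lemma sz_F_ball:
  fixes \<gamma> :: "'o ordinal"
  assumes inf: "infinite (UNIV :: 'o set)" and \<epsilon>: "0 < \<epsilon>"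
    and C: "{x. F x \<le> 1} \<subseteq> C 0" "C m = {}" "\<And>k. compact (C k)"
      "\<And>k. sz nm \<epsilon> \<gamma> (C k) \<subseteq> C (Suc k)"
    and C_S: "\<And>k. C k \<noteq> {} \<Longrightarrow> C k \<in> range S"
  obtains \<delta> where "0 < \<delta>" "\<delta> < 1" "\<And>x. x \<in> sz nm (2 * \<epsilon>) \<gamma> {x. F x \<le> 1} \<Longrightarrow> F x \<le> 1 - \<delta>"
proof -
  define K where "K = {x. F x \<le> 1}"
  have "\<exists>i. C k \<noteq> {} \<longrightarrow> S i = C k" for k using C_S[of k] by fastforce
  then obtain idx where idx: "\<And>k. C k \<noteq> {} \<Longrightarrow> S (idx k) = C k" by metis
  \<comment> \<open>\<open>n0\<close> bounds the positions \<open>idx k\<close> in the enumeration,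
    so \<open>w\<close> bounds the corresponding weights from below.\<close>
  define n0 where "n0 = Max (insert 0 (idx ` {..<m}))"
  have n0: "idx k \<le> n0" if "k < m" for k unfolding n0_def using that by (intro Max_ge) auto
  define w where "w = (1 / 2 :: real) ^ n0"
  have w: "0 < w" by (simp add: w_def)
  have wk: "w \<le> (1 / 2) ^ idx k" if "k < m" for k
    unfolding w_def using n0[OF that] by (intro power_decreasing) auto
  \<comment> \<open>The distance bound worsens by \<eta> per link; after at most \<open>m\<close>
    links the radius of the enlargement is still at most \<open>\<epsilon> / 2\<close>.\<close>
  define \<eta> where "\<eta> = \<epsilon> / (2 * (real m + 1))"
  have \<eta>: "0 < \<eta>" using \<epsilon> by (simp add: \<eta>_def)
  \<comment> \<open>One \<delta> is lost because \<open>F x\<close> may lie below 1, another in the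
    neighbourhood \<open>V\<close>; together, divided by a weight, they cost at most \<eta>.\<close>
  define \<delta> where "\<delta> = min (1 / 2) (w * \<eta> / 2)"
  have \<delta>: "0 < \<delta>" "\<delta> < 1" "2 * \<delta> \<le> w * \<eta>" using w \<eta> by (auto simp: \<delta>_def)
  have "F x \<le> 1 - \<delta>" if x: "x \<in> sz nm (2 * \<epsilon>) \<gamma> K" for x
  proof (rule ccontr)
    assume not: "\<not> F x \<le> 1 - \<delta>"
    define V where "V = (\<Inter>k\<in>{..<m}. {y. rest (idx k) x - \<delta> < rest (idx k) y})"
    have V: "open V" "x \<in> V"
      unfolding V_def using lsc_rest \<delta> by (auto simp: lsc_def)
    have near: "dst (C k) y < dst (C k) x + \<eta>" if y: "y \<in> K \<inter> V" and k: "k < m" "C k \<noteq> {}" for y k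
    proof -
      let ?w = "(1 / 2 :: real) ^ idx k"
      have "rest (idx k) x - \<delta> < rest (idx k) y" using y k by (auto simp: V_def)
      then have "summand (idx k) y < summand (idx k) x + 2 * \<delta>"
        using y not F_split[of x "idx k"] F_split[of y "idx k"] by (simp add: K_def)
      also have "2 * \<delta> \<le> ?w * \<eta>"
        using \<delta>(3) mult_right_mono[OF wk[OF k(1)] less_imp_le[OF \<eta>]] by (rule order_trans)
      finally have "?w * dst (C k) y < ?w * (dst (C k) x + \<eta>)"
        by (simp add: summand_def idx[OF k(2)] distrib_left)
      then show ?thesis by simp
    qed
    \<comment> \<open>Nonemptiness is propagated together with the distance; at \<open>j = m\<close>
      it contradicts \<open>C m = {}\<close>.\<close>
    have "C j \<noteq> {} \<and> dst (C j) x \<le> real j * \<eta>" if "j \<le> m" for j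
      using that
    proof (induction j)
      case 0
      have "x \<in> C 0" using x sz_subset[OF inf] C(1) unfolding K_def by blast
      then show ?case using dst_le[of x "C 0" x] by auto
    next
      case (Suc j)
      then have j: "j < m" "C j \<noteq> {}" "dst (C j) x \<le> real j * \<eta>" by auto
      define r where "r = real (Suc j) * \<eta>"
      have r: "0 < r" using \<eta> by (simp add: r_def)
      have "real (Suc j) * \<epsilon> \<le> (real m + 1) * \<epsilon>" using Suc.prems \<epsilon> by (intro mult_right_mono) auto
      then have r\<epsilon>: "2 * r \<le> \<epsilon>" by (simp add: r_def \<eta>_def field_simps)
      have "K \<inter> V \<subseteq> nb r (C j)"
      proof
        fix y assume "y \<in> K \<inter> V"
        from near[OF this j(1,2)] j(3) show "y \<in> nb r (C j)"
          by (intro dst_less_nb j) (simp add: r_def algebra_simps)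
      qed
      then have cl: "closure (K \<inter> V) \<subseteq> nb r (C j)"
        by (intro closure_minimal compact_imp_closed compact_nb C r)
      have "compact K" unfolding K_def by (rule compact_F_ball)
      then have "x \<in> sz nm (2 * \<epsilon>) \<gamma> (closure (K \<inter> V))"
        using sz_local[OF inf _ V(1)] x V(2) by blast
      also have "\<dots> \<subseteq> sz nm (\<epsilon> + 2 * r) \<gamma> (nb r (C j))"
        using cl r\<epsilon> by (intro sz_mono[OF inf]) auto
      also have "\<dots> \<subseteq> nb r (sz nm \<epsilon> \<gamma> (C j))" by (rule sz_nb[OF inf C(3) \<epsilon> r])
      also have "\<dots> \<subseteq> nb r (C (Suc j))" by (rule nb_mono[OF order_refl C(4)])
      finally have "x \<in> nb r (C (Suc j))" .
      then show ?case using nb_dst[of x r] by (auto simp: nb_def r_def)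
    qed
    then show False using C(2) by blast
  qed
  then show ?thesis using that \<delta> by (simp add: K_def)
qed

end

section \<open>Empty derivatives and shrinking balls\<close>

context dual_norm_space
begin

context
  assumes inf: "infinite (UNIV :: 'o set)"
begin

text \<open>A ball of \<open>nm\<close> with radius \<open>e / 2\<close> lies in the ball of
  \<open>nm'\<close> with radius \<open>b * e / 2\<close>, so small sets remain small and at least
  as many points are removed.\<close>

lemma sz_compare:
  fixes \<gamma> :: "'o ordinal"
  assumes "\<And>x. nm' x \<le> b * nm x" "0 < b"
  shows "sz nm' (b * \<epsilon>) \<gamma> A \<subseteq> sz nm \<epsilon> \<gamma> A"
  unfolding sz_def
proof (rule transrec_Inter_mono[OF inf subset_refl])
  fix X Y :: "'v set" assume "X \<subseteq> Y"
  have "small nm' (b * \<epsilon>) (X \<inter> V)" if small: "small nm \<epsilon> (Y \<inter> V)" for V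
  proof -
    obtain e C where *: "0 < e" "e < \<epsilon>" "finite C" "Y \<inter> V \<subseteq> (\<Union>c\<in>C. {x. nm (x - c) \<le> e / 2})"
      using small unfolding small_def by blast
    have "nm' (x - c) \<le> b * e / 2" if "nm (x - c) \<le> e / 2" for x c
      using order_trans[OF assms(1) mult_left_mono[OF that]] assms(2) by simp
    then have "X \<inter> V \<subseteq> (\<Union>c\<in>C. {x. nm' (x - c) \<le> b * e / 2})"
      using *(4) \<open>X \<subseteq> Y\<close> by blast
    then show ?thesis
      unfolding small_def using * assms(2) by (intro exI[of _ "b * e"] exI[of _ C]) auto
  qed
  then show "szd nm' (b * \<epsilon>) X \<subseteq> szd nm \<epsilon> Y"
    using \<open>X \<subseteq> Y\<close> by (auto simp: szd_def)
qed

text \<open>The chains for all scales \<open>1 / Suc n\<close> enter one sum, so that a single ball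
  handles every \<epsilon>; the factor 2 lost in the scale is paid by choosing \<open>n\<close>
  large.\<close>

lemma renorming:
  fixes \<alpha> :: "'o ordinal"
  assumes empty: "\<And>\<epsilon>. 0 < \<epsilon> \<Longrightarrow> sz nm \<epsilon> (opow oomega (osuc \<alpha>)) {x. nm x \<le> 1} = {}"
  obtains K where "compact K" "convex K" "\<And>x. x \<in> K \<Longrightarrow> - x \<in> K"
    "{x. nm x \<le> 1 / 2} \<subseteq> K" "K \<subseteq> {x. nm x \<le> 1}"
    "\<And>\<epsilon>. 0 < \<epsilon> \<Longrightarrow> \<exists>\<delta>>0. \<delta> < 1 \<and> sz nm \<epsilon> (opow oomega \<alpha>) K \<subseteq> (\<lambda>x. (1 - \<delta>) *\<^sub>R x) ` K"
proof -
  let ?B = "{x. nm x \<le> 1}" and ?\<epsilon> = "\<lambda>n. 1 / real (Suc n)"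
  have "\<exists>C m. ?B \<subseteq> C 0 \<and> C m = {} \<and> (\<forall>k. compact (C k) \<and> convex (C k) \<and>
      sz nm (?\<epsilon> n) (opow oomega \<alpha>) (C k) \<subseteq> C (Suc k) \<and> (\<forall>x\<in>C k. - x \<in> C k))" for n
  proof -
    have \<epsilon>: "0 < ?\<epsilon> n / 2" "?\<epsilon> n / 2 < ?\<epsilon> n" by (auto simp: field_simps)
    obtain j where j: "(sz nm (?\<epsilon> n / 2) (opow oomega \<alpha>) ^^ j) ?B = {}"
      using sz_opow_suc_empty[OF inf compact_unit_ball empty[OF \<epsilon>(1)]] by blast
    show ?thesis
    proof (rule convex_chain[OF inf sz_cch[OF inf] \<epsilon> compact_unit_ball order_refl j])
      fix C :: "nat \<Rightarrow> 'v set" and m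
      assume C: "?B \<subseteq> C 0" "C m = {}" "\<And>k. compact (C k)" "\<And>k. convex (C k)"
        "\<And>k. sz nm (?\<epsilon> n) (opow oomega \<alpha>) (C k) \<subseteq> C (Suc k)"
        and sym: "\<And>k x. (\<And>x. x \<in> ?B \<Longrightarrow> - x \<in> ?B) \<Longrightarrow> x \<in> C k \<Longrightarrow> - x \<in> C k"
      have "\<And>k x. x \<in> C k \<Longrightarrow> - x \<in> C k" by (rule sym) auto
      then show ?thesis using C by (intro exI[of _ C] exI[of _ m]) blast
    qed
  qed
  then obtain C m where C: "\<And>n. ?B \<subseteq> C n 0" "\<And>n. C n (m n) = {}" "\<And>n k. compact (C n k)"
    "\<And>n k. convex (C n k)" "\<And>n k. sz nm (?\<epsilon> n) (opow oomega \<alpha>) (C n k) \<subseteq> C n (Suc k)"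
    "\<And>n k x. x \<in> C n k \<Longrightarrow> - x \<in> C n k" by metis
  \<comment> \<open>Position 0 is reserved for \<open>{0}\<close>. Empty links are replaced by
    \<open>{0}\<close> too, since a distance to the empty set has no meaning.\<close>
  define S where "S i = (case i of 0 \<Rightarrow> {0} | Suc j \<Rightarrow>
    (case prod_decode j of (n, k) \<Rightarrow> if C n k = {} then {0} else C n k))" for i
  interpret symmetric_convex_sequence nm S
    by unfold_locales (auto simp: S_def C split: nat.splits prod.splits if_splits)
  have C_S: "C n k \<in> range S" if "C n k \<noteq> {}" for n k
  proof -
    have "S (Suc (prod_encode (n, k))) = C n k" using that by (simp add: S_def)
    then show ?thesis by (metis rangeI)
  qed
  let ?K = "{x. F x \<le> 1}"
  have K_B: "?K \<subseteq> ?B" using order_trans[OF F_ge] by auto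
  show ?thesis
  proof (rule that[OF compact_F_ball convex_F_ball _ _ K_B])
    show "- x \<in> ?K" if "x \<in> ?K" for x using that by (simp add: F_uminus)
    show "{x. nm x \<le> 1 / 2} \<subseteq> ?K" using order_trans[OF F_le] by auto
    fix \<epsilon> :: real assume \<epsilon>: "0 < \<epsilon>"
    obtain n where "2 / \<epsilon> < real n" using reals_Archimedean2 by blast
    then have n: "2 * ?\<epsilon> n \<le> \<epsilon>" using \<epsilon> by (simp add: field_simps)
    have pos: "0 < ?\<epsilon> n" by simp
    have "?K \<subseteq> C n 0" using K_B C(1) by blast
    then obtain \<delta> where \<delta>: "0 < \<delta>" "\<delta> < 1"
      "\<And>x. x \<in> sz nm (2 * ?\<epsilon> n) (opow oomega \<alpha>) ?K \<Longrightarrow> F x \<le> 1 - \<delta>"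
      using sz_F_ball[OF inf pos _ C(2,3,5) C_S] by metis
    have "sz nm \<epsilon> (opow oomega \<alpha>) ?K \<subseteq> (\<lambda>x. (1 - \<delta> / 4) *\<^sub>R x) ` ?K"
    proof
      fix x assume "x \<in> sz nm \<epsilon> (opow oomega \<alpha>) ?K"
      then have "x \<in> sz nm (2 * ?\<epsilon> n) (opow oomega \<alpha>) ?K"
        using sz_mono[OF inf order_refl n, of nm "opow oomega \<alpha>" ?K] by blast
      then show "x \<in> (\<lambda>x. (1 - \<delta> / 4) *\<^sub>R x) ` ?K" using F_ball_shrink \<delta> by blast
    qed
    then show "\<exists>\<delta>>0. \<delta> < 1 \<and> sz nm \<epsilon> (opow oomega \<alpha>) ?K \<subseteq> (\<lambda>x. (1 - \<delta>) *\<^sub>R x) ` ?K"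
      using \<delta> by (intro exI[of _ "\<delta> / 4"]) auto
  qed
qed

text \<open>For \<open>t \<le> 1\<close>, deriving the \<open>t\<close>-fold ball at \<epsilon>
  amounts to deriving the ball at \<open>\<epsilon> / t \<ge> \<epsilon>\<close>, so the same factor
  \<open>1 - \<delta>\<close> is gained at every radius. Once the radius is below
  \<open>\<epsilon> / 4\<close> the set is small, and one more application empties it, as it is
  contained in a single derivation.\<close>

lemma sz_ball_empty:
  fixes \<alpha> :: "'o ordinal"
  assumes ukk: "\<exists>\<delta>>0. \<delta> < 1 \<and>
      sz nm \<epsilon> (opow oomega \<alpha>) {x. nm x \<le> 1} \<subseteq> (\<lambda>x. (1 - \<delta>) *\<^sub>R x) ` {x. nm x \<le> 1}"
    and \<epsilon>: "0 < \<epsilon>"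
  shows "sz nm \<epsilon> (opow oomega (osuc \<alpha>)) {x. nm x \<le> 1} = {}"
proof -
  let ?K = "{x. nm x \<le> 1}" and ?D = "sz nm \<epsilon> (opow oomega \<alpha>)"
  obtain \<delta> where \<delta>: "0 < \<delta>" "\<delta> < 1" "?D ?K \<subseteq> (\<lambda>x. (1 - \<delta>) *\<^sub>R x) ` ?K" using ukk by blast
  have step: "?D ((\<lambda>x. t *\<^sub>R x) ` ?K) \<subseteq> (\<lambda>x. (t * (1 - \<delta>)) *\<^sub>R x) ` ?K" if t: "0 < t" "t \<le> 1" for t
  proof -
    have "?D ((\<lambda>x. t *\<^sub>R x) ` ?K) = sz nm (\<bar>t\<bar> * (\<epsilon> / t)) (opow oomega \<alpha>) ((\<lambda>x. t *\<^sub>R x) ` ?K)"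
      using t by simp
    also have "\<dots> \<subseteq> (\<lambda>x. t *\<^sub>R x) ` sz nm (\<epsilon> / t) (opow oomega \<alpha>) ?K"
      by (rule sz_scaleR[OF inf]) (use t in simp)
    also have "\<dots> \<subseteq> (\<lambda>x. t *\<^sub>R x) ` ?D ?K"
      using t \<epsilon> by (intro image_mono sz_mono[OF inf order_refl]) (simp add: field_simps)
    also have "\<dots> \<subseteq> (\<lambda>x. t *\<^sub>R x) ` (\<lambda>x. (1 - \<delta>) *\<^sub>R x) ` ?K" by (rule image_mono[OF \<delta>(3)])
    also have "\<dots> = (\<lambda>x. (t * (1 - \<delta>)) *\<^sub>R x) ` ?K" by (simp add: image_image)
    finally show ?thesis .
  qed
  have pow: "(?D ^^ n) ?K \<subseteq> (\<lambda>x. (1 - \<delta>) ^ n *\<^sub>R x) ` ?K" for n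
  proof (induction n)
    case (Suc n)
    have "?D ((?D ^^ n) ?K) \<subseteq> ?D ((\<lambda>x. (1 - \<delta>) ^ n *\<^sub>R x) ` ?K)"
      by (rule sz_mono[OF inf Suc.IH order_refl])
    also have "\<dots> \<subseteq> (\<lambda>x. ((1 - \<delta>) ^ n * (1 - \<delta>)) *\<^sub>R x) ` ?K"
      using \<delta> by (intro step power_le_one) auto
    finally show ?case by (simp add: mult.commute)
  qed simp
  obtain n where n: "(1 - \<delta>) ^ n < \<epsilon> / 4"
    using real_arch_pow_inv[of "\<epsilon> / 4" "1 - \<delta>"] \<epsilon> \<delta> by auto
  have "(?D ^^ n) ?K \<subseteq> {x. nm (x - 0) \<le> (\<epsilon> / 2) / 2}"
  proof
    fix x assume "x \<in> (?D ^^ n) ?K"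
    then obtain y where "nm y \<le> 1" "x = (1 - \<delta>) ^ n *\<^sub>R y" using pow by blast
    then have "nm x \<le> (1 - \<delta>) ^ n * 1" using \<delta> by (auto simp: nm_scaleR intro!: mult_left_mono)
    then show "x \<in> {x. nm (x - 0) \<le> (\<epsilon> / 2) / 2}" using n by simp
  qed
  then have "small nm \<epsilon> ((?D ^^ n) ?K)"
    unfolding small_def using \<epsilon> by (intro exI[of _ "\<epsilon> / 2"] exI[of _ "{0}"]) auto
  then have "szd nm \<epsilon> ((?D ^^ n) ?K) = {}"
    using szd_empty_iff_small[OF compact_sz_funpow[OF inf compact_unit_ball] \<epsilon>] by blast
  moreover have "?D ((?D ^^ n) ?K) \<subseteq> szd nm \<epsilon> ((?D ^^ n) ?K)"
    using transrec_opow_antimono[where d = "szd nm \<epsilon>" and A = "(?D ^^ n) ?K", OF inf szd_subset ozero_le[of \<alpha>]]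
    by (simp add: sz_def transrec_opow_zero[OF inf])
  ultimately have "(?D ^^ Suc n) ?K = {}" by simp
  then show ?thesis using sz_opow_suc_subset[OF inf, of \<epsilon> \<alpha> ?K "Suc n"] by blast
qed

end

end

section \<open>Equivalent norms and their duals\<close>

lemma dual_norm_space_norm:
  "dual_norm_space (\<lambda>\<phi> :: 'a::real_normed_vector weak_dual. norm (functional \<phi>))"
  by unfold_locales (simp_all add: norm_triangle_ineq Banach_Alaoglu)

context
  fixes N :: "'a::real_normed_vector \<Rightarrow> real" and a b :: real
  assumes N0: "N 0 = 0" and N_scaleR: "\<And>c x. N (c *\<^sub>R x) = \<bar>c\<bar> * N x"
    and ab: "0 < a" "0 < b" and N_bounds: "\<And>x. a * norm x \<le> N x" "\<And>x. N x \<le> b * norm x"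
begin

lemma blinfun_le_on_ball: "N x \<le> 1 \<Longrightarrow> \<bar>blinfun_apply f x\<bar> \<le> norm f / a"
proof -
  assume "N x \<le> 1"
  then have "norm x \<le> 1 / a" using N_bounds(1)[of x] ab by (simp add: field_simps)
  then show ?thesis
    using norm_blinfun[of f x] mult_left_mono[of "norm x" "1 / a" "norm f"] by simp
qed

lemma dual_norm_upper: "N x \<le> 1 \<Longrightarrow> \<bar>blinfun_apply f x\<bar> \<le> dual_norm N f"
  unfolding dual_norm_def
  by (rule cSUP_upper) (auto intro!: bdd_aboveI[of _ "norm f / a"] blinfun_le_on_ball)

lemma dual_norm_least:
  assumes "\<And>x. N x \<le> 1 \<Longrightarrow> \<bar>blinfun_apply f x\<bar> \<le> c"
  shows "dual_norm N f \<le> c"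
  unfolding dual_norm_def by (rule cSUP_least) (use assms N0 in \<open>auto intro: exI[of _ 0]\<close>)

lemma dual_norm_nonneg: "0 \<le> dual_norm N f"
  using dual_norm_upper[of 0 f] N0 by (simp add: blinfun.zero_right)

lemma dual_norm_le_norm: "dual_norm N f \<le> norm f / a"
  by (rule dual_norm_least) (rule blinfun_le_on_ball)

lemma norm_le_dual_norm: "norm f \<le> b * dual_norm N f"
proof (rule norm_blinfun_bound)
  show "0 \<le> b * dual_norm N f" using ab dual_norm_nonneg[of f] by simp
  show "norm (blinfun_apply f x) \<le> b * dual_norm N f * norm x" for x
  proof (cases "x = 0")
    case False
    define c where "c = 1 / (b * norm x)"
    have c: "0 < c" using False ab by (simp add: c_def)
    have "N (c *\<^sub>R x) \<le> c * (b * norm x)"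
      unfolding N_scaleR using c N_bounds(2)[of x] by (simp add: mult_left_mono)
    then have "N (c *\<^sub>R x) \<le> 1" using False ab by (simp add: c_def)
    from dual_norm_upper[OF this, of f] have "c * \<bar>blinfun_apply f x\<bar> \<le> dual_norm N f"
      using c by (simp add: blinfun.scaleR_right abs_mult)
    then show ?thesis using False ab by (simp add: c_def field_simps)
  qed (simp add: blinfun.zero_right)
qed

lemma dual_norm_add: "dual_norm N (f + g) \<le> dual_norm N f + dual_norm N g"
proof (rule dual_norm_least)
  fix x assume "N x \<le> 1"
  then have "\<bar>blinfun_apply f x\<bar> \<le> dual_norm N f" "\<bar>blinfun_apply g x\<bar> \<le> dual_norm N g"
    by (auto intro: dual_norm_upper)
  then show "\<bar>blinfun_apply (f + g) x\<bar> \<le> dual_norm N f + dual_norm N g"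
    by (simp add: blinfun.add_left)
qed

lemma dual_norm_scaleR: "dual_norm N (c *\<^sub>R f) = \<bar>c\<bar> * dual_norm N f"
proof -
  have le: "dual_norm N (c *\<^sub>R f) \<le> \<bar>c\<bar> * dual_norm N f" for c f
    by (rule dual_norm_least) (simp add: blinfun.scaleR_left abs_mult mult_left_mono dual_norm_upper)
  show ?thesis
  proof (cases "c = 0")
    case True
    then show ?thesis using le[of 0 f] dual_norm_nonneg[of 0] by simp
  next
    case False
    then have "dual_norm N f \<le> \<bar>inverse c\<bar> * dual_norm N (c *\<^sub>R f)"
      using le[of "inverse c" "c *\<^sub>R f"] by simp
    then have "\<bar>c\<bar> * dual_norm N f \<le> dual_norm N (c *\<^sub>R f)"
      using False by (simp add: field_simps)
    then show ?thesis using le[of c f] by simp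
  qed
qed

text \<open>The unit ball is an intersection of weak-star closed slabs inside a compact multiple of
  the original dual ball.\<close>

lemma dual_norm_space_dual_norm: "dual_norm_space (\<lambda>\<phi>. dual_norm N (functional \<phi>))"
proof
  let ?K = "{\<phi>. dual_norm N (functional \<phi>) \<le> 1}"
  interpret norm: dual_norm_space "\<lambda>\<phi> :: 'a weak_dual. norm (functional \<phi>)"
    by (rule dual_norm_space_norm)
  have "?K = (\<Inter>x\<in>{x. N x \<le> 1}. (\<lambda>\<phi>. eval \<phi> x) -` {-1..1})"
  proof (intro equalityI subsetI)
    fix \<phi> assume "\<phi> \<in> ?K"
    then have "\<bar>eval \<phi> x\<bar> \<le> 1" if "N x \<le> 1" for x
      using dual_norm_upper[OF that, of "functional \<phi>"] by (simp add: eval_def)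
    then show "\<phi> \<in> (\<Inter>x\<in>{x. N x \<le> 1}. (\<lambda>\<phi>. eval \<phi> x) -` {-1..1})"
      by (auto simp: abs_le_iff minus_le_iff)
  next
    fix \<phi> assume *: "\<phi> \<in> (\<Inter>x\<in>{x. N x \<le> 1}. (\<lambda>\<phi>. eval \<phi> x) -` {-1..1})"
    have "dual_norm N (functional \<phi>) \<le> 1"
      by (rule dual_norm_least) (use * in \<open>auto simp: eval_def abs_le_iff minus_le_iff\<close>)
    then show "\<phi> \<in> ?K" by simp
  qed
  then have "closed ?K"
    by (simp only:) (intro closed_INT ballI closed_vimage continuous_on_eval closed_atLeastAtMost)
  from closed_Int_compact[OF this norm.compact_nm_ball[OF ab(2)]]
  have "compact (?K \<inter> {\<phi>. norm (functional \<phi>) \<le> b})" .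
  moreover have "norm (functional \<phi>) \<le> b" if "\<phi> \<in> ?K" for \<phi>
    using order_trans[OF norm_le_dual_norm mult_left_mono[of "dual_norm N (functional \<phi>)" 1 b]] that ab
    by simp
  then have "?K \<inter> {\<phi>. norm (functional \<phi>) \<le> b} = ?K" by blast
  ultimately show "compact ?K" by simp
qed (simp_all add: dual_norm_add dual_norm_scaleR)

end

text \<open>\<open>N\<close> is the support function of \<open>K\<close>, and that its dual ball is
  again \<open>K\<close> is the bipolar theorem.\<close>

lemma equivalent_norm_of_dual_ball:
  fixes K :: "'a::real_normed_vector weak_dual set"
  assumes K: "compact K" "convex K" and sym: "\<And>\<phi>. \<phi> \<in> K \<Longrightarrow> - \<phi> \<in> K"
    and K_bounds: "{\<phi>. norm (functional \<phi>) \<le> 1 / 2} \<subseteq> K" "K \<subseteq> {\<phi>. norm (functional \<phi>) \<le> 1}"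
  obtains N where "equivalent_norm N" "{\<phi>. dual_norm N (functional \<phi>) \<le> 1} = K"
    "\<And>x. norm x / 2 \<le> N x" "\<And>x. N x \<le> norm x"
proof -
  define N where "N x = (SUP \<phi>\<in>K. \<bar>eval \<phi> x\<bar>)" for x :: 'a
  have zero: "0 \<in> K" using K_bounds(1) by auto
  have le_norm: "\<bar>eval \<phi> x\<bar> \<le> norm x" if "\<phi> \<in> K" for \<phi> x
  proof -
    have "norm (functional \<phi>) \<le> 1" using that K_bounds(2) by blast
    then show ?thesis
      using norm_blinfun[of "functional \<phi>" x] mult_right_mono[of "norm (functional \<phi>)" 1 "norm x"]
      by (simp add: eval_def)
  qed
  have upper: "\<bar>eval \<phi> x\<bar> \<le> N x" if "\<phi> \<in> K" for \<phi> x
    unfolding N_def by (rule cSUP_upper[OF that]) (auto intro!: bdd_aboveI[of _ "norm x"] le_norm)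
  have least: "N x \<le> c" if "\<And>\<phi>. \<phi> \<in> K \<Longrightarrow> \<bar>eval \<phi> x\<bar> \<le> c" for x c
    unfolding N_def by (rule cSUP_least) (use zero that in auto)
  have N_le: "N x \<le> norm x" for x by (rule least) (rule le_norm)
  have N_ge: "norm x / 2 \<le> N x" for x
  proof -
    \<comment> \<open>Half of a norming functional lies in the ball of radius \<open>1 / 2\<close>,
      which is known to be inside \<open>K\<close>.\<close>
    obtain f where f: "norm f \<le> 1" "blinfun_apply f x = norm x" by (rule norming_functional)
    have "weak_dual ((1 / 2) *\<^sub>R f) \<in> K" using K_bounds(1) f(1) by auto
    from upper[OF this, of x] show ?thesis using f(2) by (simp add: eval_def blinfun.scaleR_left)
  qed
  have N_zero: "N x = 0 \<longleftrightarrow> x = 0" for x using N_le[of x] N_ge[of x] by auto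
  have N_scaleR: "N (c *\<^sub>R x) = \<bar>c\<bar> * N x" for c x
  proof -
    have le: "N (c *\<^sub>R x) \<le> \<bar>c\<bar> * N x" for c x
      by (rule least) (simp add: abs_mult mult_left_mono upper)
    show ?thesis
    proof (cases "c = 0")
      case False
      then have "N x \<le> \<bar>inverse c\<bar> * N (c *\<^sub>R x)"
        using le[of "inverse c" "c *\<^sub>R x"] by simp
      then have "\<bar>c\<bar> * N x \<le> N (c *\<^sub>R x)" using False by (simp add: field_simps)
      then show ?thesis using le[of c x] by simp
    qed (simp add: N_zero)
  qed
  have N_add: "N (x + y) \<le> N x + N y" for x y
  proof (rule least)
    fix \<phi> assume "\<phi> \<in> K"
    from upper[OF this, of x] upper[OF this, of y]
    show "\<bar>eval \<phi> (x + y)\<bar> \<le> N x + N y" by simp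
  qed
  have "equivalent_norm N"
    unfolding equivalent_norm_def using N_zero N_add N_scaleR N_le N_ge
    by (intro conjI allI exI[of _ "1 / 2"] exI[of _ 1]) auto
  moreover have "{\<phi>. dual_norm N (functional \<phi>) \<le> 1} = K"
  proof (intro equalityI subsetI)
    fix \<phi> assume "\<phi> \<in> K"
    have "dual_norm N (functional \<phi>) \<le> 1"
      unfolding dual_norm_def
    proof (rule cSUP_least)
      show "{x. N x \<le> 1} \<noteq> {}" using N_zero[of 0] by (auto intro: exI[of _ 0])
      show "\<bar>blinfun_apply (functional \<phi>) x\<bar> \<le> 1" if "x \<in> {x. N x \<le> 1}" for x
        using upper[OF \<open>\<phi> \<in> K\<close>, of x] that by (simp add: eval_def)
    qed
    then show "\<phi> \<in> {\<phi>. dual_norm N (functional \<phi>) \<le> 1}" by simp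
  next
    fix \<phi> assume \<phi>: "\<phi> \<in> {\<phi>. dual_norm N (functional \<phi>) \<le> 1}"
    show "\<phi> \<in> K"
    proof (rule ccontr)
      assume not: "\<phi> \<notin> K"
      have "K \<noteq> {}" using zero by blast
      then obtain x c where sep: "\<And>\<psi>. \<psi> \<in> K \<Longrightarrow> eval \<psi> x \<le> c" "c < eval \<phi> x"
        using weak_dual_separation[OF K _ not] by blast
      have N_c: "N x \<le> c"
      proof (rule least)
        fix \<psi> assume "\<psi> \<in> K"
        then show "\<bar>eval \<psi> x\<bar> \<le> c" using sep(1)[of \<psi>] sep(1)[OF sym, of \<psi>] by simp
      qed
      have "x \<noteq> 0" using sep(1)[OF zero] sep(2) by auto
      then have c: "0 < c" using N_c N_ge[of x] by (smt (verit) zero_less_norm_iff divide_pos_pos)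
      \<comment> \<open>Normalising the separating vector by \<open>c\<close> gives
        \<open>N\<close>-norm at most 1, while \<phi> exceeds 1 on it.\<close>
      define y where "y = (1 / c) *\<^sub>R x"
      have "N y \<le> 1" using N_c c by (simp add: y_def N_scaleR)
      moreover have "1 < \<bar>blinfun_apply (functional \<phi>) y\<bar>"
        using sep(2) c by (simp add: y_def eval_def blinfun.scaleR_right abs_mult)
      moreover have "\<bar>blinfun_apply (functional \<phi>) y\<bar> \<le> dual_norm N (functional \<phi>)" if "N y \<le> 1"
      proof (rule dual_norm_upper[of N "1 / 2" 1, OF _ N_scaleR _ _ _ _ that])
        show "1 / 2 * norm x \<le> N x" for x using N_ge[of x] by simp
        show "N x \<le> 1 * norm x" for x using N_le[of x] by simp
      qed (simp_all add: N_zero)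
      ultimately show False using \<phi> by simp
    qed
  qed
  ultimately show ?thesis using that N_ge N_le by blast
qed

section \<open>Comparison of the derivations\<close>

lemma weak_dual_image_mem [simp]: "\<phi> \<in> weak_dual ` A \<longleftrightarrow> functional \<phi> \<in> A"
  by (metis functional_inverse functional_inverse' image_iff)

lemma weak_dual_eq_iff [simp]: "weak_dual f = weak_dual g \<longleftrightarrow> f = g"
  by (metis functional_inverse')

lemma openin_weak_star_iff: "openin weak_star V \<longleftrightarrow> open (weak_dual ` V)"
proof -
  have "weak_dual -` weak_dual ` V = V" by (simp add: set_eq_iff)
  then show ?thesis by (simp add: open_weak_dual_def)
qed

lemma closedin_weak_star: "closed U \<Longrightarrow> closedin weak_star (weak_dual -` U)"
  unfolding closedin_def
  by (simp add: strong_operator_topology_topspace closed_def open_weak_dual_def flip: vimage_Compl Compl_eq_Diff_UNIV)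

text \<open>Boundedness of \<open>A\<close> supplies a cover, so the infimum is taken over a
  nonempty set and has its intended meaning.\<close>

lemma kuratowski_ge_iff:
  assumes A: "A \<subseteq> {f. M f \<le> R}"
  shows "\<epsilon> \<le> kuratowski M A \<longleftrightarrow> \<not> small (\<lambda>\<phi>. M (functional \<phi>)) \<epsilon> (weak_dual ` A)"
proof -
  let ?X = "{e. 0 < e \<and> (\<exists>C. finite C \<and> A \<subseteq> (\<Union>c\<in>C. {f. M (f - c) \<le> e / 2}))}"
  have "M f \<le> max 1 (2 * R) / 2" if "f \<in> A" for f using A that by fastforce
  \<comment> \<open>One ball around 0 covers \<open>A\<close>; the maximum with 1 keeps the diameter
    positive.\<close>
  then have "max 1 (2 * R) \<in> ?X"
    by (intro CollectI conjI exI[of _ "{0}"]) auto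
  then have ne: "?X \<noteq> {}" by blast
  have "bdd_below ?X" by (intro bdd_belowI[of _ 0]) auto
  then have "\<epsilon> \<le> kuratowski M A \<longleftrightarrow> (\<forall>e\<in>?X. \<epsilon> \<le> e)"
    unfolding kuratowski_def using ne by (intro le_cInf_iff)
  also have "\<dots> \<longleftrightarrow> \<not> small (\<lambda>\<phi>. M (functional \<phi>)) \<epsilon> (weak_dual ` A)"
  proof -
    have "(\<exists>C. finite C \<and> A \<subseteq> (\<Union>c\<in>C. {f. M (f - c) \<le> e / 2})) \<longleftrightarrow>
        (\<exists>C. finite C \<and> weak_dual ` A \<subseteq> (\<Union>c\<in>C. {\<phi>. M (functional (\<phi> - c)) \<le> e / 2}))" (is "?L \<longleftrightarrow> ?R") for e
    proof
      assume ?L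
      then obtain C where C: "finite C" "A \<subseteq> (\<Union>c\<in>C. {f. M (f - c) \<le> e / 2})" by blast
      then show ?R by (intro exI[of _ "weak_dual ` C"]) fastforce
    next
      assume ?R
      then obtain C where C: "finite C" "weak_dual ` A \<subseteq> (\<Union>c\<in>C. {\<phi>. M (functional (\<phi> - c)) \<le> e / 2})" by blast
      then show ?L by (intro exI[of _ "functional ` C"]) fastforce
    qed
    then show ?thesis unfolding small_def Ball_def mem_Collect_eq by (meson not_le)
  qed
  finally show ?thesis .
qed

text \<open>Inside every open \<open>V\<close> around \<phi> there is an open \<open>W\<close> whose
  closure stays in \<open>V\<close>, which turns traces on closures into traces on open sets. The
  converse uses that a neighbourhood lies in its closure.\<close>

lemma szlenk_deriv_eq:
  fixes M :: "('a::real_normed_vector \<Rightarrow>\<^sub>L real) \<Rightarrow> real"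
  assumes A: "A \<subseteq> {f. M f \<le> R}"
  shows "weak_dual ` szlenk_deriv M \<epsilon> A = szd (\<lambda>\<phi>. M (functional \<phi>)) \<epsilon> (weak_dual ` A)"
proof (rule set_eqI)
  fix \<phi> :: "'a weak_dual"
  let ?small = "small (\<lambda>\<phi>. M (functional \<phi>)) \<epsilon>"
  have K: "\<epsilon> \<le> kuratowski M (A \<inter> B) \<longleftrightarrow> \<not> ?small (weak_dual ` (A \<inter> B))" for B
    by (rule kuratowski_ge_iff) (use A in blast)
  show "\<phi> \<in> weak_dual ` szlenk_deriv M \<epsilon> A \<longleftrightarrow> \<phi> \<in> szd (\<lambda>\<phi>. M (functional \<phi>)) \<epsilon> (weak_dual ` A)"
  proof
    assume "\<phi> \<in> weak_dual ` szlenk_deriv M \<epsilon> A"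
    then have \<phi>: "functional \<phi> \<in> A"
      "\<And>U V. openin weak_star V \<Longrightarrow> functional \<phi> \<in> V \<Longrightarrow> V \<subseteq> U \<Longrightarrow>
        \<not> ?small (weak_dual ` (A \<inter> weak_star closure_of U))"
      unfolding weak_dual_image_mem szlenk_deriv_def K by blast+
    have "\<not> ?small (weak_dual ` A \<inter> V)" if V: "open V" "\<phi> \<in> V" for V
    proof -
      have "open {\<psi>. \<psi> - (- \<phi>) \<in> V}" by (rule open_translation'[OF V(1)])
      moreover have "0 \<in> {\<psi>. \<psi> - (- \<phi>) \<in> V}" using V(2) by simp
      ultimately obtain U where U: "closed U" "convex U" "0 \<in> interior U" "U \<subseteq> {\<psi>. \<psi> - (- \<phi>) \<in> V}"
        by (rule locally_convex)
      define W where "W = {\<psi>. \<psi> - \<phi> \<in> interior U}"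
      have W: "open W" "\<phi> \<in> W" using U(3) by (auto simp: W_def open_translation')
      have "closed ((\<lambda>\<psi>. \<psi> - \<phi>) -` U)" using U(1) by (intro closed_vimage continuous_intros)
      then have "closedin weak_star (weak_dual -` (\<lambda>\<psi>. \<psi> - \<phi>) -` U)" by (rule closedin_weak_star)
      then have cl: "weak_star closure_of (weak_dual -` W) \<subseteq> weak_dual -` (\<lambda>\<psi>. \<psi> - \<phi>) -` U"
        using interior_subset[of U] by (intro closure_of_minimal) (auto simp: W_def)
      have sub: "weak_dual ` (A \<inter> weak_star closure_of (weak_dual -` W)) \<subseteq> weak_dual ` A \<inter> V"
      proof
        fix \<psi> assume "\<psi> \<in> weak_dual ` (A \<inter> weak_star closure_of (weak_dual -` W))"
        then have "functional \<psi> \<in> A" "\<psi> - \<phi> \<in> U" using cl by auto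
        then show "\<psi> \<in> weak_dual ` A \<inter> V" using U(4) by auto
      qed
      have "\<not> ?small (weak_dual ` (A \<inter> weak_star closure_of (weak_dual -` W)))"
        using W by (intro \<phi>(2)[of "weak_dual -` W"]) (auto simp: open_weak_dual_def)
      then show ?thesis using small_subset[OF _ sub] by blast
    qed
    then show "\<phi> \<in> szd (\<lambda>\<phi>. M (functional \<phi>)) \<epsilon> (weak_dual ` A)"
      unfolding szd_def using \<phi>(1) by simp
  next
    assume \<phi>: "\<phi> \<in> szd (\<lambda>\<phi>. M (functional \<phi>)) \<epsilon> (weak_dual ` A)"
    have "\<not> ?small (weak_dual ` (A \<inter> weak_star closure_of U))"
      if V: "openin weak_star V" "functional \<phi> \<in> V" "V \<subseteq> U" for U V
    proof -
      have "\<not> ?small (weak_dual ` A \<inter> weak_dual ` V)"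
        using \<phi> V(1,2) unfolding szd_def openin_weak_star_iff by auto
      moreover have "V \<subseteq> weak_star closure_of U"
        using closure_of_subset[of U weak_star] V(3)
        unfolding strong_operator_topology_topspace by blast
      then have "weak_dual ` A \<inter> weak_dual ` V \<subseteq> weak_dual ` (A \<inter> weak_star closure_of U)"
        by auto
      ultimately show ?thesis using small_subset by blast
    qed
    then show "\<phi> \<in> weak_dual ` szlenk_deriv M \<epsilon> A"
      using \<phi> unfolding weak_dual_image_mem szlenk_deriv_def K szd_def by auto
  qed
qed

lemma szlenk_derived_eq:
  fixes \<gamma> :: "'o ordinal" and M :: "('a::real_normed_vector \<Rightarrow>\<^sub>L real) \<Rightarrow> real"
  assumes inf: "infinite (UNIV :: 'o set)" and A: "A \<subseteq> {f. M f \<le> R}"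
  shows "weak_dual ` szlenk_derived M \<epsilon> \<gamma> A = sz (\<lambda>\<phi>. M (functional \<phi>)) \<epsilon> \<gamma> (weak_dual ` A)"
  unfolding szlenk_derived_def
proof (induction \<gamma> rule: ordinal_induct[OF inf, case_names zero suc limit])
  case zero
  then show ?case by (simp add: transrec_ozero sz_zero)
next
  case (suc \<gamma>)
  \<comment> \<open>Stages stay inside \<open>A\<close>, so the bound \<open>R\<close> persists and
    a single derivation can be compared.\<close>
  have "transrec A (szlenk_deriv M \<epsilon>) Inter \<gamma> \<subseteq> transrec A (szlenk_deriv M \<epsilon>) Inter (ozero :: 'o ordinal)"
    by (rule transrec_antimono[OF inf _ ozero_le]) (auto simp: szlenk_deriv_def)
  then have "transrec A (szlenk_deriv M \<epsilon>) Inter \<gamma> \<subseteq> {f. M f \<le> R}"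
    using A by (simp add: transrec_ozero)
  from szlenk_deriv_eq[OF this, of \<epsilon>] show ?case
    by (simp add: transrec_suc[OF inf] sz_suc[OF inf] suc)
next
  case (limit \<gamma>)
  obtain j where j: "j \<in> {..<\<gamma>}" using olimit_lessThan_nonempty[OF limit.hyps] by blast
  have "inj weak_dual" by (simp add: inj_def)
  then have "weak_dual ` transrec A (szlenk_deriv M \<epsilon>) Inter \<gamma> =
      (\<Inter>\<beta>\<in>{..<\<gamma>}. weak_dual ` transrec A (szlenk_deriv M \<epsilon>) Inter \<beta>)"
    unfolding transrec_olimit[OF limit.hyps] by (rule image_INT[OF _ _ j]) simp
  also have "\<dots> = (\<Inter>\<beta>\<in>{..<\<gamma>}. sz (\<lambda>\<phi>. M (functional \<phi>)) \<epsilon> \<beta> (weak_dual ` A))"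
    using limit.IH by (intro INF_cong) auto
  finally show ?case by (simp only: sz_limit[OF limit.hyps])
qed

section \<open>The index and the Kadets-Klee condition in terms of the abstract derivation\<close>

lemma infinite_functions: "infinite (UNIV :: ('a \<Rightarrow> real) set)"
proof
  assume "finite (UNIV :: ('a \<Rightarrow> real) set)"
  moreover have "inj (\<lambda>(r :: real) (x :: 'a). r)" by (rule injI) (metis)
  ultimately have "finite (UNIV :: real set)" using finite_imageD finite_subset subset_UNIV by metis
  then show False using infinite_UNIV_char_0 by blast
qed

text \<open>Derived sets decrease, so the least empty stage is at most \<gamma> exactly when stage
  \<gamma> is empty. If no ordinal serves all \<epsilon>, the index is \<open>top.Top\<close> and
  both sides fail.\<close>

lemma Sz_le_iff:
  fixes \<gamma> :: "'a::real_normed_vector dual_ordinal"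
  shows "Sz TYPE('a) \<le> top.Value \<gamma> \<longleftrightarrow>
    (\<forall>\<epsilon>>0. sz (\<lambda>\<phi> :: 'a weak_dual. norm (functional \<phi>)) \<epsilon> \<gamma> {\<phi>. norm (functional \<phi>) \<le> 1} = {})"
proof -
  let ?B = "cball 0 1 :: ('a \<Rightarrow>\<^sub>L real) set"
  let ?P = "\<lambda>s. \<forall>\<epsilon>>0. Sz_eps norm ?B \<epsilon> \<le> s"
  let ?d = "\<lambda>\<epsilon> (\<gamma> :: 'a dual_ordinal). szlenk_derived norm \<epsilon> \<gamma> ?B"
  have inf: "infinite (UNIV :: ('a \<Rightarrow> real) set)" by (rule infinite_functions)
  have anti: "?d \<epsilon> \<gamma> \<subseteq> ?d \<epsilon> \<beta>" if "\<beta> \<le> \<gamma>" for \<epsilon> and \<beta> \<gamma> :: "'a dual_ordinal"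
    unfolding szlenk_derived_def
    by (rule transrec_antimono[OF inf _ that]) (auto simp: szlenk_deriv_def)
  have eps: "Sz_eps norm ?B \<epsilon> \<le> top.Value \<gamma> \<longleftrightarrow> ?d \<epsilon> \<gamma> = {}" for \<epsilon> and \<gamma> :: "'a dual_ordinal"
  proof (cases "\<exists>\<beta> :: 'a dual_ordinal. ?d \<epsilon> \<beta> = {}")
    case True
    then have L: "?d \<epsilon> (LEAST \<beta>. ?d \<epsilon> \<beta> = {}) = {}" by (rule LeastI_ex)
    have "(LEAST \<beta>. ?d \<epsilon> \<beta> = {}) \<le> \<gamma> \<longleftrightarrow> ?d \<epsilon> \<gamma> = {}"
      using anti[of "LEAST \<beta>. ?d \<epsilon> \<beta> = {}" \<gamma> \<epsilon>] L Least_le[of "\<lambda>\<beta>. ?d \<epsilon> \<beta> = {}" \<gamma>] by blast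
    then show ?thesis using True by (simp add: Sz_eps_def less_eq_top_def)
  next
    case False
    then show ?thesis by (simp add: Sz_eps_def less_eq_top_def)
  qed
  have "Sz TYPE('a) \<le> top.Value \<gamma> \<longleftrightarrow> ?P (top.Value \<gamma>)"
  proof (cases "\<exists>\<beta>. ?P (top.Value \<beta>)")
    case True
    define l where "l = (LEAST \<beta>. ?P (top.Value \<beta>))"
    have l: "?P (top.Value l)" unfolding l_def using True by (rule LeastI_ex)
    have least: "l \<le> \<beta>" if "?P (top.Value \<beta>)" for \<beta> unfolding l_def using that by (rule Least_le)
    have "Sz TYPE('a) = top.Value l"
      unfolding Sz_def Sz_set_def
    proof (rule Least_equality)
      show "?P (top.Value l)" by (rule l)
      fix s assume "?P s"
      then show "top.Value l \<le> s" using least by (cases s) (auto simp: less_eq_top_def)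
    qed
    then have "Sz TYPE('a) \<le> top.Value \<gamma> \<longleftrightarrow> l \<le> \<gamma>" by (simp add: less_eq_top_def)
    also have "\<dots> \<longleftrightarrow> ?P (top.Value \<gamma>)"
    proof
      assume "l \<le> \<gamma>"
      then have "top.Value l \<le> top.Value \<gamma>" by (simp add: less_eq_top_def)
      then show "?P (top.Value \<gamma>)" using l order_trans by blast
    qed (rule least)
    finally show ?thesis .
  next
    case False
    have "Sz TYPE('a) = top.Top"
      unfolding Sz_def Sz_set_def
    proof (rule Least_equality)
      show "?P top.Top" by (simp add: less_eq_top_def)
      fix s assume "?P s"
      then show "top.Top \<le> s" using False by (cases s) auto
    qed
    then have "\<not> Sz TYPE('a) \<le> top.Value \<gamma>" by (simp add: less_eq_top_def)
    then show ?thesis using False by blast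
  qed
  also have "\<dots> \<longleftrightarrow> (\<forall>\<epsilon>>0. ?d \<epsilon> \<gamma> = {})" by (simp only: eps)
  also have "\<dots> \<longleftrightarrow> (\<forall>\<epsilon>>0. sz (\<lambda>\<phi> :: 'a weak_dual. norm (functional \<phi>)) \<epsilon> \<gamma> {\<phi>. norm (functional \<phi>) \<le> 1} = {})"
  proof -
    have "weak_dual ` ?B = {\<phi>. norm (functional \<phi>) \<le> 1}" by (rule set_eqI) simp
    moreover have "?B \<subseteq> {f. norm f \<le> 1}" by auto
    ultimately show ?thesis
      using szlenk_derived_eq[OF inf, of ?B norm 1 _ \<gamma>] by (metis image_is_empty)
  qed
  finally show ?thesis .
qed

lemma UKK_star_iff:
  fixes \<alpha> :: "'o ordinal"
  assumes inf: "infinite (UNIV :: 'o set)"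
  shows "UKK_star \<alpha> M \<longleftrightarrow> (\<forall>\<epsilon>>0. \<exists>\<delta>>0. \<delta> < 1 \<and>
    sz (\<lambda>\<phi>. M (functional \<phi>)) \<epsilon> (opow oomega \<alpha>) {\<phi>. M (functional \<phi>) \<le> 1} \<subseteq>
      (\<lambda>\<phi>. (1 - \<delta>) *\<^sub>R \<phi>) ` {\<phi>. M (functional \<phi>) \<le> 1})"
proof -
  let ?B = "{f. M f \<le> 1}"
  have ball: "weak_dual ` ?B = {\<phi>. M (functional \<phi>) \<le> 1}" by (rule set_eqI) simp
  have inj: "inj weak_dual" by (simp add: inj_def)
  have scale: "weak_dual ` (\<lambda>f. (1 - \<delta>) *\<^sub>R f) ` ?B = (\<lambda>\<phi>. (1 - \<delta>) *\<^sub>R \<phi>) ` {\<phi>. M (functional \<phi>) \<le> 1}" for \<delta>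
    unfolding ball[symmetric] image_image by (intro image_cong refl) (simp add: scaleR_weak_dual_def)
  have "S \<subseteq> (\<lambda>f. (1 - \<delta>) *\<^sub>R f) ` ?B \<longleftrightarrow>
      weak_dual ` S \<subseteq> (\<lambda>\<phi>. (1 - \<delta>) *\<^sub>R \<phi>) ` {\<phi>. M (functional \<phi>) \<le> 1}" for S \<delta>
    unfolding scale[symmetric] by (rule inj_image_subset_iff[OF inj, symmetric])
  then show ?thesis
    unfolding UKK_star_def using szlenk_derived_eq[where M = M and R = 1, OF inf order_refl] by (simp add: ball)
qed

theorem theorem6p3:
  fixes \<alpha> :: "'a::banach dual_ordinal"
  assumes "separable_space (euclidean :: 'a topology)"
    and "countable {..<\<alpha>}"
  shows "Sz TYPE('a) \<le> top.Value (opow oomega (osuc \<alpha>)) \<longleftrightarrow>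
    (\<exists>N :: 'a \<Rightarrow> real. equivalent_norm N \<and> UKK_star \<alpha> (dual_norm N))"
proof -
  let ?nm = "\<lambda>\<phi> :: 'a weak_dual. norm (functional \<phi>)" and ?D = "opow oomega (osuc \<alpha>)"
  have inf: "infinite (UNIV :: ('a \<Rightarrow> real) set)" by (rule infinite_functions)
  interpret norm: dual_norm_space ?nm by (rule dual_norm_space_norm)
  show ?thesis
    unfolding Sz_le_iff UKK_star_iff[OF inf]
  proof
    assume "\<forall>\<epsilon>>0. sz ?nm \<epsilon> ?D {\<phi>. ?nm \<phi> \<le> 1} = {}"
    then have empty: "sz ?nm \<epsilon> ?D {\<phi>. ?nm \<phi> \<le> 1} = {}" if "0 < \<epsilon>" for \<epsilon> using that by blast
    obtain K where K: "compact K" "convex K" "\<And>\<phi>. \<phi> \<in> K \<Longrightarrow> - \<phi> \<in> K"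
      "{\<phi>. ?nm \<phi> \<le> 1 / 2} \<subseteq> K" "K \<subseteq> {\<phi>. ?nm \<phi> \<le> 1}"
      and ukk: "\<And>\<epsilon>. 0 < \<epsilon> \<Longrightarrow> \<exists>\<delta>>0. \<delta> < 1 \<and> sz ?nm \<epsilon> (opow oomega \<alpha>) K \<subseteq> (\<lambda>\<phi>. (1 - \<delta>) *\<^sub>R \<phi>) ` K"
      using norm.renorming[OF inf empty] by metis
    obtain N where N: "equivalent_norm N" "{\<phi>. dual_norm N (functional \<phi>) \<le> 1} = K"
      "\<And>x. norm x / 2 \<le> N x" "\<And>x. N x \<le> norm x"
      using equivalent_norm_of_dual_ball[OF K] by metis
    have N0: "N 0 = 0" and N_scaleR: "\<And>c x. N (c *\<^sub>R x) = \<bar>c\<bar> * N x"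
      using N(1) by (auto simp: equivalent_norm_def)
    have bound: "dual_norm N f \<le> norm f / (1 / 2)" for f
      by (rule dual_norm_le_norm[of N "1 / 2" 1, OF N0 N_scaleR]) (use N(3,4) in auto)
    have le: "dual_norm N (functional \<phi>) \<le> 2 * ?nm \<phi>" for \<phi>
      using bound[of "functional \<phi>"] by simp
    \<comment> \<open>The inclusion is known for the original dual norm. The new one is at most
      twice as large, so halving \<epsilon> transfers the inclusion for the same set
      \<open>K\<close>.\<close>
    have "\<exists>\<delta>>0. \<delta> < 1 \<and> sz (\<lambda>\<phi>. dual_norm N (functional \<phi>)) \<epsilon> (opow oomega \<alpha>) K \<subseteq> (\<lambda>\<phi>. (1 - \<delta>) *\<^sub>R \<phi>) ` K"
      if "0 < \<epsilon>" for \<epsilon>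
    proof -
      have "sz (\<lambda>\<phi>. dual_norm N (functional \<phi>)) (2 * (\<epsilon> / 2)) (opow oomega \<alpha>) K \<subseteq> sz ?nm (\<epsilon> / 2) (opow oomega \<alpha>) K"
        by (rule norm.sz_compare[OF inf le]) simp
      then show ?thesis using ukk[of "\<epsilon> / 2"] that by (simp, blast)
    qed
    then show "\<exists>N :: 'a \<Rightarrow> real. equivalent_norm N \<and> (\<forall>\<epsilon>>0. \<exists>\<delta>>0. \<delta> < 1 \<and>
        sz (\<lambda>\<phi>. dual_norm N (functional \<phi>)) \<epsilon> (opow oomega \<alpha>) {\<phi>. dual_norm N (functional \<phi>) \<le> 1} \<subseteq>
          (\<lambda>\<phi>. (1 - \<delta>) *\<^sub>R \<phi>) ` {\<phi>. dual_norm N (functional \<phi>) \<le> 1})"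
      using N(1) unfolding N(2)[symmetric] by blast
  next
    assume "\<exists>N :: 'a \<Rightarrow> real. equivalent_norm N \<and> (\<forall>\<epsilon>>0. \<exists>\<delta>>0. \<delta> < 1 \<and>
        sz (\<lambda>\<phi>. dual_norm N (functional \<phi>)) \<epsilon> (opow oomega \<alpha>) {\<phi>. dual_norm N (functional \<phi>) \<le> 1} \<subseteq>
          (\<lambda>\<phi>. (1 - \<delta>) *\<^sub>R \<phi>) ` {\<phi>. dual_norm N (functional \<phi>) \<le> 1})"
    then obtain N :: "'a \<Rightarrow> real" where N: "equivalent_norm N"
      and ukk: "\<And>\<epsilon>. 0 < \<epsilon> \<Longrightarrow> \<exists>\<delta>>0. \<delta> < 1 \<and>
        sz (\<lambda>\<phi>. dual_norm N (functional \<phi>)) \<epsilon> (opow oomega \<alpha>) {\<phi>. dual_norm N (functional \<phi>) \<le> 1} \<subseteq>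
          (\<lambda>\<phi>. (1 - \<delta>) *\<^sub>R \<phi>) ` {\<phi>. dual_norm N (functional \<phi>) \<le> 1}"
      by blast
    let ?M = "\<lambda>\<phi>. dual_norm N (functional \<phi>)"
    let ?K = "{\<phi>. ?M \<phi> \<le> 1}"
    obtain a b where ab: "0 < a" "0 < b" "\<And>x. a * norm x \<le> N x" "\<And>x. N x \<le> b * norm x"
      using N unfolding equivalent_norm_def by blast
    have N0: "N 0 = 0" and N_scaleR: "\<And>c x. N (c *\<^sub>R x) = \<bar>c\<bar> * N x"
      using N by (auto simp: equivalent_norm_def)
    note dual = N0 N_scaleR ab
    interpret M: dual_norm_space ?M by (rule dual_norm_space_dual_norm[OF dual])
    have le: "?nm \<phi> \<le> b * ?M \<phi>" for \<phi> by (rule norm_le_dual_norm[OF dual])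
    have ball: "{\<phi>. ?nm \<phi> \<le> 1} \<subseteq> (\<lambda>\<phi>. (1 / a) *\<^sub>R \<phi>) ` ?K"
    proof
      fix \<phi> :: "'a weak_dual" assume "\<phi> \<in> {\<phi>. ?nm \<phi> \<le> 1}"
      then have "?M \<phi> \<le> 1 / a"
        using dual_norm_le_norm[OF dual, of "functional \<phi>"] divide_right_mono[of "?nm \<phi>" 1 a] ab by simp
      then have "?M (a *\<^sub>R \<phi>) \<le> 1"
        using ab(1) M.nm_scaleR[of a \<phi>] by (simp add: field_simps)
      then show "\<phi> \<in> (\<lambda>\<phi>. (1 / a) *\<^sub>R \<phi>) ` ?K"
        using ab(1) by (intro image_eqI[of _ _ "a *\<^sub>R \<phi>"]) auto
    qed
    show "\<forall>\<epsilon>>0. sz ?nm \<epsilon> ?D {\<phi>. ?nm \<phi> \<le> 1} = {}"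
    proof (intro allI impI)
      fix \<epsilon> :: real assume \<epsilon>: "0 < \<epsilon>"
      \<comment> \<open>The norm is changed at the cost \<open>b\<close> and the ball is dilated by
        \<open>1 / a\<close>; both alter \<epsilon> only by positive factors, and the derivative of
        \<open>?K\<close> is empty at every positive scale.\<close>
      have "sz ?nm \<epsilon> ?D {\<phi>. ?nm \<phi> \<le> 1} = sz ?nm (b * (\<epsilon> / b)) ?D {\<phi>. ?nm \<phi> \<le> 1}"
        using ab by simp
      also have "\<dots> \<subseteq> sz ?M (\<epsilon> / b) ?D {\<phi>. ?nm \<phi> \<le> 1}"
        by (rule M.sz_compare[OF inf le ab(2)])
      also have "\<dots> \<subseteq> sz ?M (\<epsilon> / b) ?D ((\<lambda>\<phi>. (1 / a) *\<^sub>R \<phi>) ` ?K)"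
        by (rule sz_mono[OF inf ball order_refl])
      also have "\<dots> = sz ?M (\<bar>1 / a\<bar> * (a * \<epsilon> / b)) ?D ((\<lambda>\<phi>. (1 / a) *\<^sub>R \<phi>) ` ?K)"
        using ab by simp
      also have "\<dots> \<subseteq> (\<lambda>\<phi>. (1 / a) *\<^sub>R \<phi>) ` sz ?M (a * \<epsilon> / b) ?D ?K"
        by (rule M.sz_scaleR[OF inf]) (use ab in simp)
      also have "sz ?M (a * \<epsilon> / b) ?D ?K = {}"
        using \<epsilon> ab by (intro M.sz_ball_empty[OF inf] ukk) auto
      finally show "sz ?nm \<epsilon> ?D {\<phi>. ?nm \<phi> \<le> 1} = {}" by simp
    qed
  qed
qed

end
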